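(* Let $G$ be a Carnot group with homogeneous dimension $Q$. There exists a constant $C_{iso}(G)>0$ such that, for every $H$-Caccioppoli set $E\subset G$, one has $$|E|^{(Q-1)/Q}\le C_{iso}(G)\,P_H(E;G).$$
   Context: A Carnot group $G$ is a connected, simply connected nilpotent Lie group whose Lie algebra is graded, $\mathfrak g=V_1\oplus\dots\oplus V_r$, with $[V_1,V_j]=V_{j+1}$ for $1\le j\le r-1$ and $[V_1,V_r]=\{0\}$. With $m_j=\dim V_j$, the homogeneous dimension is $Q=m_1+2m_2+\dots+rm_r$. Haar measure $dg$ is the push-forward of Lebesgue measure on $\mathfrak g$ under the exponential map; $|E|$ is the Haar measure of $E$. Let $m=m_1$, fix an orthonormal basis $e_1,\dots,e_m$ of $V_1$ and let $X_1,\dots,X_m$ be the corresponding left-invariant vector fields. For $\Omega\subset G$ open and $u\in L^1_{loc}(\Omega)$, $Var_H(u;\Omega)=\sup\int u\sum_{i=1}^mX_i\zeta_i\,dg$, the supremum over $\zeta=(\zeta_1,\dots,\zeta_m)$ with $\zeta_i$ and $X_j\zeta_i$ continuous and compactly supported in $\Omega$ for all $i,j$, and $\sup_\Omega(\sum_i\zeta_i^2)^{1/2}\le1$. $BV_H(\Omega)$ is the set of $u\in L^1(\Omega)$ with $Var_H(u;\Omega)<\infty$. For $E$ measurable, $P_H(E;\Omega)=Var_H(\chi_E;\Omega)$, where $\chi_E$ is the indicator function of $E$. A measurable set $E$ is an $H$-Caccioppoli set if $\chi_E\in BV_H(\Omega)$ for every open $\Omega$ relatively compact in $G$.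
   Formalization: The formal theorem assumes in addition that |E| is finite; without this the inequality fails, for example for E = G, which is an H-Caccioppoli set with |E| infinite and P_H(E;G) = 0. *)

theory Defs
  imports "HOL-Analysis.Analysis"
begin

section \<open>Smooth maps and Lie groups\<close>

text \<open>On open sets \<open>U\<close> the predicate \<open>Ck_on k f U\<close> is the usual \<open>C\<^sup>k\<close>: all iterated directional
  derivatives up to order \<open>k\<close> exist, as Frechet derivatives, and are continuous.\<close>

fun Ck_on :: "nat \<Rightarrow> ('a::real_normed_vector \<Rightarrow> 'b::real_normed_vector) \<Rightarrow> 'a set \<Rightarrow> bool" where
  "Ck_on 0 f U \<longleftrightarrow> continuous_on U f"
| "Ck_on (Suc k) f U \<longleftrightarrow>
     (\<forall>x\<in>U. f differentiable (at x)) \<and> (\<forall>v. Ck_on k (\<lambda>x. frechet_derivative f (at x) v) U)"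

definition smooth_on :: "('a::real_normed_vector \<Rightarrow> 'b::real_normed_vector) \<Rightarrow> 'a set \<Rightarrow> bool" where
  "smooth_on f U \<longleftrightarrow> (\<forall>k. Ck_on k f U)"

text \<open>A chart is a pair \<open>(U, \<phi>)\<close>; only the values of \<open>\<phi>\<close> on \<open>U\<close> matter. An atlas need not be
  maximal.\<close>

type_synonym ('g, 'm) chart = "'g set \<times> ('g \<Rightarrow> 'm)"

definition is_chart :: "('g::topological_space, 'm::euclidean_space) chart \<Rightarrow> bool" where
  "is_chart c \<longleftrightarrow> (case c of (U, \<phi>) \<Rightarrow>
     open U \<and> open (\<phi> ` U) \<and> homeomorphism U (\<phi> ` U) \<phi> (inv_into U \<phi>))"

definition smooth_atlas :: "('g::topological_space, 'm::euclidean_space) chart set \<Rightarrow> bool" where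
  "smooth_atlas A \<longleftrightarrow>
     (\<forall>c\<in>A. is_chart c) \<and> (\<Union>(U, \<phi>)\<in>A. U) = UNIV \<and>
     (\<forall>(U, \<phi>)\<in>A. \<forall>(W, \<psi>)\<in>A. smooth_on (\<psi> \<circ> inv_into U \<phi>) (\<phi> ` (U \<inter> W)))"

definition prod_atlas :: "('g, 'm) chart set \<Rightarrow> ('h, 'n) chart set \<Rightarrow> ('g \<times> 'h, 'm \<times> 'n) chart set" where
  "prod_atlas A B = {(U \<times> W, map_prod \<phi> \<psi>) | U \<phi> W \<psi>. (U, \<phi>) \<in> A \<and> (W, \<psi>) \<in> B}"

definition smooth_map ::
  "('g::topological_space, 'm::euclidean_space) chart set \<Rightarrow>
   ('h::topological_space, 'n::euclidean_space) chart set \<Rightarrow> ('g \<Rightarrow> 'h) \<Rightarrow> bool" where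
  "smooth_map A B f \<longleftrightarrow> continuous_on UNIV f \<and>
     (\<forall>(U, \<phi>)\<in>A. \<forall>(W, \<psi>)\<in>B. smooth_on (\<psi> \<circ> f \<circ> inv_into U \<phi>) (\<phi> ` (U \<inter> f -` W)))"

text \<open>The class \<^class>\<open>group_add\<close> does not assume commutativity: in this theory \<open>g + h\<close> is the (in
  general non-commutative) group product, \<open>- g\<close> the inverse and \<open>0\<close> the identity element.\<close>

definition lie_group ::
  "('g::{topological_group_add, t2_space, second_countable_topology}, 'm::euclidean_space) chart set
   \<Rightarrow> bool" where
  "lie_group A \<longleftrightarrow> smooth_atlas A \<and>
     smooth_map (prod_atlas A A) A (\<lambda>(g, h). g + h) \<and> smooth_map A A uminus"

definition smooth_functions ::
  "('g::topological_space, 'm::euclidean_space) chart set \<Rightarrow> ('g \<Rightarrow> real) set" where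
  "smooth_functions A = {f. smooth_map A {(UNIV, id :: real \<Rightarrow> real)} f}"


section \<open>The Lie algebra and the exponential map\<close>

text \<open>Vector fields are derivations of the algebra of smooth functions. They are made total by
  sending every non-smooth function to \<open>0\<close>, so that distinct fields are distinct functionals.\<close>

definition left_invariant_field ::
  "('g::{topological_space, group_add}, 'm::euclidean_space) chart set
   \<Rightarrow> (('g \<Rightarrow> real) \<Rightarrow> ('g \<Rightarrow> real)) \<Rightarrow> bool" where
  "left_invariant_field A X \<longleftrightarrow>
     (\<forall>f\<in>smooth_functions A. X f \<in> smooth_functions A) \<and>
     (\<forall>f\<in>smooth_functions A. \<forall>h\<in>smooth_functions A. \<forall>a b.
        X (\<lambda>g. a * f g + b * h g) = (\<lambda>g. a * X f g + b * X h g)) \<and>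
     (\<forall>f\<in>smooth_functions A. \<forall>h\<in>smooth_functions A.
        X (\<lambda>g. f g * h g) = (\<lambda>g. f g * X h g + X f g * h g)) \<and>
     (\<forall>f\<in>smooth_functions A. \<forall>p. X (\<lambda>g. f (p + g)) = (\<lambda>g. X f (p + g))) \<and>
     (\<forall>f. f \<notin> smooth_functions A \<longrightarrow> X f = (\<lambda>_. 0))"

text \<open>The Lie algebra is carried by the Euclidean space \<open>'v\<close>, which supplies its scalar product (and
  hence its Lebesgue measure), through a linear isomorphism \<open>L\<close> of \<open>'v\<close> onto the space of
  left-invariant vector fields. Here \<open>L v\<close> is the left-invariant field corresponding to \<open>v\<close>.\<close>

definition lie_algebra ::
  "('g::{topological_space, group_add}, 'm::euclidean_space) chart set
   \<Rightarrow> ('v::euclidean_space \<Rightarrow> ('g \<Rightarrow> real) \<Rightarrow> ('g \<Rightarrow> real)) \<Rightarrow> bool" where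
  "lie_algebra A L \<longleftrightarrow>
     bij_betw L UNIV {X. left_invariant_field A X} \<and>
     (\<forall>a b v w f g. L (a *\<^sub>R v + b *\<^sub>R w) f g = a * L v f g + b * L w f g)"

definition lie_bracket ::
  "('v \<Rightarrow> ('g \<Rightarrow> real) \<Rightarrow> ('g \<Rightarrow> real)) \<Rightarrow> 'v \<Rightarrow> 'v \<Rightarrow> 'v" where
  "lie_bracket L v w = (THE z. L z = (\<lambda>f g. L v (L w f) g - L w (L v f) g))"

text \<open>One-parameter subgroups \<open>\<gamma>\<close> with initial velocity \<open>v\<close>. As a homomorphism whose composition with
  every smooth function is differentiable at \<open>0\<close>, \<open>\<gamma>\<close> is automatically smooth.\<close>

definition one_parameter_subgroup ::
  "('g::{topological_space, group_add}, 'm::euclidean_space) chart set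
   \<Rightarrow> ('v \<Rightarrow> ('g \<Rightarrow> real) \<Rightarrow> ('g \<Rightarrow> real)) \<Rightarrow> 'v \<Rightarrow> (real \<Rightarrow> 'g) \<Rightarrow> bool" where
  "one_parameter_subgroup A L v \<gamma> \<longleftrightarrow>
     (\<forall>s t. \<gamma> (s + t) = \<gamma> s + \<gamma> t) \<and>
     (\<forall>f\<in>smooth_functions A. ((f \<circ> \<gamma>) has_real_derivative L v f 0) (at 0))"

definition lie_exp ::
  "('g::{topological_space, group_add}, 'm::euclidean_space) chart set
   \<Rightarrow> ('v \<Rightarrow> ('g \<Rightarrow> real) \<Rightarrow> ('g \<Rightarrow> real)) \<Rightarrow> 'v \<Rightarrow> 'g" where
  "lie_exp A L v = (THE \<gamma>. one_parameter_subgroup A L v \<gamma>) 1"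


section \<open>Carnot groups\<close>

fun upper_central :: "nat \<Rightarrow> 'g::group_add set" where
  "upper_central 0 = {0}"
| "upper_central (Suc n) = {x. \<forall>y. x + y - x - y \<in> upper_central n}"

definition stratification ::
  "('v::euclidean_space \<Rightarrow> ('g \<Rightarrow> real) \<Rightarrow> ('g \<Rightarrow> real)) \<Rightarrow> nat \<Rightarrow> (nat \<Rightarrow> 'v set) \<Rightarrow> bool" where
  "stratification L r V \<longleftrightarrow> r \<ge> 1 \<and>
     (\<forall>j\<in>{1..r}. subspace (V j)) \<and>
     (\<forall>x. \<exists>!c. c \<in> PiE {1..r} V \<and> x = (\<Sum>j=1..r. c j)) \<and>
     (\<forall>j\<in>{1..<r}. span {lie_bracket L x y | x y. x \<in> V 1 \<and> y \<in> V j} = V (j + 1)) \<and>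
     span {lie_bracket L x y | x y. x \<in> V 1 \<and> y \<in> V r} = {0}"

definition carnot_group ::
  "('g::{topological_group_add, t2_space, second_countable_topology}, 'm::euclidean_space) chart set
   \<Rightarrow> ('v::euclidean_space \<Rightarrow> ('g \<Rightarrow> real) \<Rightarrow> ('g \<Rightarrow> real)) \<Rightarrow> nat \<Rightarrow> (nat \<Rightarrow> 'v set) \<Rightarrow> bool" where
  "carnot_group A L r V \<longleftrightarrow>
     lie_group A \<and> connected (UNIV :: 'g set) \<and> simply_connected (UNIV :: 'g set) \<and>
     (\<exists>n. upper_central n = (UNIV :: 'g set)) \<and>
     lie_algebra A L \<and> stratification L r V"

definition homogeneous_dimension :: "nat \<Rightarrow> (nat \<Rightarrow> 'v::euclidean_space set) \<Rightarrow> nat" where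
  "homogeneous_dimension r V = (\<Sum>j=1..r. j * dim (V j))"

text \<open>Haar measure, on the Lebesgue (i.e. completed) rather than just the Borel sets.\<close>

definition haar ::
  "('g::{topological_space, group_add}, 'm::euclidean_space) chart set
   \<Rightarrow> ('v::euclidean_space \<Rightarrow> ('g \<Rightarrow> real) \<Rightarrow> ('g \<Rightarrow> real)) \<Rightarrow> 'g measure" where
  "haar A L = completion (distr lborel borel (lie_exp A L))"

definition orthonormal_basis :: "nat \<Rightarrow> (nat \<Rightarrow> 'v::euclidean_space) \<Rightarrow> 'v set \<Rightarrow> bool" where
  "orthonormal_basis m e W \<longleftrightarrow>
     (\<forall>i\<in>{1..m}. \<forall>j\<in>{1..m}. e i \<bullet> e j = (if i = j then 1 else 0)) \<and> span (e ` {1..m}) = W"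


section \<open>Horizontal variation and perimeter\<close>

text \<open>The action of the left-invariant field of \<open>v\<close> on functions that need not be smooth is the
  derivative along its integral curves \<open>t \<mapsto> g exp(tv)\<close>. \<open>lie_deriv\<close> is meaningful only together with
  \<open>has_lie_deriv\<close>.\<close>

definition has_lie_deriv ::
  "('g::{topological_space, group_add}, 'm::euclidean_space) chart set
   \<Rightarrow> ('v::euclidean_space \<Rightarrow> ('g \<Rightarrow> real) \<Rightarrow> ('g \<Rightarrow> real)) \<Rightarrow> 'v \<Rightarrow> ('g \<Rightarrow> real) \<Rightarrow> bool" where
  "has_lie_deriv A L v u \<longleftrightarrow> (\<forall>g. (\<lambda>t::real. u (g + lie_exp A L (t *\<^sub>R v))) differentiable (at 0))"

definition lie_deriv ::
  "('g::{topological_space, group_add}, 'm::euclidean_space) chart set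
   \<Rightarrow> ('v::euclidean_space \<Rightarrow> ('g \<Rightarrow> real) \<Rightarrow> ('g \<Rightarrow> real)) \<Rightarrow> 'v \<Rightarrow> ('g \<Rightarrow> real) \<Rightarrow> 'g \<Rightarrow> real" where
  "lie_deriv A L v u g = deriv (\<lambda>t::real. u (g + lie_exp A L (t *\<^sub>R v))) 0"

definition continuous_compact_support :: "'g::topological_space set \<Rightarrow> ('g \<Rightarrow> real) \<Rightarrow> bool" where
  "continuous_compact_support \<Omega> f \<longleftrightarrow> continuous_on UNIV f \<and>
     compact (closure {x. f x \<noteq> 0}) \<and> closure {x. f x \<noteq> 0} \<subseteq> \<Omega>"

definition test_fields ::
  "('g::{topological_space, group_add}, 'm::euclidean_space) chart set
   \<Rightarrow> ('v::euclidean_space \<Rightarrow> ('g \<Rightarrow> real) \<Rightarrow> ('g \<Rightarrow> real))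
   \<Rightarrow> nat \<Rightarrow> (nat \<Rightarrow> 'v) \<Rightarrow> 'g set \<Rightarrow> (nat \<Rightarrow> 'g \<Rightarrow> real) set" where
  "test_fields A L m e \<Omega> = {\<zeta>.
     (\<forall>i\<in>{1..m}. continuous_compact_support \<Omega> (\<zeta> i)) \<and>
     (\<forall>i\<in>{1..m}. \<forall>j\<in>{1..m}. has_lie_deriv A L (e j) (\<zeta> i) \<and>
        continuous_compact_support \<Omega> (lie_deriv A L (e j) (\<zeta> i))) \<and>
     (\<forall>g\<in>\<Omega>. sqrt (\<Sum>i=1..m. (\<zeta> i g)\<^sup>2) \<le> 1)}"

definition Var_H ::
  "('g::{topological_space, group_add}, 'm::euclidean_space) chart set
   \<Rightarrow> ('v::euclidean_space \<Rightarrow> ('g \<Rightarrow> real) \<Rightarrow> ('g \<Rightarrow> real))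
   \<Rightarrow> nat \<Rightarrow> (nat \<Rightarrow> 'v) \<Rightarrow> ('g \<Rightarrow> real) \<Rightarrow> 'g set \<Rightarrow> ereal" where
  "Var_H A L m e u \<Omega> = (SUP \<zeta>\<in>test_fields A L m e \<Omega>.
     ereal (LINT g:\<Omega>|haar A L. u g * (\<Sum>i=1..m. lie_deriv A L (e i) (\<zeta> i) g)))"

definition BV_H ::
  "('g::{topological_space, group_add}, 'm::euclidean_space) chart set
   \<Rightarrow> ('v::euclidean_space \<Rightarrow> ('g \<Rightarrow> real) \<Rightarrow> ('g \<Rightarrow> real))
   \<Rightarrow> nat \<Rightarrow> (nat \<Rightarrow> 'v) \<Rightarrow> 'g set \<Rightarrow> ('g \<Rightarrow> real) set" where
  "BV_H A L m e \<Omega> = {u. set_integrable (haar A L) \<Omega> u \<and> Var_H A L m e u \<Omega> < \<infinity>}"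

definition P_H ::
  "('g::{topological_space, group_add}, 'm::euclidean_space) chart set
   \<Rightarrow> ('v::euclidean_space \<Rightarrow> ('g \<Rightarrow> real) \<Rightarrow> ('g \<Rightarrow> real))
   \<Rightarrow> nat \<Rightarrow> (nat \<Rightarrow> 'v) \<Rightarrow> 'g set \<Rightarrow> 'g set \<Rightarrow> ereal" where
  "P_H A L m e E \<Omega> = Var_H A L m e (indicator E) \<Omega>"

definition H_Caccioppoli ::
  "('g::{topological_space, group_add}, 'm::euclidean_space) chart set
   \<Rightarrow> ('v::euclidean_space \<Rightarrow> ('g \<Rightarrow> real) \<Rightarrow> ('g \<Rightarrow> real))
   \<Rightarrow> nat \<Rightarrow> (nat \<Rightarrow> 'v) \<Rightarrow> 'g set \<Rightarrow> bool" where
  "H_Caccioppoli A L m e E \<longleftrightarrow> E \<in> sets (haar A L) \<and>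
     (\<forall>\<Omega>. open \<Omega> \<and> compact (closure \<Omega>) \<longrightarrow> indicator E \<in> BV_H A L m e \<Omega>)"

end

theory Submission
  imports Defs
begin

text \<open>Translating a set \<open>E\<close> by \<open>exp (t e\<^sub>i)\<close> from the right moves at most \<open>\<bar>t\<bar> P\<^sub>H(E)\<close> of its mass out of
  \<open>E\<close>, so for a product \<open>w\<close> of \<open>k\<close> such elements with \<open>\<bar>t\<bar> \<le> s\<close> the loss is at most \<open>k s P\<^sub>H(E)\<close>. As
  \<open>V\<^sub>1\<close> generates, for some \<open>k\<close> these products fill a set \<open>S\<^sub>s\<close> of measure \<open>s\<^sup>Q \<bar>S\<^sub>1\<bar> > 0\<close>. Choose \<open>s\<close> with
  \<open>\<bar>S\<^sub>s\<bar> = 2 \<bar>E\<bar>\<close>: averaged over \<open>w \<in> S\<^sub>s\<close>, at least half of the mass is lost, so \<open>\<bar>E\<bar> \<le> 2 k s P\<^sub>H(E)\<close> with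
  \<open>s\<close> proportional to \<open>\<bar>E\<bar>\<^sup>1\<^sup>/\<^sup>Q\<close>.

  Only the exponential coordinates are needed: \<open>exp\<close> is a homomorphism for the Baker-Campbell-Hausdorff
  law \<open>mul\<close>, obtained as the solution of an ordinary differential equation. Right translations are
  compositions of shears, hence preserve Lebesgue measure, and so do left translations, as inversion is
  \<open>x \<mapsto> - x\<close>. Injectivity of \<open>exp\<close> is not proved: without it, a set of finite measure is null.\<close>

section \<open>Calculus of \<open>C\<^sup>k\<close> maps\<close>

text \<open>The group is given by an atlas and its Lie algebra by derivations of the globally smooth
  functions, so no computation can be done in coordinates until \<open>exp\<close> is understood.
  Curves in the group are therefore differentiated through their compositions with smooth functions,
  and the calculus below provides enough of these: bump functions, and Hadamard's expansion to
  recognise derivations as first order operators. Differentiability of \<open>exp\<close> comes from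
  the curve exp(-sz) exp(sx), whose logarithmic derivative is explicit.

  Averaging wins because the mass that is not lost, integrated over all w, is exactly |E|^2, by
  Fubini and left invariance. The shape of the set of products is never described: all products
  together exhaust the coordinate space, which is then a countable union of compact sets, so one of
  them has positive measure, and dilations supply the scaling.

  An injective \<open>exp\<close> is open by invariance of domain, so that test functions on the Lie
  algebra extend by zero to the group.\<close>

lemma Ck_on_SucD:
  assumes "Ck_on (Suc k) f U" "x \<in> U"
  shows "(f has_derivative frechet_derivative f (at x)) (at x)"
  using assms by (auto simp: frechet_derivative_works)

lemma Ck_on_cong:
  assumes "open U" "\<And>x. x \<in> U \<Longrightarrow> f x = g x" "Ck_on k f U"
  shows "Ck_on k g U"
  using assms(2,3)
proof (induction k arbitrary: f g)
  case 0
  then show ?case using continuous_on_cong[of U U f g] by simp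
next
  case (Suc k)
  have d: "(g has_derivative frechet_derivative f (at x)) (at x)" if "x \<in> U" for x
    using has_derivative_transform_within_open[OF Ck_on_SucD[OF Suc.prems(2) that] assms(1) that, of g] Suc.prems(1)
    by auto
  have e: "frechet_derivative f (at x) = frechet_derivative g (at x)" if "x \<in> U" for x
    using frechet_derivative_at[OF d[OF that]] by simp
  have "Ck_on k (\<lambda>x. frechet_derivative g (at x) v) U" for v
    by (rule Suc.IH[of "\<lambda>x. frechet_derivative f (at x) v"]) (use Suc.prems(2) e in auto)
  then show ?case using d by (auto simp: differentiable_def)
qed

lemma Ck_on_SucI:
  assumes "open U" "\<And>x. x \<in> U \<Longrightarrow> (f has_derivative f' x) (at x)" "\<And>v. Ck_on k (\<lambda>x. f' x v) U"
  shows "Ck_on (Suc k) f U"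
proof -
  have e: "f' x = frechet_derivative f (at x)" if "x \<in> U" for x
    using frechet_derivative_at[OF assms(2)[OF that]] .
  have "Ck_on k (\<lambda>x. frechet_derivative f (at x) v) U" for v
    by (rule Ck_on_cong[OF assms(1) _ assms(3)[of v]]) (simp add: e)
  then show ?thesis using assms(2) by (auto simp: differentiable_def)
qed

lemma Ck_on_subset: "Ck_on k f U \<Longrightarrow> V \<subseteq> U \<Longrightarrow> Ck_on k f V"
  by (induction k arbitrary: f) (auto intro: continuous_on_subset)

lemma Ck_on_imp_continuous_on: "Ck_on k f U \<Longrightarrow> continuous_on U f"
  by (cases k) (auto intro!: continuous_at_imp_continuous_on differentiable_imp_continuous_within)

lemma Ck_on_Suc_lower: "Ck_on (Suc k) f U \<Longrightarrow> Ck_on k f U"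
proof (induction k arbitrary: f)
  case 0
  then show ?case using Ck_on_imp_continuous_on by fastforce
next
  case (Suc k)
  then show ?case by (metis Ck_on.simps(2))
qed

lemma Ck_on_local:
  assumes "\<And>x. x \<in> U \<Longrightarrow> \<exists>V. open V \<and> x \<in> V \<and> Ck_on k f V"
  shows "Ck_on k f U"
  using assms
proof (induction k arbitrary: f)
  case 0
  have "isCont f x" if x: "x \<in> U" for x
  proof -
    obtain V where "open V" "x \<in> V" "Ck_on 0 f V" using 0[OF x] by auto
    then show ?thesis by (simp add: continuous_on_eq_continuous_at)
  qed
  then show ?case by (simp add: continuous_at_imp_continuous_on)
next
  case (Suc k)
  have "f differentiable (at x)" if "x \<in> U" for x
    using Suc.prems[OF that] by auto
  moreover have "Ck_on k (\<lambda>x. frechet_derivative f (at x) v) U" for v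
    using Suc.prems by (intro Suc.IH) (metis Ck_on.simps(2))
  ultimately show ?case by simp
qed

lemma Ck_on_const [simp]: "Ck_on k (\<lambda>x. c) U"
  by (induction k arbitrary: c) auto

lemma Ck_on_compose_bounded_linear:
  assumes "bounded_linear h" "open U" "Ck_on k f U"
  shows "Ck_on k (\<lambda>x. h (f x)) U"
  using assms(3)
proof (induction k arbitrary: f)
  case 0
  then show ?case
    using assms(1) by (simp add: linear_continuous_on_compose bounded_linear.linear continuous_on_compose2
        bounded_linear.continuous_on)
next
  case (Suc k)
  show ?case
  proof (rule Ck_on_SucI[OF assms(2)])
    show "((\<lambda>x. h (f x)) has_derivative (\<lambda>v. h (frechet_derivative f (at x) v))) (at x)" if "x \<in> U" for x
      by (rule bounded_linear.has_derivative[OF assms(1) Ck_on_SucD[OF Suc.prems that]])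
    show "Ck_on k (\<lambda>x. h (frechet_derivative f (at x) v)) U" for v
      using Suc by auto
  qed
qed

lemma Ck_on_ident: "open U \<Longrightarrow> Ck_on k (\<lambda>x. x) U"
proof (cases k)
  case (Suc j)
  assume "open U"
  then show ?thesis unfolding Suc
    by (rule Ck_on_SucI[where f' = "\<lambda>x v. v"]) auto
qed auto

lemma Ck_on_bounded_linear:
  "bounded_linear h \<Longrightarrow> open U \<Longrightarrow> Ck_on k h U"
  using Ck_on_compose_bounded_linear[of h U k "\<lambda>x. x"] Ck_on_ident by auto

lemma Ck_on_add:
  assumes "open U" "Ck_on k f U" "Ck_on k g U"
  shows "Ck_on k (\<lambda>x. f x + g x) U"
  using assms(2,3)
proof (induction k arbitrary: f g)
  case (Suc k)
  show ?case
  proof (rule Ck_on_SucI[OF assms(1)])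
    show "((\<lambda>x. f x + g x) has_derivative
       (\<lambda>v. frechet_derivative f (at x) v + frechet_derivative g (at x) v)) (at x)" if "x \<in> U" for x
      by (intro has_derivative_add Ck_on_SucD[OF Suc.prems(1) that] Ck_on_SucD[OF Suc.prems(2) that])
    show "Ck_on k (\<lambda>x. frechet_derivative f (at x) v + frechet_derivative g (at x) v) U" for v
      using Suc by auto
  qed
qed (auto intro: continuous_intros)

lemma Ck_on_sum:
  assumes "open U" "\<And>i. i \<in> I \<Longrightarrow> Ck_on k (f i) U"
  shows "Ck_on k (\<lambda>x. \<Sum>i\<in>I. f i x) U"
  using assms(2) by (induction I rule: infinite_finite_induct) (auto intro: Ck_on_add[OF assms(1)])

lemma Ck_on_scaleR:
  assumes "open U" "Ck_on k f U" "Ck_on k g U"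
  shows "Ck_on k (\<lambda>x. f x *\<^sub>R g x) U"
  using assms(2,3)
proof (induction k arbitrary: f g)
  case (Suc k)
  show ?case
  proof (rule Ck_on_SucI[OF assms(1)])
    show "((\<lambda>x. f x *\<^sub>R g x) has_derivative
       (\<lambda>v. f x *\<^sub>R frechet_derivative g (at x) v + frechet_derivative f (at x) v *\<^sub>R g x)) (at x)" if "x \<in> U" for x
      by (intro has_derivative_scaleR Ck_on_SucD[OF Suc.prems(1) that] Ck_on_SucD[OF Suc.prems(2) that])
    show "Ck_on k (\<lambda>x. f x *\<^sub>R frechet_derivative g (at x) v + frechet_derivative f (at x) v *\<^sub>R g x) U" for v
      using Suc.prems by (intro Ck_on_add[OF assms(1)] Suc.IH) (auto intro: Ck_on_Suc_lower)
  qed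
qed (auto intro: continuous_intros)

lemma Ck_on_mult:
  fixes f g :: "_ \<Rightarrow> real"
  assumes "open U" "Ck_on k f U" "Ck_on k g U"
  shows "Ck_on k (\<lambda>x. f x * g x) U"
  using Ck_on_scaleR[OF assms] by simp

text \<open>The hypotheses concern derivatives in fixed directions, while the chain rule
  differentiates \<open>g\<close> in the varying direction Df(x) v. Expanding that direction in a
  basis of the middle space, which is why this space is Euclidean, leaves sums and products to which
  the induction applies.\<close>

lemma Ck_on_compose:
  fixes f :: "'a::real_normed_vector \<Rightarrow> 'b::euclidean_space"
  assumes "open U" "open W" "Ck_on k f U" "Ck_on k g W" "f ` U \<subseteq> W"
  shows "Ck_on k (\<lambda>x. g (f x)) U"
  using assms(3,4)
proof (induction k arbitrary: g)
  case 0
  then show ?case using assms(5) continuous_on_compose2[of W g U f] by simp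
next
  case (Suc k)
  let ?D = "\<lambda>x v. \<Sum>b\<in>Basis. (frechet_derivative f (at x) v \<bullet> b) *\<^sub>R frechet_derivative g (at (f x)) b"
  show ?case
  proof (rule Ck_on_SucI[OF assms(1)])
    fix x assume x: "x \<in> U"
    have g: "(g has_derivative frechet_derivative g (at (f x))) (at (f x))"
      by (rule Ck_on_SucD[OF Suc.prems(2)]) (use x assms(5) in blast)
    then have l: "linear (frechet_derivative g (at (f x)))"
      by (rule has_derivative_linear)
    have "((\<lambda>x. g (f x)) has_derivative (\<lambda>v. frechet_derivative g (at (f x)) (frechet_derivative f (at x) v))) (at x)"
      by (rule has_derivative_compose[OF Ck_on_SucD[OF Suc.prems(1) x] g])
    moreover have "frechet_derivative g (at (f x)) w = (\<Sum>b\<in>Basis. (w \<bullet> b) *\<^sub>R frechet_derivative g (at (f x)) b)" for w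
      using linear_sum[OF l, of "\<lambda>b. (w \<bullet> b) *\<^sub>R b" Basis]
      by (simp only: euclidean_representation linear_cmul[OF l])
    then have "(\<lambda>v. frechet_derivative g (at (f x)) (frechet_derivative f (at x) v)) = ?D x"
      by (intro ext)
    ultimately show "((\<lambda>x. g (f x)) has_derivative ?D x) (at x)" by (rule has_derivative_eq_rhs)
  next
    fix v
    have *: "Ck_on k (\<lambda>x. frechet_derivative g (at (f x)) b) U" for b
      using Suc.prems(2) Suc.IH[OF Ck_on_Suc_lower[OF Suc.prems(1)], of "\<lambda>y. frechet_derivative g (at y) b"] by simp
    have "Ck_on k (\<lambda>x. frechet_derivative f (at x) v \<bullet> b) U" for b
      by (rule Ck_on_compose_bounded_linear[OF bounded_linear_inner_left assms(1)]) (use Suc.prems(1) in simp)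
    with * show "Ck_on k (\<lambda>x. ?D x v) U"
      by (auto intro!: Ck_on_sum[OF assms(1)] Ck_on_scaleR[OF assms(1)])
  qed
qed

lemma Ck_on_Pair:
  assumes "open U" "Ck_on k f U" "Ck_on k g U"
  shows "Ck_on k (\<lambda>x. (f x, g x)) U"
proof -
  have "Ck_on k (\<lambda>x. (f x, 0) + (0, g x)) U"
    by (rule Ck_on_add[OF assms(1) Ck_on_compose_bounded_linear[of "\<lambda>u. (u, 0)"]
          Ck_on_compose_bounded_linear[of "\<lambda>u. (0, u)"]])
       (auto intro!: assms bounded_linear_Pair bounded_linear_ident bounded_linear_zero)
  then show ?thesis by simp
qed

section \<open>Flat functions and smooth plateaus\<close>

lemma DERIV_inverse_power:
  assumes "x \<noteq> 0"
  shows "((\<lambda>x. inverse x ^ n) has_real_derivative (- real n * inverse x ^ (n + 1))) (at x)"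
proof -
  have "((\<lambda>x. inverse x ^ n) has_real_derivative (real n * (- (inverse x ^ Suc (Suc 0)) * inverse x ^ (n - Suc 0)))) (at x)"
    using DERIV_power[OF DERIV_inverse[OF assms], of n] by (simp add: mult_ac)
  moreover have "real n * (- (u ^ Suc (Suc 0)) * u ^ (n - Suc 0)) = - real n * u ^ (n + 1)" for u :: real
    by (cases n) (auto simp: algebra_simps)
  ultimately show ?thesis by (simp only:)
qed

lemma Ck_on_inverse_power: "Ck_on k (\<lambda>x::real. inverse x ^ n) (- {0})"
proof (induction k arbitrary: n)
  case 0
  show ?case by (auto intro!: continuous_intros)
next
  case (Suc k)
  have o: "open (- {0::real})" by auto
  show ?case
  proof (rule Ck_on_SucI[OF o])
    show "((\<lambda>x. inverse x ^ n) has_derivative (\<lambda>v. (- real n * inverse x ^ (n + 1)) * v)) (at x)"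
      if "x \<in> - {0}" for x :: real
    proof -
      have "((\<lambda>x. inverse x ^ n) has_real_derivative (- real n * inverse x ^ (n + 1))) (at x)"
        using that by (intro DERIV_inverse_power) auto
      then show ?thesis unfolding has_field_derivative_def .
    qed
    show "Ck_on k (\<lambda>x. (- real n * inverse x ^ (n + 1)) * v) (- {0})" for v :: real
      by (intro Ck_on_mult[OF o] Ck_on_const Suc.IH)
  qed
qed

text \<open>The power in front of exp(-1/t) closes the family under differentiation, so one
  induction proves all members smooth.\<close>

definition flat_exp :: "nat \<Rightarrow> real \<Rightarrow> real" where
  "flat_exp n t = (if t > 0 then inverse t ^ n * exp (- inverse t) else 0)"

lemma flat_exp_has_derivative:
  "(flat_exp n has_real_derivative (flat_exp (n + 2) t - real n * flat_exp (n + 1) t)) (at t)"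
proof -
  consider "t > 0" | "t < 0" | "t = 0" by linarith
  then show ?thesis
  proof cases
    case 1
    have "((\<lambda>t. inverse t ^ n * exp (- inverse t)) has_real_derivative
        (inverse t ^ (n+2) * exp (- inverse t) - real n * (inverse t ^ (n+1) * exp (- inverse t)))) (at t)"
    proof -
      have "((\<lambda>t. exp (- inverse t)) has_real_derivative (exp (- inverse t) * (inverse t ^ 2))) (at t)"
        using 1 DERIV_fun_exp[OF DERIV_minus[OF DERIV_inverse[of t]]] by (simp add: power2_eq_square)
      from DERIV_mult[OF DERIV_inverse_power[of t n] this] show ?thesis
        using 1 by (simp add: algebra_simps power2_eq_square)
    qed
    then show ?thesis
      using 1 by (auto simp: flat_exp_def[abs_def] intro: has_field_derivative_transform_within_open[where S="{0<..}"])
  next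
    case 2
    have "((\<lambda>t. 0) has_real_derivative 0) (at t)" by auto
    then show ?thesis
      by (rule has_field_derivative_transform_within_open[where S="{..<0}", THEN DERIV_cong])
         (use 2 in \<open>auto simp: flat_exp_def\<close>)
  next
    case 3
    \<comment> \<open>At 0 the difference quotient of \<open>flat_exp n\<close> is
      \<open>flat_exp (n + 1)\<close> itself, and the exponential beats the power.\<close>
    have "((\<lambda>x. flat_exp (n + 1) x) \<longlongrightarrow> 0) (at_right 0)"
    proof -
      have "((\<lambda>x. x ^ (n + 1) / exp x) \<longlongrightarrow> (0::real)) at_top" by (rule tendsto_power_div_exp_0)
      then have "((\<lambda>x::real. inverse x ^ (n + 1) / exp (inverse x)) \<longlongrightarrow> 0) (at_right 0)"
        by (rule filterlim_compose[OF _ filterlim_inverse_at_top_right])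
      then show ?thesis
        by (rule Lim_transform_eventually)
           (rule eventually_mono[OF eventually_at_right_less], simp add: flat_exp_def exp_minus divide_inverse)
    qed
    moreover have "((\<lambda>x. flat_exp (n + 1) x) \<longlongrightarrow> 0) (at_left 0)"
      by (rule Lim_transform_eventually[of "\<lambda>_. 0"])
         (auto simp: flat_exp_def intro: eventually_mono[OF eventually_at_left_real[of "-1" "0::real"]])
    ultimately have "((\<lambda>x. flat_exp (n + 1) x) \<longlongrightarrow> 0) (at 0)"
      by (simp add: filterlim_split_at)
    then have "((\<lambda>h. (flat_exp n h - flat_exp n 0) / h) \<longlongrightarrow> 0) (at 0)"
      by (rule Lim_transform_eventually)
         (auto simp: flat_exp_def field_simps eventually_at_filter)
    then show ?thesis using 3 by (simp add: DERIV_def flat_exp_def)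
  qed
qed

lemma Ck_on_flat_exp: "Ck_on k (flat_exp n) UNIV"
proof (induction k arbitrary: n)
  case 0
  have "isCont (flat_exp n) t" for t
    using flat_exp_has_derivative DERIV_isCont by blast
  then show ?case by (simp add: continuous_at_imp_continuous_on)
next
  case (Suc k)
  show ?case
  proof (rule Ck_on_SucI)
    show "(flat_exp n has_derivative (\<lambda>v. v * (flat_exp (n + 2) t + (- real n) * flat_exp (n + 1) t))) (at t)" for t
      using flat_exp_has_derivative[of n t]
      by (simp add: has_field_derivative_def mult_commute_abs)
    show "Ck_on k (\<lambda>t. v * (flat_exp (n + 2) t + (- real n) * flat_exp (n + 1) t)) UNIV" for v
      by (intro Ck_on_mult Ck_on_add Ck_on_const Suc.IH open_UNIV)
  qed simp
qed

lemma Ck_on_inner_self: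
  fixes c :: "'a::euclidean_space"
  assumes "open U" shows "Ck_on k (\<lambda>x. (x - c) \<bullet> (x - c)) U"
proof -
  have s: "Ck_on k (\<lambda>x. (x - c) \<bullet> b) U" for b
  proof -
    have "Ck_on k (\<lambda>x. x \<bullet> b + (- (c \<bullet> b))) U"
      by (intro Ck_on_add assms Ck_on_const Ck_on_bounded_linear bounded_linear_inner_left)
    then show ?thesis by (simp add: inner_diff_left)
  qed
  have "Ck_on k (\<lambda>x. \<Sum>b\<in>Basis. ((x - c) \<bullet> b) * ((x - c) \<bullet> b)) U"
    by (intro Ck_on_sum Ck_on_mult assms s)
  then show ?thesis by (subst euclidean_inner) simp
qed

text \<open>The quotient F(R^2 - q) / (F(R^2 - q) + F(q - r^2)) with a flat function
  \<open>F\<close>. Taking for \<open>q\<close> the squared distance keeps it smooth at the centre,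
  and \<open>r < R\<close> keeps the denominator positive.\<close>

lemma smooth_plateau:
  fixes c :: "'a::euclidean_space"
  assumes "0 < r" "r < R"
  obtains \<beta> :: "'a \<Rightarrow> real" where "\<And>k. Ck_on k \<beta> UNIV" "\<And>x. 0 \<le> \<beta> x" "\<And>x. \<beta> x \<le> 1"
    "\<And>x. dist c x \<le> r \<Longrightarrow> \<beta> x = 1" "\<And>x. R \<le> dist c x \<Longrightarrow> \<beta> x = 0"
proof
  define F where "F = flat_exp 0"
  have Fp: "F t > 0" if "t > 0" for t using that by (simp add: F_def flat_exp_def)
  have Fz: "F t = 0" if "t \<le> 0" for t using that by (simp add: F_def flat_exp_def)
  have Fn: "F t \<ge> 0" for t by (simp add: F_def flat_exp_def)
  define q where "q x = (x - c) \<bullet> (x - c)" for x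
  have q: "q x = (dist c x)\<^sup>2" for x by (simp add: q_def dist_norm power2_norm_eq_inner norm_minus_commute[of c x])
  define num where "num x = F (R\<^sup>2 - q x)" for x
  define den where "den x = F (R\<^sup>2 - q x) + F (q x - r\<^sup>2)" for x
  have "r\<^sup>2 < R\<^sup>2" using assms by (simp add: power_strict_mono)
  then have den: "den x > 0" for x
  proof (cases "q x < R\<^sup>2")
    case True then show ?thesis unfolding den_def using Fp[of "R\<^sup>2 - q x"] Fn[of "q x - r\<^sup>2"] by linarith
  next
    case False then show ?thesis unfolding den_def
      using Fp[of "q x - r\<^sup>2"] Fn[of "R\<^sup>2 - q x"] \<open>r\<^sup>2 < R\<^sup>2\<close> by linarith
  qed
  define \<beta> where "\<beta> x = num x * inverse (den x)" for x
  have q1: "Ck_on k (\<lambda>x. R\<^sup>2 - q x) UNIV" for k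
  proof -
    have "Ck_on k (\<lambda>x. R\<^sup>2 + (-1) * q x) UNIV"
      unfolding q_def by (intro Ck_on_add Ck_on_mult Ck_on_const Ck_on_inner_self open_UNIV)
    then show ?thesis by simp
  qed
  have q2: "Ck_on k (\<lambda>x. q x - r\<^sup>2) UNIV" for k
  proof -
    have "Ck_on k (\<lambda>x. q x + (- (r\<^sup>2))) UNIV"
      unfolding q_def by (intro Ck_on_add Ck_on_const Ck_on_inner_self open_UNIV)
    then show ?thesis by simp
  qed
  have n: "Ck_on k num UNIV" for k
    unfolding num_def F_def by (rule Ck_on_compose[OF _ _ q1 Ck_on_flat_exp]) auto
  have d: "Ck_on k den UNIV" for k
    unfolding den_def F_def
    by (intro Ck_on_add open_UNIV Ck_on_compose[OF _ _ q1 Ck_on_flat_exp] Ck_on_compose[OF _ _ q2 Ck_on_flat_exp]) auto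
  have "Ck_on k (\<lambda>x. inverse (den x) ^ 1) UNIV" for k
    by (rule Ck_on_compose[OF _ _ d Ck_on_inverse_power]) (use den in \<open>auto simp: less_le\<close>)
  then show "Ck_on k \<beta> UNIV" for k
    unfolding \<beta>_def by (intro Ck_on_mult n open_UNIV) simp
  show "0 \<le> \<beta> x" for x
    using den[of x] Fn by (simp add: \<beta>_def num_def)
  show "\<beta> x \<le> 1" for x
    using den[of x] Fn by (simp add: \<beta>_def num_def den_def field_simps)
  show "\<beta> x = 1" if "dist c x \<le> r" for x
  proof -
    have "q x \<le> r\<^sup>2" unfolding q using that by (simp add: power_mono)
    then show ?thesis using den[of x] by (simp add: \<beta>_def num_def den_def Fz)
  qed
  show "\<beta> x = 0" if "R \<le> dist c x" for x
  proof -
    have "R\<^sup>2 \<le> q x" unfolding q using that assms by (simp add: power_mono)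
    then show ?thesis by (simp add: \<beta>_def num_def Fz)
  qed
qed

section \<open>Hadamard's lemma\<close>

lemma Ck_on_segment_integral:
  fixes g :: "'a::euclidean_space \<Rightarrow> real"
  assumes "open U" "convex U" "x \<in> U" "Ck_on k g U" "continuous_on {0..1} w"
  shows "Ck_on k (\<lambda>y. integral {0..1} (\<lambda>s. w s * g (x + s *\<^sub>R (y - x)))) U"
  using assms(4,5)
proof (induction k arbitrary: g w)
  case (0 g w)
  have seg: "x + s *\<^sub>R (y - x) \<in> U" if "y \<in> U" "0 \<le> s" "s \<le> 1" for y s
    using convexD_alt[OF assms(2,3) that] by (simp add: algebra_simps)
  have "continuous_on (U \<times> cbox 0 1) (\<lambda>(y, s). w s * g (x + s *\<^sub>R (y - x)))"
    unfolding split_beta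
    by (intro continuous_on_mult continuous_on_compose2[OF 0(2)] continuous_on_compose2[OF Ck_on_imp_continuous_on[OF 0(1)]] continuous_intros)
       (use seg in auto)
  from integral_continuous_on_param[OF this] show ?case by simp
next
  case (Suc k g w)
  have seg: "x + s *\<^sub>R (y - x) \<in> U" if "y \<in> U" "0 \<le> s" "s \<le> 1" for y s
    using convexD_alt[OF assms(2,3) that] by (simp add: algebra_simps)
  let ?D = "\<lambda>y. frechet_derivative g (at y)"
  have Dg: "(g has_derivative ?D y) (at y)" if "y \<in> U" for y
    using Ck_on_SucD[OF Suc.prems(1) that] .
  have gc: "continuous_on U g" using Suc.prems(1) by (rule Ck_on_imp_continuous_on)
  \<comment> \<open>Differentiation under the integral wants the derivative as a continuous family
    of bounded operators; in finite dimension continuity can be tested on basis vectors.\<close>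
  define B where "B y s = Blinfun (\<lambda>v. w s * s * ?D (x + s *\<^sub>R (y - x)) v)" for y s
  have B: "blinfun_apply (B y s) = (\<lambda>v. w s * s * ?D (x + s *\<^sub>R (y - x)) v)" if "y \<in> U" "s \<in> {0..1}" for y s
    unfolding B_def
    by (rule bounded_linear_Blinfun_apply, rule bounded_linear_const_mult, rule has_derivative_bounded_linear[OF Dg])
       (use that seg in auto)
  have cD: "continuous_on U (\<lambda>y. ?D y v)" for v
    using Suc.prems(1) by (auto intro: Ck_on_imp_continuous_on)
  have cB: "continuous_on (U \<times> cbox 0 1) (\<lambda>(y, s). B y s)"
    unfolding split_beta
  proof (rule continuous_on_blinfun_componentwise)
    fix i :: 'a
    have "continuous_on (U \<times> cbox 0 1) (\<lambda>z. w (snd z) * snd z * ?D (x + snd z *\<^sub>R (fst z - x)) i)"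
      by (intro continuous_on_mult continuous_on_compose2[OF Suc.prems(2)] continuous_on_compose2[OF cD[of i]] continuous_intros)
         (use seg in auto)
    then show "continuous_on (U \<times> cbox 0 1) (\<lambda>z. blinfun_apply (B (fst z) (snd z)) i)"
      by (rule continuous_on_eq) (auto simp: B)
  qed
  have int: "integral {0..1} (\<lambda>s. B y s) v = integral {0..1} (\<lambda>s. w s * s * ?D (x + s *\<^sub>R (y - x)) v)" if "y \<in> U" for y v
  proof -
    have "(\<lambda>s. B y s) integrable_on {0..1}"
    proof -
      have "continuous_on {0..1} (Pair y)" by (intro continuous_intros)
      then show ?thesis
        using integrable_continuous[of 0 1 "\<lambda>s. B y s"] continuous_on_compose2[OF cB, of "cbox 0 1" "\<lambda>s. (y, s)"] that
        by auto
    qed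
    then have "integral {0..1} (\<lambda>s. B y s) v = integral {0..1} (\<lambda>s. blinfun_apply (B y s) v)"
      by (rule blinfun_apply_integral)
    also have "\<dots> = integral {0..1} (\<lambda>s. w s * s * ?D (x + s *\<^sub>R (y - x)) v)"
      by (rule integral_cong) (use B that in auto)
    finally show ?thesis .
  qed
  show ?case
  proof (rule Ck_on_SucI[OF assms(1)])
    fix y assume y: "y \<in> U"
    have "((\<lambda>y. integral (cbox 0 1) (\<lambda>s. w s * g (x + s *\<^sub>R (y - x)))) has_derivative
        integral (cbox 0 1) (\<lambda>s. B y s)) (at y within U)"
    proof (rule leibniz_rule[OF _ _ cB y assms(2)])
      fix z s assume z: "z \<in> U" "s \<in> cbox (0::real) 1"
      then have "x + s *\<^sub>R (z - x) \<in> U" using seg by auto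
      have "((\<lambda>z. x + s *\<^sub>R (z - x)) has_derivative (\<lambda>v. s *\<^sub>R v)) (at z)"
        by (auto intro!: derivative_eq_intros)
      from has_derivative_mult_right[OF has_derivative_compose[OF this Dg[OF \<open>x + s *\<^sub>R (z - x) \<in> U\<close>]], of "w s"]
      have "((\<lambda>z. w s * g (x + s *\<^sub>R (z - x))) has_derivative (\<lambda>v. w s * ?D (x + s *\<^sub>R (z - x)) (s *\<^sub>R v))) (at z)" .
      moreover have "?D (x + s *\<^sub>R (z - x)) (s *\<^sub>R v) = s * ?D (x + s *\<^sub>R (z - x)) v" for v
        using linear_cmul[OF has_derivative_linear[OF Dg[OF \<open>x + s *\<^sub>R (z - x) \<in> U\<close>]]] by simp
      ultimately show "((\<lambda>z. w s * g (x + s *\<^sub>R (z - x))) has_derivative blinfun_apply (B z s)) (at z within U)"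
        using B z by (auto simp: mult.assoc intro: has_derivative_at_withinI)
    next
      fix z assume "z \<in> U"
      then show "(\<lambda>s. w s * g (x + s *\<^sub>R (z - x))) integrable_on cbox 0 1"
        using seg by (intro integrable_continuous continuous_on_mult continuous_on_compose2[OF Suc.prems(2)]
          continuous_on_compose2[OF gc] continuous_intros) auto
    qed
    then have "((\<lambda>y. integral {0..1} (\<lambda>s. w s * g (x + s *\<^sub>R (y - x)))) has_derivative
        integral {0..1} (\<lambda>s. B y s)) (at y)"
      using at_within_open[OF y assms(1)] by simp
    then show "((\<lambda>y. integral {0..1} (\<lambda>s. w s * g (x + s *\<^sub>R (y - x)))) has_derivative
        (\<lambda>v. integral {0..1} (\<lambda>s. (w s * s) * ?D (x + s *\<^sub>R (y - x)) v))) (at y)"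
      unfolding ext[of "blinfun_apply (integral {0..1} (\<lambda>s. B y s))", OF int[OF y]] .
  next
    \<comment> \<open>Each derivative in \<open>y\<close> releases a factor \<open>s\<close>; the
      free weight \<open>w\<close> of the statement is there to absorb it.\<close>
    show "Ck_on k (\<lambda>y. integral {0..1} (\<lambda>s. (w s * s) * ?D (x + s *\<^sub>R (y - x)) v)) U" for v
      by (rule Suc.IH) (use Suc.prems in \<open>auto intro!: continuous_intros\<close>)
  qed
qed

text \<open>Integrate the derivative of \<open>f\<close> along the segment from \<open>x\<close> to
  \<open>y\<close> and split \<open>y - x\<close> into coordinates. With the remainder in product
  form, a derivation can be applied to it by the product rule alone.\<close>

lemma Hadamard_expansion:
  fixes f :: "'a::euclidean_space \<Rightarrow> real"
  assumes "open U" "convex U" "x \<in> U" "\<And>k. Ck_on k f U"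
  obtains h where "\<And>i k. Ck_on k (h i) U" "\<And>i. h i x = frechet_derivative f (at x) i"
    "\<And>y. y \<in> U \<Longrightarrow> f y = f x + (\<Sum>i\<in>Basis. ((y - x) \<bullet> i) * h i y)"
proof
  let ?D = "\<lambda>y. frechet_derivative f (at y)"
  define h where "h i y = integral {0..1} (\<lambda>s. 1 * ?D (x + s *\<^sub>R (y - x)) i)" for i y
  have CD: "Ck_on k (\<lambda>y. ?D y i) U" for i k using assms(4)[of "Suc k"] by simp
  show "Ck_on k (h i) U" for i k
    unfolding h_def by (rule Ck_on_segment_integral[OF assms(1-3) CD]) auto
  show "h i x = ?D x i" for i by (simp add: h_def)
  fix y assume y: "y \<in> U"
  have seg: "x + s *\<^sub>R (y - x) \<in> U" if "0 \<le> s" "s \<le> 1" for s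
    using convexD_alt[OF assms(2,3) y that] by (simp add: algebra_simps)
  have Df: "(f has_derivative ?D z) (at z)" if "z \<in> U" for z
    using Ck_on_SucD[OF assms(4)[of 1, unfolded One_nat_def] that] .
  have "((\<lambda>s. f (x + s *\<^sub>R (y - x))) has_vector_derivative ?D (x + s *\<^sub>R (y - x)) (y - x)) (at s within {0..1})"
    if "s \<in> {0..1}" for s
  proof -
    have *: "x + s *\<^sub>R (y - x) \<in> U" using seg that by auto
    have "((\<lambda>s. f (x + s *\<^sub>R (y - x))) has_derivative (\<lambda>t. ?D (x + s *\<^sub>R (y - x)) (t *\<^sub>R (y - x)))) (at s)"
      by (auto intro!: derivative_eq_intros has_derivative_compose[where f="\<lambda>s. x + s *\<^sub>R (y - x)", OF _ Df] *)
    then show ?thesis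
      unfolding has_vector_derivative_def
      using linear_cmul[OF has_derivative_linear[OF Df[OF *]]] by (auto intro: has_derivative_at_withinI)
  qed
  then have "((\<lambda>s. ?D (x + s *\<^sub>R (y - x)) (y - x)) has_integral (f (x + 1 *\<^sub>R (y - x)) - f (x + 0 *\<^sub>R (y - x)))) {0..1}"
    by (intro fundamental_theorem_of_calculus) auto
  then have e: "integral {0..1} (\<lambda>s. ?D (x + s *\<^sub>R (y - x)) (y - x)) = f y - f x"
    by (simp add: integral_unique)
  have "integral {0..1} (\<lambda>s. ?D (x + s *\<^sub>R (y - x)) (y - x))
     = integral {0..1} (\<lambda>s. \<Sum>i\<in>Basis. ((y - x) \<bullet> i) * ?D (x + s *\<^sub>R (y - x)) i)"
  proof (rule integral_cong)
    fix s :: real assume "s \<in> {0..1}"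
    then have l: "linear (?D (x + s *\<^sub>R (y - x)))"
      using seg has_derivative_linear[OF Df] by auto
    show "?D (x + s *\<^sub>R (y - x)) (y - x) = (\<Sum>i\<in>Basis. ((y - x) \<bullet> i) * ?D (x + s *\<^sub>R (y - x)) i)"
      using linear_sum[OF l, of "\<lambda>b. ((y - x) \<bullet> b) *\<^sub>R b" Basis]
      by (simp only: euclidean_representation linear_cmul[OF l]) simp
  qed
  also have "\<dots> = (\<Sum>i\<in>Basis. integral {0..1} (\<lambda>s. ((y - x) \<bullet> i) * ?D (x + s *\<^sub>R (y - x)) i))"
  proof (rule integral_sum)
    fix i :: 'a
    have "continuous_on {0..1} (\<lambda>s. ?D (x + s *\<^sub>R (y - x)) i)"
      by (rule continuous_on_compose2[OF Ck_on_imp_continuous_on[OF CD[where i=i and k=0]]])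
         (use seg in \<open>auto intro!: continuous_intros\<close>)
    then show "(\<lambda>s. ((y - x) \<bullet> i) * ?D (x + s *\<^sub>R (y - x)) i) integrable_on {0..1}"
      by (intro integrable_continuous_interval continuous_intros)
  qed auto
  finally show "f y = f x + (\<Sum>i\<in>Basis. ((y - x) \<bullet> i) * h i y)"
    using e by (simp add: h_def)
qed

section \<open>Smooth functions on a Lie group\<close>

lemma Ck_on_cutoff:
  fixes h \<beta> :: "'a::euclidean_space \<Rightarrow> real"
  assumes "open V" "closed K" "K \<subseteq> V" "Ck_on k h V" "Ck_on k \<beta> UNIV" "\<And>x. x \<notin> K \<Longrightarrow> \<beta> x = 0"
  shows "Ck_on k (\<lambda>x. if x \<in> V then \<beta> x * h x else 0) UNIV"
proof (rule Ck_on_local)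
  fix x :: 'a
  consider "x \<in> V" | "x \<in> - K" using assms(3) by auto
  then show "\<exists>W. open W \<and> x \<in> W \<and> Ck_on k (\<lambda>x. if x \<in> V then \<beta> x * h x else 0) W"
  proof cases
    case 1
    have "Ck_on k (\<lambda>x. \<beta> x * h x) V"
      by (rule Ck_on_mult[OF assms(1) Ck_on_subset[OF assms(5)] assms(4)]) simp
    then have "Ck_on k (\<lambda>x. if x \<in> V then \<beta> x * h x else 0) V"
      by (rule Ck_on_cong[OF assms(1), rotated]) simp
    then show ?thesis using 1 assms(1) by blast
  next
    case 2
    have "Ck_on k (\<lambda>x. if x \<in> V then \<beta> x * h x else 0) (- K)"
      by (rule Ck_on_cong[of _ "\<lambda>x. 0"]) (use assms in auto)
    then show ?thesis using 2 assms(2) by blast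
  qed
qed

locale lie_group_atlas =
  fixes A :: "('g::{topological_group_add, t2_space, second_countable_topology}, 'm::euclidean_space) chart set"
  assumes lie: "lie_group A"
begin

lemma chart_props:
  assumes "(U, \<phi>) \<in> A"
  shows "open U" "open (\<phi> ` U)" "continuous_on U \<phi>" "continuous_on (\<phi> ` U) (inv_into U \<phi>)" "inj_on \<phi> U"
    "\<And>p. p \<in> U \<Longrightarrow> inv_into U \<phi> (\<phi> p) = p"
proof -
  have "is_chart (U, \<phi>)" using lie assms by (auto simp: lie_group_def smooth_atlas_def)
  then have *: "open U" "open (\<phi> ` U)" "homeomorphism U (\<phi> ` U) \<phi> (inv_into U \<phi>)" by (auto simp: is_chart_def)
  then show "open U" "open (\<phi> ` U)" "continuous_on U \<phi>" "continuous_on (\<phi> ` U) (inv_into U \<phi>)"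
    "\<And>p. p \<in> U \<Longrightarrow> inv_into U \<phi> (\<phi> p) = p" by (auto simp: homeomorphism_def)
  then show "inj_on \<phi> U" by (metis inj_onI)
qed

lemma chart_transition:
  assumes "(U, \<phi>) \<in> A" "(W, \<psi>) \<in> A"
  shows "Ck_on k (\<psi> \<circ> inv_into U \<phi>) (\<phi> ` (U \<inter> W))"
proof -
  have "\<forall>(U, \<phi>)\<in>A. \<forall>(W, \<psi>)\<in>A. smooth_on (\<psi> \<circ> inv_into U \<phi>) (\<phi> ` (U \<inter> W))"
    using lie by (simp add: lie_group_def smooth_atlas_def)
  from bspec[OF this assms(1), simplified, THEN bspec[OF _ assms(2)]] show ?thesis
    by (simp add: smooth_on_def)
qed

lemma chart_exists: obtains U \<phi> where "(U, \<phi>) \<in> A" "p \<in> U"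
proof -
  have "p \<in> (\<Union>(U, \<phi>)\<in>A. U)" using lie by (simp add: lie_group_def smooth_atlas_def)
  then show ?thesis using that by auto
qed

lemma chart_image_open:
  assumes "(U, \<phi>) \<in> A" "open W"
  shows "open (\<phi> ` (U \<inter> W))"
proof -
  note c = chart_props[OF assms(1)]
  have "\<phi> ` (U \<inter> W) = \<phi> ` U \<inter> inv_into U \<phi> -` W"
    using c(6) by (auto simp: image_iff)
  then show ?thesis using continuous_open_preimage[OF c(4) c(2) assms(2)] by (simp add: Int_commute)
qed

lemma chart_preimage_open:
  assumes "(U, \<phi>) \<in> A" "open B"
  shows "open {p \<in> U. \<phi> p \<in> B}"
  using continuous_open_preimage[OF chart_props(3,1)[OF assms(1)] assms(2)]
  by (simp add: vimage_def Int_def)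

lemma chart_ball:
  assumes "open W" "p \<in> W"
  obtains U \<phi> R where "(U, \<phi>) \<in> A" "p \<in> U" "0 < R" "cball (\<phi> p) R \<subseteq> \<phi> ` (U \<inter> W)"
proof -
  obtain U \<phi> where U: "(U, \<phi>) \<in> A" "p \<in> U" by (rule chart_exists)
  then have "open (\<phi> ` (U \<inter> W))" "\<phi> p \<in> \<phi> ` (U \<inter> W)" using chart_image_open assms by auto
  then show ?thesis using that U open_contains_cball by metis
qed

lemma smooth_functions_iff:
  "f \<in> smooth_functions A \<longleftrightarrow> continuous_on UNIV f \<and>
     (\<forall>(U, \<phi>)\<in>A. \<forall>k. Ck_on k (\<lambda>x. f (inv_into U \<phi> x)) (\<phi> ` U))"
  unfolding smooth_functions_def smooth_map_def smooth_on_def by (auto simp: o_def)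

lemma smooth_functions_Ck:
  "f \<in> smooth_functions A \<Longrightarrow> (U, \<phi>) \<in> A \<Longrightarrow> Ck_on k (\<lambda>x. f (inv_into U \<phi> x)) (\<phi> ` U)"
  by (auto simp: smooth_functions_iff)

lemma smooth_functions_continuous: "f \<in> smooth_functions A \<Longrightarrow> continuous_on UNIV f"
  by (auto simp: smooth_functions_iff)

lemma smooth_functions_const [simp]: "(\<lambda>x. c) \<in> smooth_functions A"
  by (auto simp: smooth_functions_iff)

lemma smooth_functions_add:
  "f \<in> smooth_functions A \<Longrightarrow> h \<in> smooth_functions A \<Longrightarrow> (\<lambda>x. f x + h x) \<in> smooth_functions A"
  by (auto simp: smooth_functions_iff intro!: continuous_on_add Ck_on_add dest: chart_props(2))

lemma smooth_functions_mult:
  "f \<in> smooth_functions A \<Longrightarrow> h \<in> smooth_functions A \<Longrightarrow> (\<lambda>x. f x * h x) \<in> smooth_functions A"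
  by (auto simp: smooth_functions_iff intro!: continuous_on_mult Ck_on_mult dest: chart_props(2))

lemma smooth_functions_cmult:
  "f \<in> smooth_functions A \<Longrightarrow> (\<lambda>x. c * f x) \<in> smooth_functions A"
  by (rule smooth_functions_mult) auto

lemma smooth_functions_diff:
  "f \<in> smooth_functions A \<Longrightarrow> h \<in> smooth_functions A \<Longrightarrow> (\<lambda>x. f x - h x) \<in> smooth_functions A"
  using smooth_functions_add[of f "\<lambda>x. (-1) * h x"] smooth_functions_cmult[of h "-1"] by simp

lemma smooth_functions_sum:
  "(\<And>i. i \<in> I \<Longrightarrow> f i \<in> smooth_functions A) \<Longrightarrow> (\<lambda>x. \<Sum>i\<in>I. f i x) \<in> smooth_functions A"
  by (induction I rule: infinite_finite_induct) (auto intro: smooth_functions_add)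

text \<open>The Hausdorff property enters here: the image of \<open>K\<close> in the group is
  compact, hence closed, so its complement and the chart domain form an open cover, and on either
  set smoothness is evident.\<close>

lemma chart_extension:
  fixes u :: "'m \<Rightarrow> real"
  assumes "(U, \<phi>) \<in> A" "compact K" "K \<subseteq> \<phi> ` U" "\<And>k. Ck_on k u UNIV" "\<And>x. x \<notin> K \<Longrightarrow> u x = 0"
  shows "(\<lambda>p. if p \<in> U then u (\<phi> p) else 0) \<in> smooth_functions A"
    "compact (inv_into U \<phi> ` K)"
    "\<And>p. p \<notin> inv_into U \<phi> ` K \<Longrightarrow> (if p \<in> U then u (\<phi> p) else 0) = 0"
proof -
  note c = chart_props[OF assms(1)]
  let ?f = "\<lambda>p. if p \<in> U then u (\<phi> p) else 0"
  let ?K = "inv_into U \<phi> ` K"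
  show K: "compact ?K"
    by (rule compact_continuous_image[OF continuous_on_subset[OF c(4) assms(3)] assms(2)])
  show z: "?f p = 0" if "p \<notin> ?K" for p
  proof (cases "p \<in> U \<and> \<phi> p \<in> K")
    case True
    then have "p \<in> ?K" using c(6)[of p] by force
    then show ?thesis using that by simp
  qed (use assms(5) in auto)
  have o: "open (- ?K)" using K compact_imp_closed by blast
  have KU: "?K \<subseteq> U" using assms(3) c(6) by auto
  have uc: "continuous_on UNIV u" using assms(4)[of 0] by simp
  have "continuous_on (U \<union> - ?K) ?f"
  proof (rule continuous_on_open_Un[OF c(1) o])
    have "continuous_on U (\<lambda>p. u (\<phi> p))" by (rule continuous_on_compose2[OF uc c(3)]) simp
    then show "continuous_on U ?f" by (rule continuous_on_eq) simp
    show "continuous_on (- ?K) ?f" by (rule continuous_on_eq[of _ "\<lambda>x. 0"]) (use z in auto)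
  qed
  moreover have "U \<union> - ?K = UNIV" using KU by auto
  ultimately have cf: "continuous_on UNIV ?f" by simp
  have "Ck_on k (\<lambda>x. ?f (inv_into W \<psi> x)) (\<psi> ` W)" if W: "(W, \<psi>) \<in> A" for W \<psi> k
  proof (rule Ck_on_local)
    note d = chart_props[OF W]
    fix x assume "x \<in> \<psi> ` W"
    then obtain q where q: "q \<in> W" "x = \<psi> q" by auto
    consider "q \<in> U" | "q \<in> - ?K" using KU by auto
    then show "\<exists>V. open V \<and> x \<in> V \<and> Ck_on k (\<lambda>x. ?f (inv_into W \<psi> x)) V"
    proof cases
      case 1
      let ?V = "\<psi> ` (W \<inter> U)"
      have V: "open ?V" using chart_image_open[OF W c(1)] .
      have "Ck_on k (\<phi> \<circ> inv_into W \<psi>) ?V"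
        by (rule chart_transition[OF W assms(1)])
      from Ck_on_compose[OF V open_UNIV this assms(4)[of k]]
      have "Ck_on k (\<lambda>x. u ((\<phi> \<circ> inv_into W \<psi>) x)) ?V" by simp
      then have "Ck_on k (\<lambda>x. ?f (inv_into W \<psi> x)) ?V"
        by (rule Ck_on_cong[OF V, rotated]) (use d(6) in auto)
      then show ?thesis using V q 1 by blast
    next
      case 2
      let ?V = "\<psi> ` (W \<inter> - ?K)"
      have V: "open ?V" using chart_image_open[OF W o] .
      have "Ck_on k (\<lambda>x. ?f (inv_into W \<psi> x)) ?V"
      proof (rule Ck_on_cong[OF V _ Ck_on_const[of k 0]])
        fix x assume "x \<in> ?V"
        then have "inv_into W \<psi> x \<notin> ?K" using d(6) by auto
        then show "0 = ?f (inv_into W \<psi> x)" using z by metis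
      qed
      then show ?thesis using V q 2 by blast
    qed
  qed
  then show "?f \<in> smooth_functions A" using cf by (auto simp: smooth_functions_iff)
qed

lemma bump_exists:
  assumes "open W" "p \<in> W"
  obtains b N K where "b \<in> smooth_functions A" "open N" "p \<in> N" "N \<subseteq> W" "\<And>x. x \<in> N \<Longrightarrow> b x = 1"
    "compact K" "K \<subseteq> W" "\<And>x. x \<notin> K \<Longrightarrow> b x = 0" "\<And>x. 0 \<le> b x"
proof -
  obtain U \<phi> R where c: "(U, \<phi>) \<in> A" "p \<in> U" "0 < R" "cball (\<phi> p) R \<subseteq> \<phi> ` (U \<inter> W)"
    using chart_ball[OF assms] .
  note cc = chart_props[OF c(1)]
  obtain \<beta> :: "'m \<Rightarrow> real" where b: "\<And>k. Ck_on k \<beta> UNIV" "\<And>x. 0 \<le> \<beta> x" "\<And>x. \<beta> x \<le> 1"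
    "\<And>x. dist (\<phi> p) x \<le> R/2 \<Longrightarrow> \<beta> x = 1" "\<And>x. R \<le> dist (\<phi> p) x \<Longrightarrow> \<beta> x = 0"
    using smooth_plateau[of "R/2" R "\<phi> p"] c(3) by auto
  have K: "compact (cball (\<phi> p) R)" "cball (\<phi> p) R \<subseteq> \<phi> ` U" using c(4) by auto
  have z: "x \<notin> cball (\<phi> p) R \<Longrightarrow> \<beta> x = 0" for x using b(5) by auto
  note e = chart_extension[OF c(1) K b(1) z]
  show ?thesis
  proof (rule that[OF e(1) _ _ _ _ e(2) _ e(3)])
    let ?N = "{x \<in> U. \<phi> x \<in> ball (\<phi> p) (R/2)}"
    show "open ?N" using chart_preimage_open[OF c(1)] by blast
    show "p \<in> ?N" using c by simp
    show "?N \<subseteq> W"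
    proof
      fix x assume x: "x \<in> ?N"
      then have "\<phi> x \<in> cball (\<phi> p) R" using c(3) by auto
      then have "\<phi> x \<in> \<phi> ` (U \<inter> W)" using c(4) by auto
      then show "x \<in> W" using x cc(5) by (auto simp: inj_on_def)
    qed
    show "inv_into U \<phi> ` cball (\<phi> p) R \<subseteq> W" using c(4) cc(6) by force
  qed (use b in auto)
qed

text \<open>Smoothness of the group law in a form free of target charts: the product is tested by a
  smooth \<open>f\<close>, and a target chart is chosen only locally, near each product.\<close>

lemma mult_chart_Ck:
  assumes "f \<in> smooth_functions A" "(U, \<phi>) \<in> A" "(W, \<psi>) \<in> A"
  shows "Ck_on k (\<lambda>z. f (inv_into U \<phi> (fst z) + inv_into W \<psi> (snd z))) (\<phi> ` U \<times> \<psi> ` W)"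
proof (rule Ck_on_local)
  note c = chart_props[OF assms(2)] and d = chart_props[OF assms(3)]
  let ?i = "\<lambda>z. (inv_into U \<phi> (fst z), inv_into W \<psi> (snd z))"
  let ?m = "\<lambda>z. inv_into U \<phi> (fst z) + inv_into W \<psi> (snd z)"
  fix z assume z: "z \<in> \<phi> ` U \<times> \<psi> ` W"
  obtain T \<theta> where T: "(T, \<theta>) \<in> A" "?m z \<in> T" by (rule chart_exists)
  note t = chart_props[OF T(1)]
  let ?V = "map_prod \<phi> \<psi> ` (U \<times> W \<inter> (\<lambda>(g, h). g + h) -` T)"
  have V: "?V = (\<phi> ` U \<times> \<psi> ` W) \<inter> ?m -` T"
    using c(6) d(6) by (auto simp: image_iff)
  have cm: "continuous_on (\<phi> ` U \<times> \<psi> ` W) ?m"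
    by (intro continuous_on_add continuous_on_compose2[OF c(4)] continuous_on_compose2[OF d(4)] continuous_intros) auto
  have oV: "open ?V" unfolding V
    by (rule continuous_open_preimage[OF cm _ t(1)]) (use c(2) d(2) open_Times in auto)
  have inv: "inv_into (U \<times> W) (map_prod \<phi> \<psi>) y = ?i y" if "y \<in> \<phi> ` U \<times> \<psi> ` W" for y
    by (rule inv_into_f_eq) (use c(5,6) d(5,6) that in \<open>auto simp: inj_on_def\<close>)
  let ?G = "\<theta> \<circ> (\<lambda>(g, h). g + h) \<circ> inv_into (U \<times> W) (map_prod \<phi> \<psi>)"
  have "(U \<times> W, map_prod \<phi> \<psi>) \<in> prod_atlas A A" using assms by (auto simp: prod_atlas_def)
  then have "Ck_on k ?G ?V"
    using lie T(1) by (fastforce simp: lie_group_def smooth_map_def smooth_on_def)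
  from Ck_on_compose[OF oV t(2) this smooth_functions_Ck[OF assms(1) T(1)]]
  have "Ck_on k (\<lambda>z. f (inv_into T \<theta> (?G z))) ?V"
    unfolding V using inv by auto
  then have "Ck_on k (\<lambda>z. f (?m z)) ?V"
    by (rule Ck_on_cong[OF oV, rotated]) (use inv t(6) in \<open>auto simp: V\<close>)
  moreover have "z \<in> ?V" using z T(2) by (simp add: V)
  ultimately show "\<exists>V. open V \<and> z \<in> V \<and> Ck_on k (\<lambda>z. f (?m z)) V" using oV by blast
qed

lemma smooth_functions_right_translate:
  assumes "f \<in> smooth_functions A" shows "(\<lambda>x. f (x + q)) \<in> smooth_functions A"
proof -
  have "Ck_on k (\<lambda>x. f (inv_into U \<phi> x + q)) (\<phi> ` U)" if U: "(U, \<phi>) \<in> A" for U \<phi> k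
  proof -
    obtain W \<psi> where W: "(W, \<psi>) \<in> A" "q \<in> W" by (rule chart_exists)
    note c = chart_props[OF U] and d = chart_props[OF W(1)]
    have "Ck_on k (\<lambda>x. (x, \<psi> q)) (\<phi> ` U)" by (intro Ck_on_Pair c(2) Ck_on_ident Ck_on_const)
    from Ck_on_compose[OF c(2) open_Times[OF c(2) d(2)] this mult_chart_Ck[OF assms U W(1)]]
    show ?thesis using W(2) d(6) by auto
  qed
  moreover have "continuous_on UNIV (\<lambda>x. f (x + q))"
    by (rule continuous_on_compose2[OF smooth_functions_continuous[OF assms]]) (auto intro!: continuous_on_add)
  ultimately show ?thesis by (auto simp: smooth_functions_iff)
qed

lemma smooth_functions_left_translate:
  assumes "f \<in> smooth_functions A" shows "(\<lambda>x. f (q + x)) \<in> smooth_functions A"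
proof -
  have "Ck_on k (\<lambda>x. f (q + inv_into U \<phi> x)) (\<phi> ` U)" if U: "(U, \<phi>) \<in> A" for U \<phi> k
  proof -
    obtain W \<psi> where W: "(W, \<psi>) \<in> A" "q \<in> W" by (rule chart_exists)
    note c = chart_props[OF U] and d = chart_props[OF W(1)]
    have "Ck_on k (\<lambda>x. (\<psi> q, x)) (\<phi> ` U)" by (intro Ck_on_Pair c(2) Ck_on_ident Ck_on_const)
    from Ck_on_compose[OF c(2) open_Times[OF d(2) c(2)] this mult_chart_Ck[OF assms W(1) U]]
    show ?thesis using W(2) d(6) by auto
  qed
  moreover have "continuous_on UNIV (\<lambda>x. f (q + x))"
    by (rule continuous_on_compose2[OF smooth_functions_continuous[OF assms]]) (auto intro!: continuous_on_add)
  ultimately show ?thesis by (auto simp: smooth_functions_iff)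
qed

end

section \<open>Left-invariant fields in charts\<close>

locale lie_group_algebra = lie_group_atlas A
  for A :: "('g::{topological_group_add, t2_space, second_countable_topology}, 'm::euclidean_space) chart set" +
  fixes L :: "'v::euclidean_space \<Rightarrow> ('g \<Rightarrow> real) \<Rightarrow> ('g \<Rightarrow> real)"
  assumes lie_alg: "lie_algebra A L"
begin

abbreviation S :: "('g \<Rightarrow> real) set" where "S \<equiv> smooth_functions A"

lemma L_field: "left_invariant_field A (L v)"
  using lie_alg by (auto simp: lie_algebra_def bij_betw_def)

lemma L_surj: assumes "left_invariant_field A X" obtains v where "L v = X"
proof -
  have "X \<in> range L" using lie_alg assms by (auto simp: lie_algebra_def bij_betw_def)
  then show ?thesis using that by auto
qed

lemma L_inj: "L v = L w \<Longrightarrow> v = w"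
  using lie_alg by (auto simp: lie_algebra_def bij_betw_def inj_on_def)

lemma L_lin: "L (a *\<^sub>R v + b *\<^sub>R w) f g = a * L v f g + b * L w f g"
  using lie_alg by (auto simp: lie_algebra_def)

lemma L_add: "L (v + w) f g = L v f g + L w f g" using L_lin[of 1 v 1 w] by simp
lemma L_scale: "L (a *\<^sub>R v) f g = a * L v f g" using L_lin[of a v 0 0] by simp
lemma L_0 [simp]: "L 0 f g = 0" using L_scale[of 0 0] by simp
lemma L_minus: "L (- v) f g = - L v f g" using L_scale[of "-1" v] by simp
lemma L_sum: "L (\<Sum>i\<in>I. v i) f g = (\<Sum>i\<in>I. L (v i) f g)"
  by (induction I rule: infinite_finite_induct) (auto simp: L_add)

lemma L_eqI: assumes "\<And>f g. f \<in> S \<Longrightarrow> L v f g = L w f g" shows "v = w"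
proof (rule L_inj, rule ext, rule ext)
  show "L v f g = L w f g" for f g
    using assms L_field by (cases "f \<in> S") (auto simp: left_invariant_field_def)
qed

lemma L_smooth: "f \<in> S \<Longrightarrow> L v f \<in> S"
  and L_nonsmooth: "f \<notin> S \<Longrightarrow> L v f = (\<lambda>_. 0)"
  and L_fun_lin: "f \<in> S \<Longrightarrow> h \<in> S \<Longrightarrow> L v (\<lambda>g. a * f g + b * h g) = (\<lambda>g. a * L v f g + b * L v h g)"
  and L_fun_mult: "f \<in> S \<Longrightarrow> h \<in> S \<Longrightarrow> L v (\<lambda>g. f g * h g) = (\<lambda>g. f g * L v h g + L v f g * h g)"
  and L_left: "f \<in> S \<Longrightarrow> L v (\<lambda>g. f (p + g)) = (\<lambda>g. L v f (p + g))"
  using L_field[of v] unfolding left_invariant_field_def by blast+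

lemma L_continuous: "f \<in> S \<Longrightarrow> continuous_on UNIV (L v f)"
  using L_smooth smooth_functions_continuous by blast

lemma L_fun_add: "f \<in> S \<Longrightarrow> h \<in> S \<Longrightarrow> L v (\<lambda>g. f g + h g) = (\<lambda>g. L v f g + L v h g)"
  using L_fun_lin[of f h v 1 1] by simp

lemma L_fun_diff: "f \<in> S \<Longrightarrow> h \<in> S \<Longrightarrow> L v (\<lambda>g. f g - h g) = (\<lambda>g. L v f g - L v h g)"
  using L_fun_lin[of f h v 1 "-1"] by simp

lemma L_fun_const: "L v (\<lambda>g. c) = (\<lambda>g. 0)"
proof -
  have 1: "L v (\<lambda>g. 1) = (\<lambda>g. 0)"
    using L_fun_mult[of "\<lambda>g. 1" "\<lambda>g. 1" v] by (simp add: fun_eq_iff)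
  have "L v (\<lambda>g. c) = L v (\<lambda>g. c * 1 + 0 * 1)" by simp
  also have "\<dots> = (\<lambda>g. 0)" by (subst L_fun_lin) (auto simp: 1)
  finally show ?thesis .
qed

lemma L_fun_sum:
  "(\<And>i. i \<in> I \<Longrightarrow> f i \<in> S) \<Longrightarrow> L v (\<lambda>g. \<Sum>i\<in>I. f i g) = (\<lambda>g. \<Sum>i\<in>I. L v (f i) g)"
proof (induction I rule: infinite_finite_induct)
  case (insert i I)
  then have "L v (\<lambda>g. f i g + (\<Sum>i\<in>I. f i g)) = (\<lambda>g. L v (f i) g + L v (\<lambda>g. \<Sum>i\<in>I. f i g) g)"
    by (intro L_fun_add smooth_functions_sum) auto
  then show ?case using insert by simp
qed (auto simp: L_fun_const)

text \<open>For a bump \<open>b\<close> that is 1 at \<open>p\<close> and supported in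
  \<open>N\<close>, the products of \<open>b\<close> with \<open>f\<close> and with \<open>h\<close>
  coincide globally. The product rule isolates \<open>L v f p\<close>, up to a term that is the same
  for \<open>h\<close> since \<open>f p = h p\<close>.\<close>

lemma L_local:
  assumes "f \<in> S" "h \<in> S" "open N" "p \<in> N" "\<And>x. x \<in> N \<Longrightarrow> f x = h x"
  shows "L v f p = L v h p"
proof -
  obtain b N' K where b: "b \<in> S" "p \<in> N'" "\<And>x. x \<in> N' \<Longrightarrow> b x = 1" "K \<subseteq> N" "\<And>x. x \<notin> K \<Longrightarrow> b x = 0"
    using bump_exists[OF assms(3,4)] by metis
  have "(\<lambda>x. b x * f x) = (\<lambda>x. b x * h x)" using b(4,5) assms(5) by fastforce
  then have "L v (\<lambda>x. b x * f x) p = L v (\<lambda>x. b x * h x) p" by simp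
  then show ?thesis using b assms by (simp add: L_fun_mult)
qed

text \<open>A derivation is a first order operator in the chart. Its coefficients are the values on
  globally smooth functions \<open>u i\<close> that agree with the coordinates near
  \<open>p0\<close>; hence they are smooth, and one neighbourhood \<open>N\<close> serves all
  \<open>f\<close> and \<open>v\<close>.\<close>

lemma chart_coordinates:
  assumes "(U, \<phi>) \<in> A" "p0 \<in> U"
  obtains u N where "\<And>i. u i \<in> S" "open N" "p0 \<in> N" "N \<subseteq> U" "\<And>i x. x \<in> N \<Longrightarrow> u i x = \<phi> x \<bullet> i"
    "\<And>v f p. f \<in> S \<Longrightarrow> p \<in> N \<Longrightarrow>
      L v f p = (\<Sum>i\<in>Basis. L v (u i) p * frechet_derivative (\<lambda>x. f (inv_into U \<phi> x)) (at (\<phi> p)) i)"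
proof -
  note c = chart_props[OF assms(1)]
  obtain R where R: "R > 0" "cball (\<phi> p0) R \<subseteq> \<phi> ` U"
    using c(2) assms(2) open_contains_cball by blast
  obtain \<beta> :: "'m \<Rightarrow> real" where b: "\<And>k. Ck_on k \<beta> UNIV" "\<And>x. 0 \<le> \<beta> x" "\<And>x. \<beta> x \<le> 1"
    "\<And>x. dist (\<phi> p0) x \<le> R/2 \<Longrightarrow> \<beta> x = 1" "\<And>x. R \<le> dist (\<phi> p0) x \<Longrightarrow> \<beta> x = 0"
    using smooth_plateau[of "R/2" R "\<phi> p0"] R(1) by auto
  have K: "compact (cball (\<phi> p0) R)" by simp
  have ck: "Ck_on k (\<lambda>x. \<beta> x * (x \<bullet> i)) UNIV" for k i
    by (intro Ck_on_mult open_UNIV b Ck_on_bounded_linear bounded_linear_inner_left)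
  have z: "\<And>x. x \<notin> cball (\<phi> p0) R \<Longrightarrow> \<beta> x * (x \<bullet> i) = 0" for i using b(5) by auto
  define u where "u i p = (if p \<in> U then \<beta> (\<phi> p) * (\<phi> p \<bullet> i) else 0)" for i p
  have u: "u i \<in> S" for i unfolding u_def[abs_def] by (rule chart_extension(1)[OF assms(1) K R(2) ck z])
  define N where "N = {x \<in> U. \<phi> x \<in> ball (\<phi> p0) (R/2)}"
  have N: "open N" "p0 \<in> N" "N \<subseteq> U"
    unfolding N_def by (rule chart_preimage_open[OF assms(1) open_ball]) (use assms R in auto)
  have uN: "u i x = \<phi> x \<bullet> i" if "x \<in> N" for i x using that b(4) by (auto simp: N_def u_def)
  have "L v f p = (\<Sum>i\<in>Basis. L v (u i) p * frechet_derivative (\<lambda>x. f (inv_into U \<phi> x)) (at (\<phi> p)) i)"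
    if f: "f \<in> S" and p: "p \<in> N" for v f p
  proof -
    let ?B = "ball (\<phi> p0) (R/2)" and ?f = "\<lambda>x. f (inv_into U \<phi> x)"
    have pB: "\<phi> p \<in> ?B" using p by (simp add: N_def)
    have BU: "?B \<subseteq> \<phi> ` U" using R order_trans[OF subset_trans[OF ball_subset_cball subset_cball[of "R/2" R "\<phi> p0"]]] by auto
    obtain h where h: "\<And>i k. Ck_on k (h i) ?B" "\<And>i. h i (\<phi> p) = frechet_derivative ?f (at (\<phi> p)) i"
       "\<And>y. y \<in> ?B \<Longrightarrow> ?f y = ?f (\<phi> p) + (\<Sum>i\<in>Basis. ((y - \<phi> p) \<bullet> i) * h i y)"
      by (rule Hadamard_expansion[OF open_ball convex_ball pB Ck_on_subset[OF smooth_functions_Ck[OF f assms(1)] BU]])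
         (rule that)
    obtain r where r: "r > 0" "cball (\<phi> p) r \<subseteq> ?B" using pB open_contains_cball by blast
    obtain \<gamma> :: "'m \<Rightarrow> real" where g: "\<And>k. Ck_on k \<gamma> UNIV" "\<And>x. 0 \<le> \<gamma> x" "\<And>x. \<gamma> x \<le> 1"
      "\<And>x. dist (\<phi> p) x \<le> r/2 \<Longrightarrow> \<gamma> x = 1" "\<And>x. r \<le> dist (\<phi> p) x \<Longrightarrow> \<gamma> x = 0"
      using smooth_plateau[of "r/2" r "\<phi> p"] r(1) by auto
    \<comment> \<open>Hadamard's coefficients live on a ball, while derivations act on global
      functions; the cutoff changes nothing near \<open>p\<close>.\<close>
    define k where "k i x = (if x \<in> ?B then \<gamma> x * h i x else 0)" for i x
    have kC: "Ck_on n (k i) UNIV" for n i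
      unfolding k_def by (rule Ck_on_cutoff[OF open_ball closed_cball r(2) h(1) g(1)]) (use g(5) in auto)
    have kz: "\<And>x. x \<notin> cball (\<phi> p) r \<Longrightarrow> k i x = 0" for i using g(5) by (auto simp: k_def)
    define H where "H i x = (if x \<in> U then k i (\<phi> x) else 0)" for i x
    have H: "H i \<in> S" for i unfolding H_def
      by (rule chart_extension(1)[OF assms(1) compact_cball _ kC kz]) (use r(2) BU in blast)
    define N2 where "N2 = {x \<in> U. \<phi> x \<in> ball (\<phi> p) (r/2)}"
    have N2: "open N2" "p \<in> N2"
      unfolding N2_def by (rule chart_preimage_open[OF assms(1) open_ball]) (use p N(3) r in auto)
    have N2N: "x \<in> N" if "x \<in> N2" for x
    proof -
      have "\<phi> x \<in> cball (\<phi> p) r" using that r(1) by (auto simp: N2_def)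
      then show ?thesis using that r(2) by (auto simp: N2_def N_def)
    qed
    let ?F = "\<lambda>x. f p + (\<Sum>i\<in>Basis. (u i x - u i p) * H i x)"
    have FS: "?F \<in> S" by (intro smooth_functions_add smooth_functions_const smooth_functions_sum smooth_functions_mult smooth_functions_diff u H)
    have "f x = ?F x" if x: "x \<in> N2" for x
    proof -
      have xB: "\<phi> x \<in> ?B" "x \<in> U" using N2N[OF x] by (auto simp: N_def)
      have "f x = f p + (\<Sum>i\<in>Basis. ((\<phi> x - \<phi> p) \<bullet> i) * h i (\<phi> x))"
        using h(3)[OF xB(1)] c(6) xB p N(3) by auto
      also have "\<dots> = ?F x"
      proof -
        have "((\<phi> x - \<phi> p) \<bullet> i) * h i (\<phi> x) = (u i x - u i p) * H i x" for i
          using uN[OF N2N[OF x]] uN[OF p] xB x g(4)[of "\<phi> x"] by (simp add: inner_diff_left H_def k_def N2_def)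
        then show ?thesis by simp
      qed
      finally show ?thesis .
    qed
    then have "L v f p = L v ?F p" by (rule L_local[OF f FS N2])
    \<comment> \<open>At \<open>p\<close> the factor \<open>u i x - u i p\<close> vanishes, so only
      the term in which it is differentiated survives.\<close>
    also have "\<dots> = (\<Sum>i\<in>Basis. L v (u i) p * H i p)"
      by (simp add: L_fun_add L_fun_diff L_fun_sum L_fun_mult L_fun_const smooth_functions_diff
          smooth_functions_mult smooth_functions_sum u H)
    also have "(\<lambda>i. H i p) = (\<lambda>i. frechet_derivative ?f (at (\<phi> p)) i)"
      using h(2) p N(3) pB g(4)[of "\<phi> p"] r(1) by (auto simp: H_def k_def)
    finally show ?thesis .
  qed
  from that[OF u N uN this] show ?thesis .
qed

lemma frechet_derivative_partial:
  assumes "G differentiable (at (x, y))"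
  shows "frechet_derivative (\<lambda>x. G (x, y)) (at x) a = frechet_derivative G (at (x, y)) (a, 0)"
    "frechet_derivative (\<lambda>y. G (x, y)) (at y) b = frechet_derivative G (at (x, y)) (0, b)"
proof -
  have G: "(G has_derivative frechet_derivative G (at (x, y))) (at (x, y))"
    using assms by (simp add: frechet_derivative_works)
  have "((\<lambda>x. (x, y)) has_derivative (\<lambda>a. (a, 0))) (at x)" by (auto intro!: derivative_eq_intros)
  from frechet_derivative_at[OF has_derivative_compose[OF this G]]
  show "frechet_derivative (\<lambda>x. G (x, y)) (at x) a = frechet_derivative G (at (x, y)) (a, 0)" by (simp add: fun_eq_iff)
  have "((\<lambda>y. (x, y)) has_derivative (\<lambda>a. (0, a))) (at y)" by (auto intro!: derivative_eq_intros)
  from frechet_derivative_at[OF has_derivative_compose[OF this G]]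
  show "frechet_derivative (\<lambda>y. G (x, y)) (at y) b = frechet_derivative G (at (x, y)) (0, b)" by (simp add: fun_eq_iff)
qed

text \<open>Joint continuity in both points is what the exchange of mixed derivatives in
  \<open>Ad_E_derivative_0\<close> asks for.\<close>

lemma L_right_translate_continuous:
  assumes "f \<in> S"
  shows "continuous_on UNIV (\<lambda>(p, q). L v (\<lambda>x. f (x + q)) p)"
proof (rule continuous_at_imp_continuous_on, rule ballI)
  fix z :: "'g \<times> 'g"
  obtain p0 q0 where z: "z = (p0, q0)" by force
  obtain U \<phi> where U: "(U, \<phi>) \<in> A" "p0 \<in> U" by (rule chart_exists)
  obtain W \<psi> where W: "(W, \<psi>) \<in> A" "q0 \<in> W" by (rule chart_exists)
  note c = chart_props[OF U(1)] and d = chart_props[OF W(1)]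
  obtain u N where u: "\<And>i. u i \<in> S" "open N" "p0 \<in> N" "N \<subseteq> U"
    "\<And>v f p. f \<in> S \<Longrightarrow> p \<in> N \<Longrightarrow>
      L v f p = (\<Sum>i\<in>Basis. L v (u i) p * frechet_derivative (\<lambda>x. f (inv_into U \<phi> x)) (at (\<phi> p)) i)"
    by (rule chart_coordinates[OF U]) (rule that)
  let ?G = "\<lambda>z. f (inv_into U \<phi> (fst z) + inv_into W \<psi> (snd z))"
  have G: "Ck_on (Suc 0) ?G (\<phi> ` U \<times> \<psi> ` W)" by (rule mult_chart_Ck[OF assms U(1) W(1)])
  have "L v (\<lambda>x. f (x + q)) p = (\<Sum>i\<in>Basis. L v (u i) p * frechet_derivative ?G (at (\<phi> p, \<psi> q)) (i, 0))"
    if "p \<in> N" "q \<in> W" for p q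
  proof -
    have "?G differentiable (at (\<phi> p, \<psi> q))" using G that u(4) by auto
    from frechet_derivative_partial(1)[OF this] 
    show ?thesis
      using u(5)[OF smooth_functions_right_translate[OF assms] that(1), of v q] d(6)[OF that(2)] by simp
  qed
  moreover have "continuous_on (N \<times> W)
     (\<lambda>y. \<Sum>i\<in>Basis. L v (u i) (fst y) * frechet_derivative ?G (at (\<phi> (fst y), \<psi> (snd y))) (i, 0))"
  proof (intro continuous_on_sum continuous_on_mult)
    fix i :: 'm
    show "continuous_on (N \<times> W) (\<lambda>y. L v (u i) (fst y))"
      by (rule continuous_on_compose2[OF L_continuous[OF u(1)]]) (auto intro!: continuous_intros)
    have "continuous_on (\<phi> ` U \<times> \<psi> ` W) (\<lambda>y. frechet_derivative ?G (at y) (i, 0))" using G by auto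
    then show "continuous_on (N \<times> W) (\<lambda>y. frechet_derivative ?G (at (\<phi> (fst y), \<psi> (snd y))) (i, 0))"
    proof (rule continuous_on_compose2)
      show "continuous_on (N \<times> W) (\<lambda>y. (\<phi> (fst y), \<psi> (snd y)))"
        by (intro continuous_on_Pair continuous_on_compose2[OF c(3)] continuous_on_compose2[OF d(3)] continuous_intros)
           (use u(4) in auto)
    qed (use u(4) in auto)
  qed
  ultimately have "continuous_on (N \<times> W) (\<lambda>(p, q). L v (\<lambda>x. f (x + q)) p)"
    by (subst continuous_on_cong[OF refl]) (auto split: prod.splits)
  then show "isCont (\<lambda>(p, q). L v (\<lambda>x. f (x + q)) p) z"
    using z u(2,3) W(2) d(1) by (auto simp: continuous_on_eq_continuous_at open_Times)
qed

section \<open>Chart dimension against the dimension of the Lie algebra\<close>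

lemma chart_field:
  assumes "(U, \<phi>) \<in> A" "0 \<in> U"
  defines "X \<equiv> \<lambda>a f p. if f \<in> S then frechet_derivative (\<lambda>y. f (p + inv_into U \<phi> y)) (at (\<phi> 0)) a else 0"
  shows "left_invariant_field A (X a)"
proof -
  note c = chart_props[OF assms(1)]
  let ?i = "inv_into U \<phi>"
  have d: "((\<lambda>y. f (p + ?i y)) has_derivative frechet_derivative (\<lambda>y. f (p + ?i y)) (at (\<phi> 0))) (at (\<phi> 0))"
    if "f \<in> S" for f p
    by (rule Ck_on_SucD[OF smooth_functions_Ck[OF smooth_functions_left_translate[OF that] assms(1)]]) (use assms in auto)
  have e: "X a f p = D a" if "f \<in> S" "((\<lambda>y. f (p + ?i y)) has_derivative D) (at (\<phi> 0))" for f p D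
    using frechet_derivative_at[OF that(2)] that(1) by (simp add: X_def)
  have sm: "X a f \<in> S" if f: "f \<in> S" for f
  proof -
    have *: "Ck_on k (\<lambda>x. X a f (inv_into W \<psi> x)) (\<psi> ` W)" if W: "(W, \<psi>) \<in> A" for W \<psi> k
    proof -
      note w = chart_props[OF W]
      let ?G = "\<lambda>z. f (inv_into W \<psi> (fst z) + ?i (snd z))"
      have G: "Ck_on (Suc k) ?G (\<psi> ` W \<times> \<phi> ` U)" for k by (rule mult_chart_Ck[OF f W assms(1)])
      have "Ck_on k (\<lambda>z. frechet_derivative ?G (at z) (0, a)) (\<psi> ` W \<times> \<phi> ` U)" using G[of k] by auto
      moreover have "Ck_on k (\<lambda>x. (x, \<phi> 0)) (\<psi> ` W)" by (intro Ck_on_Pair w(2) Ck_on_ident Ck_on_const)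
      ultimately have "Ck_on k (\<lambda>x. frechet_derivative ?G (at (x, \<phi> 0)) (0, a)) (\<psi> ` W)"
        using assms(2) by (intro Ck_on_compose[OF w(2) open_Times[OF w(2) c(2)], where f="\<lambda>x. (x, \<phi> 0)" and g = "\<lambda>z. frechet_derivative ?G (at z) (0, a)"]) auto
      then show ?thesis
      proof (rule Ck_on_cong[OF w(2), rotated])
        fix x assume "x \<in> \<psi> ` W"
        then have "?G differentiable (at (x, \<phi> 0))" using G[of 0] assms(2) by auto
        from frechet_derivative_partial(2)[OF this, of a]
        show "frechet_derivative ?G (at (x, \<phi> 0)) (0, a) = X a f (inv_into W \<psi> x)" using f by (simp add: X_def)
      qed
    qed
    have "continuous_on UNIV (X a f)"
    proof (rule continuous_at_imp_continuous_on, rule ballI)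
      fix p
      obtain W \<psi> where W: "(W, \<psi>) \<in> A" "p \<in> W" by (rule chart_exists)
      note w = chart_props[OF W(1)]
      have "continuous_on W (\<lambda>p. X a f (inv_into W \<psi> (\<psi> p)))"
        by (rule continuous_on_compose2[OF Ck_on_imp_continuous_on[OF *[OF W(1), of 0]] w(3)]) auto
      then have "continuous_on W (X a f)" by (rule continuous_on_eq) (simp add: w(6))
      then show "isCont (X a f) p" using W(2) w(1) by (simp add: continuous_on_eq_continuous_at)
    qed
    then show ?thesis using * by (auto simp: smooth_functions_iff)
  qed
  show ?thesis
    unfolding left_invariant_field_def
  proof (intro conjI ballI allI impI)
    fix f h assume f: "f \<in> S" and h: "h \<in> S"
    show "X a (\<lambda>g. r * f g + s * h g) = (\<lambda>g. r * X a f g + s * X a h g)" for r s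
    proof
      fix g
      have "((\<lambda>y. r * f (g + ?i y) + s * h (g + ?i y)) has_derivative
        (\<lambda>v. r * frechet_derivative (\<lambda>y. f (g + ?i y)) (at (\<phi> 0)) v + s * frechet_derivative (\<lambda>y. h (g + ?i y)) (at (\<phi> 0)) v)) (at (\<phi> 0))"
        by (intro has_derivative_add has_derivative_mult_right d f h)
      from e[OF _ this] show "X a (\<lambda>g. r * f g + s * h g) g = r * X a f g + s * X a h g"
        using f h by (simp add: X_def smooth_functions_add smooth_functions_cmult)
    qed
    show "X a (\<lambda>g. f g * h g) = (\<lambda>g. f g * X a h g + X a f g * h g)"
    proof
      fix g
      note e[OF smooth_functions_mult[OF f h] has_derivative_mult[OF d[OF f] d[OF h]]]
      then show "X a (\<lambda>g. f g * h g) g = f g * X a h g + X a f g * h g"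
        using f h c(6)[OF assms(2)] by (simp add: X_def)
    qed
  next
    fix f p assume f: "f \<in> S"
    then show "X a (\<lambda>g. f (p + g)) = (\<lambda>g. X a f (p + g))"
      using smooth_functions_left_translate[OF f] by (simp add: X_def fun_eq_iff add.assoc)
  qed (use sm in \<open>auto simp: X_def\<close>)
qed

text \<open>The types carrying the charts and the Lie algebra are unrelated by definition. Left
  translation turns every chart direction at the identity into a left-invariant field, and different
  directions give different fields. Invariance of domain asks for this inequality in
  \<open>E_open_map\<close>.\<close>

lemma DIM_le: "DIM('m) \<le> DIM('v)"
proof -
  obtain U \<phi> where U: "(U, \<phi>) \<in> A" "0 \<in> U" by (rule chart_exists)
  note c = chart_props[OF U(1)]
  let ?i = "inv_into U \<phi>"
  define X where "X a f p = (if f \<in> S then frechet_derivative (\<lambda>y. f (p + ?i y)) (at (\<phi> 0)) a else 0)" for a f p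
  have "left_invariant_field A (X a)" for a unfolding X_def by (rule chart_field[OF U])
  then have "\<forall>a. \<exists>v. L v = X a" using L_surj by metis
  then obtain T where T: "\<And>a. L (T a) = X a" by metis
  have d: "linear (frechet_derivative (\<lambda>y. f (p + ?i y)) (at (\<phi> 0)))" if "f \<in> S" for f p
    by (rule has_derivative_linear[OF Ck_on_SucD[OF smooth_functions_Ck[OF smooth_functions_left_translate[OF that] U(1)]]])
       (use U in auto)
  have lin: "linear T"
  proof
    show "T (a + b) = T a + T b" for a b
      by (rule L_eqI) (simp add: T L_add X_def linear_add[OF d])
    show "T (r *\<^sub>R a) = r *\<^sub>R T a" for r a
      by (rule L_eqI) (simp add: T L_scale X_def linear_cmul[OF d])
  qed
  obtain u N where u: "\<And>i. u i \<in> S" "open N" "0 \<in> N" "N \<subseteq> U" "\<And>i x. x \<in> N \<Longrightarrow> u i x = \<phi> x \<bullet> i"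
    by (rule chart_coordinates[OF U]) (rule that)
  have Xu: "X a (u i) 0 = a \<bullet> i" for a i
  proof -
    have o: "open (\<phi> ` (U \<inter> N))" using chart_image_open[OF U(1) u(2)] .
    have "((\<lambda>y. y \<bullet> i) has_derivative (\<lambda>a. a \<bullet> i)) (at (\<phi> 0))" by (auto intro!: derivative_eq_intros)
    then have "((\<lambda>y. u i (0 + ?i y)) has_derivative (\<lambda>a. a \<bullet> i)) (at (\<phi> 0))"
      by (rule has_derivative_transform_within_open[OF _ o]) (use u U c(6) in auto)
    from frechet_derivative_at[OF this] show ?thesis using u(1) by (simp add: X_def fun_eq_iff)
  qed
  have "inj T"
  proof (rule injI)
    fix a b assume "T a = T b"
    then have e: "X a = X b" using T[of a] T[of b] by simp
    have i: "a \<bullet> i = b \<bullet> i" for i using Xu[of a i] Xu[of b i] unfolding e by simp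
    show "a = b" by (rule euclidean_eqI) (rule i)
  qed
  then have "dim (T ` UNIV) = dim (UNIV :: 'm set)" by (intro dim_image_eq[OF lin]) simp
  then show ?thesis using dim_subset_UNIV[of "T ` UNIV"] by simp
qed

end

section \<open>Existence of one-parameter subgroups\<close>

lemma picard_lindelof:
  fixes b :: "'a::euclidean_space \<Rightarrow> 'a"
  assumes K: "K > 0" and lip: "\<And>x y. dist (b x) (b y) \<le> K * dist x y"
  obtains T c where "T > 0" "c 0 = x0" "\<And>t. \<bar>t\<bar> < T \<Longrightarrow> (c has_vector_derivative b (c t)) (at t)"
proof -
  \<comment> \<open>The integral from 0 is written as a difference of two integrals that start at
    -T, over lengths at most 2T and T. So the Picard operator has Lipschitz constant 3KT, which this
    choice makes 1/2.\<close>
  define T where "T = 1 / (6 * K)"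
  have T: "T > 0" using K by (simp add: T_def)
  \<comment> \<open>Freezing time outside [-T, T] lets the operator act on bounded continuous
    functions on the whole line, a complete space.\<close>
  define cl where "cl t = max (-T) (min T t)" for t
  have cl: "cl t \<in> {-T..T}" "\<bar>t\<bar> < T \<Longrightarrow> cl t = t" for t using T by (auto simp: cl_def)
  have clc: "continuous_on UNIV cl" unfolding cl_def by (intro continuous_intros)
  have bc: "continuous_on UNIV b"
    by (rule lipschitz_on_continuous_on[of K]) (use lip K in \<open>auto simp: lipschitz_on_def\<close>)
  define J where "J g t = integral {-T..t} g - integral {-T..0} g" for g :: "real \<Rightarrow> 'a" and t
  define P where "P c t = x0 + J (\<lambda>s. b (apply_bcontfun c s)) (cl t)" for c :: "real \<Rightarrow>\<^sub>C 'a" and t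
  have gc: "continuous_on X (\<lambda>s. b (apply_bcontfun c s))" for c :: "real \<Rightarrow>\<^sub>C 'a" and X
    by (rule continuous_on_compose2[OF bc]) (auto intro!: continuous_intros)
  have gi: "(\<lambda>s. b (apply_bcontfun c s)) integrable_on {x..y}" for c :: "real \<Rightarrow>\<^sub>C 'a" and x y
    by (rule integrable_continuous_interval[OF gc])
  have PB: "P c \<in> bcontfun" for c
  proof -
    have J: "continuous_on {-T..T} (J (\<lambda>s. b (apply_bcontfun c s)))"
      unfolding J_def by (intro continuous_on_diff continuous_on_const indefinite_integral_continuous_1 gi)
    have "continuous_on UNIV (P c)"
      unfolding P_def by (intro continuous_on_add continuous_on_const continuous_on_compose2[OF J clc]) (use cl in auto)
    moreover have "range (P c) \<subseteq> (\<lambda>t. x0 + J (\<lambda>s. b (apply_bcontfun c s)) t) ` {-T..T}"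
      using cl(1) by (auto simp: P_def)
    moreover have "bounded ((\<lambda>t. x0 + J (\<lambda>s. b (apply_bcontfun c s)) t) ` {-T..T})"
      by (intro compact_imp_bounded compact_continuous_image continuous_on_add continuous_on_const J) auto
    ultimately show ?thesis using bounded_subset by (auto simp: bcontfun_def)
  qed
  have D: "dist (Bcontfun (P c)) (Bcontfun (P d)) \<le> 1/2 * dist c d" for c d
  proof (rule dist_bound)
    fix t
    have *: "norm (integral {-T..s} (\<lambda>s. b (apply_bcontfun c s)) - integral {-T..s} (\<lambda>s. b (apply_bcontfun d s)))
        \<le> K * dist c d * (s - (-T))" if "s \<in> {-T..T}" for s
    proof -
      have "integral {-T..s} (\<lambda>s. b (apply_bcontfun c s)) - integral {-T..s} (\<lambda>s. b (apply_bcontfun d s))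
        = integral {-T..s} (\<lambda>s. b (apply_bcontfun c s) - b (apply_bcontfun d s))"
        by (rule integral_diff[symmetric]) (rule gi)+
      also have "norm \<dots> \<le> K * dist c d * (s - (-T))"
      proof (rule integral_bound)
        show "continuous_on {- T..s} (\<lambda>s. b (apply_bcontfun c s) - b (apply_bcontfun d s))"
          by (intro continuous_on_diff gc)
        show "norm (b (apply_bcontfun c t) - b (apply_bcontfun d t)) \<le> K * dist c d" for t
        proof -
          have "dist (b (apply_bcontfun c t)) (b (apply_bcontfun d t)) \<le> K * dist (apply_bcontfun c t) (apply_bcontfun d t)"
            by (rule lip)
          also have "\<dots> \<le> K * dist c d" using K by (intro mult_left_mono dist_bounded) auto
          finally show ?thesis by (simp only: dist_norm)
        qed
      qed (use that in auto)
      finally show ?thesis .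
    qed
    have "norm (P c t - P d t) \<le> K * dist c d * (cl t - (-T)) + K * dist c d * (0 - (-T))"
    proof -
      have "P c t - P d t = (integral {-T..cl t} (\<lambda>s. b (apply_bcontfun c s)) - integral {-T..cl t} (\<lambda>s. b (apply_bcontfun d s)))
         - (integral {-T..0} (\<lambda>s. b (apply_bcontfun c s)) - integral {-T..0} (\<lambda>s. b (apply_bcontfun d s)))"
        by (simp add: P_def J_def)
      also have "norm \<dots> \<le> norm (integral {-T..cl t} (\<lambda>s. b (apply_bcontfun c s)) - integral {-T..cl t} (\<lambda>s. b (apply_bcontfun d s)))
         + norm (integral {-T..0} (\<lambda>s. b (apply_bcontfun c s)) - integral {-T..0} (\<lambda>s. b (apply_bcontfun d s)))"
        by (rule norm_triangle_ineq4)
      also have "\<dots> \<le> K * dist c d * (cl t - (-T)) + K * dist c d * (0 - (-T))"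
        by (intro add_mono *) (use cl(1) T in auto)
      finally show ?thesis .
    qed
    also have "\<dots> = K * dist c d * (cl t + 2 * T)" by (simp add: algebra_simps)
    also have "\<dots> \<le> K * dist c d * (3 * T)"
      using cl(1)[of t] K by (intro mult_left_mono mult_nonneg_nonneg) auto
    also have "\<dots> = 1/2 * dist c d" using K by (simp add: T_def)
    finally show "dist (apply_bcontfun (Bcontfun (P c)) t) (apply_bcontfun (Bcontfun (P d)) t) \<le> 1 / 2 * dist c d"
      by (simp add: Bcontfun_inverse PB dist_norm)
  qed
  have "\<exists>!c. Bcontfun (P c) = c"
    by (rule banach_fix_type[of "1/2"]) (use D in auto)
  then obtain c where c: "Bcontfun (P c) = c" by blast
  have e: "apply_bcontfun c t = x0 + J (\<lambda>s. b (apply_bcontfun c s)) (cl t)" for t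
    using Bcontfun_inverse[OF PB, of c] c by (metis P_def)
  show ?thesis
  proof (rule that[OF T, of "apply_bcontfun c"])
    show "apply_bcontfun c 0 = x0" using e[of 0] cl(2)[of 0] T by (simp add: J_def)
    fix t :: real assume t: "\<bar>t\<bar> < T"
    have "((\<lambda>u. integral {-T..u} (\<lambda>s. b (apply_bcontfun c s))) has_vector_derivative b (apply_bcontfun c t)) (at t within {-T..T})"
      by (rule integral_has_vector_derivative[OF gc]) (use t in auto)
    moreover have "at t within {-T..T} = at t" by (rule at_within_interior) (use t in \<open>auto simp: abs_less_iff\<close>)
    ultimately have "((\<lambda>u. x0 + J (\<lambda>s. b (apply_bcontfun c s)) u) has_vector_derivative b (apply_bcontfun c t)) (at t)"
      unfolding J_def by (auto intro!: derivative_eq_intros)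
    then show "(apply_bcontfun c has_vector_derivative b (apply_bcontfun c t)) (at t)"
    proof (rule has_vector_derivative_transform_within_open[where S="{-T<..<T}"])
      fix u assume "u \<in> {-T<..<T}"
      then have "cl u = u" by (intro cl(2)) (auto simp: abs_less_iff)
      then show "x0 + J (\<lambda>s. b (apply_bcontfun c s)) u = apply_bcontfun c u" by (subst (2) e) simp
    qed (use t in \<open>auto simp: abs_less_iff\<close>)
  qed
qed

text \<open>Gronwall's argument: exp(-2Kt) times the squared distance of the two solutions is
  nonincreasing and starts at 0.\<close>

lemma ode_unique_forward:
  fixes b :: "'a::euclidean_space \<Rightarrow> 'a"
  assumes lip: "\<And>x y. dist (b x) (b y) \<le> K * dist x y" and "0 \<le> t" "c 0 = d 0"
    and c: "\<And>s. s \<in> {0..t} \<Longrightarrow> (c has_vector_derivative b (c s)) (at s)"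
    and d: "\<And>s. s \<in> {0..t} \<Longrightarrow> (d has_vector_derivative b (d s)) (at s)"
  shows "c t = d t"
proof -
  define w where "w s = c s - d s" for s
  have "exp (-(2 * K * t)) * (w t \<bullet> w t) \<le> exp (-(2 * K * 0)) * (w 0 \<bullet> w 0)"
  proof (rule DERIV_nonpos_imp_nonincreasing[OF assms(2)])
    fix s assume s: "0 \<le> s" "s \<le> t"
    then have "(w has_vector_derivative (b (c s) - b (d s))) (at s)"
      unfolding w_def by (intro has_vector_derivative_diff c d) auto
    then have w': "(w has_derivative (\<lambda>h. h *\<^sub>R (b (c s) - b (d s)))) (at s)" by (simp only: has_vector_derivative_def)
    have 1: "((\<lambda>s. w s \<bullet> w s) has_real_derivative 2 * (w s \<bullet> (b (c s) - b (d s)))) (at s)"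
      unfolding has_field_derivative_def
      by (rule has_derivative_eq_rhs[OF has_derivative_inner[OF w' w']]) (auto simp: fun_eq_iff inner_commute)
    have 2: "((\<lambda>s. exp (-(2 * K * s))) has_real_derivative - (2 * K) * exp (-(2 * K * s))) (at s)"
      by (auto intro!: derivative_eq_intros)
    have 3: "((\<lambda>s. exp (-(2 * K * s)) * (w s \<bullet> w s)) has_real_derivative
      exp (-(2 * K * s)) * (2 * (w s \<bullet> (b (c s) - b (d s))) - 2 * K * (w s \<bullet> w s))) (at s)"
      using DERIV_mult[OF 2 1] by (simp add: algebra_simps)
    have "w s \<bullet> (b (c s) - b (d s)) \<le> norm (w s) * norm (b (c s) - b (d s))" by (rule norm_cauchy_schwarz)
    also have "\<dots> \<le> norm (w s) * (K * norm (w s))"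
      using lip[of "c s" "d s"] by (intro mult_left_mono) (auto simp: dist_norm w_def)
    also have "\<dots> = K * (w s \<bullet> w s)" by (simp add: dot_square_norm power2_eq_square)
    finally have "exp (-(2 * K * s)) * (2 * (w s \<bullet> (b (c s) - b (d s))) - 2 * K * (w s \<bullet> w s)) \<le> 0"
      by (simp add: mult_le_0_iff)
    then show "\<exists>y. ((\<lambda>s. exp (-(2 * K * s)) * (w s \<bullet> w s)) has_real_derivative y) (at s) \<and> y \<le> 0" using 3 by blast
  qed
  then have "w t \<bullet> w t \<le> 0" using assms(3) by (simp add: w_def mult_le_0_iff)
  then have "w t \<bullet> w t = 0" using inner_ge_zero[of "w t"] by linarith
  then show ?thesis by (simp add: w_def)
qed

lemma ode_unique:
  fixes b :: "'a::euclidean_space \<Rightarrow> 'a"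
  assumes lip: "\<And>x y. dist (b x) (b y) \<le> K * dist x y" and "c 0 = d 0"
    and c: "\<And>s. s \<in> closed_segment 0 t \<Longrightarrow> (c has_vector_derivative b (c s)) (at s)"
    and d: "\<And>s. s \<in> closed_segment 0 t \<Longrightarrow> (d has_vector_derivative b (d s)) (at s)"
  shows "c t = d t"
proof (cases "0 \<le> t")
  case True
  then show ?thesis
    using ode_unique_forward[of b K t c d, OF lip True assms(2)] c d by (simp add: closed_segment_eq_real_ivl)
next
  case False
  have r: "((\<lambda>s. e (- s)) has_vector_derivative - b (e (- s))) (at s)"
    if "\<And>s. s \<in> closed_segment 0 t \<Longrightarrow> (e has_vector_derivative b (e s)) (at s)" "s \<in> {0..-t}" for e s
  proof -
    have "(e has_vector_derivative b (e (- s))) (at (- s))"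
      using that False by (auto simp: closed_segment_eq_real_ivl)
    moreover have "((\<lambda>s. - s) has_vector_derivative - 1) (at s)" by (auto intro!: derivative_eq_intros)
    ultimately show ?thesis using vector_diff_chain_at by (fastforce simp: o_def)
  qed
  have l: "dist (- b x) (- b y) \<le> K * dist x y" for x y using lip[of x y] by (simp add: dist_minus)
  have "c (- (- t)) = d (- (- t))"
  proof (rule ode_unique_forward[of "\<lambda>x. - b x" K "- t" "\<lambda>s. c (- s)" "\<lambda>s. d (- s)"])
    show "((\<lambda>s. c (- s)) has_vector_derivative - b (c (- s))) (at s)" if "s \<in> {0..-t}" for s
      using r[of c s] c that by blast
    show "((\<lambda>s. d (- s)) has_vector_derivative - b (d (- s))) (at s)" if "s \<in> {0..-t}" for s
      using r[of d s] d that by blast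
  qed (use l False assms(2) in auto)
  then show ?thesis by simp
qed

lemma isCont_eventually_nhds:
  assumes "isCont f x" "open B" "f x \<in> B" shows "\<forall>\<^sub>F y in nhds x. f y \<in> B"
  using assms by (auto simp: isCont_def tendsto_at_iff_tendsto_nhds intro: topological_tendstoD)

section \<open>Extending a local one-parameter group\<close>

definition group_mult :: "nat \<Rightarrow> 'a::group_add \<Rightarrow> 'a" where
  "group_mult n x = ((+) x ^^ n) 0"

lemma group_mult_simps [simp]: "group_mult 0 x = 0" "group_mult (Suc n) x = x + group_mult n x"
  by (auto simp: group_mult_def)

lemma group_mult_add: "group_mult (m + n) x = group_mult m x + group_mult n x"
  by (induction m) (auto simp: add.assoc)

lemma group_mult_mult: "group_mult (m * n) x = group_mult m (group_mult n x)"
  by (induction m) (auto simp: group_mult_add)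

lemma group_mult_commute:
  assumes "a + b = b + (a::'a::group_add)" shows "group_mult n a + b = b + group_mult n a"
proof (induction n)
  case (Suc n)
  have "group_mult (Suc n) a + b = a + (group_mult n a + b)" by (simp add: add.assoc)
  also have "\<dots> = (a + b) + group_mult n a" using Suc by (simp add: add.assoc)
  also have "\<dots> = b + group_mult (Suc n) a" using assms by (simp add: add.assoc)
  finally show ?case .
qed auto

lemma group_mult_distrib:
  assumes "a + b = b + (a::'a::group_add)" shows "group_mult n (a + b) = group_mult n a + group_mult n b"
proof (induction n)
  case (Suc n)
  have "group_mult (Suc n) (a + b) = a + (b + group_mult n a) + group_mult n b" using Suc by (simp add: add.assoc)
  also have "b + group_mult n a = group_mult n a + b" using group_mult_commute[OF assms] by simp
  finally show ?case by (simp add: add.assoc)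
qed auto

text \<open>Take the n-th power of c(t/n) for any n with |t| < nT; passing to common multiples shows
  that the choice of n is immaterial. The group may be noncommutative, but c(s/n) and c(t/n) commute
  because s/n + t/n = t/n + s/n, so powers of their product split.\<close>

lemma local_hom_extends:
  fixes c :: "real \<Rightarrow> 'a::group_add"
  assumes T: "T > 0" and hom: "\<And>s t. \<bar>s\<bar> < T \<Longrightarrow> \<bar>t\<bar> < T \<Longrightarrow> \<bar>s + t\<bar> < T \<Longrightarrow> c (s + t) = c s + c t"
  obtains \<gamma> where "\<And>s t. \<gamma> (s + t) = \<gamma> s + \<gamma> t" "\<And>t. \<bar>t\<bar> < T \<Longrightarrow> \<gamma> t = c t"
proof -
  have c0: "c 0 = 0"
  proof -
    have "c 0 + c 0 = c 0 + 0" using hom[of 0 0] T by simp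
    then show ?thesis by (rule add_left_imp_eq)
  qed
  have k: "c (real k * s) = group_mult k (c s)" if "real k * \<bar>s\<bar> < T" for k s
    using that
  proof (induction k)
    case (Suc k)
    have a: "real k * \<bar>s\<bar> < T" "\<bar>s\<bar> < T" using Suc.prems
      by (auto simp: algebra_simps intro: le_less_trans[rotated])
    have "c (real (Suc k) * s) = c (s + real k * s)" by (simp add: algebra_simps)
    also have "\<dots> = c s + c (real k * s)"
    proof (rule hom)
      have "\<bar>s + real k * s\<bar> = real (Suc k) * \<bar>s\<bar>"
        by (simp add: abs_mult[symmetric] algebra_simps) (metis abs_mult abs_of_nat distrib_left mult.right_neutral of_nat_Suc mult.commute add.commute)
      then show "\<bar>s + real k * s\<bar> < T" using Suc.prems by simp
    qed (use a in \<open>auto simp: abs_mult\<close>)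
    finally show ?case using Suc.IH a by simp
  qed (simp add: c0)
  define N where "N t = Suc (nat \<lceil>\<bar>t\<bar> / T\<rceil>)" for t
  have N: "\<bar>t\<bar> < real n * T" if "n \<ge> N t" for n t
  proof -
    have "\<bar>t\<bar> / T < real (N t)" unfolding N_def by linarith
    then have "\<bar>t\<bar> < real (N t) * T" using T by (simp add: field_simps)
    also have "\<dots> \<le> real n * T" using that T by simp
    finally show ?thesis .
  qed
  define \<gamma> where "\<gamma> t = group_mult (N t) (c (t / real (N t)))" for t
  have sub: "group_mult n (c (t / real n)) = group_mult (m * n) (c (t / real (m * n)))"
    if "\<bar>t\<bar> < real n * T" "n > 0" "m > 0" for m n t
  proof -
    have "real m * \<bar>t / real (m * n)\<bar> = \<bar>t\<bar> / real n" using that by (simp add: abs_div)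
    also have "\<dots> < T" using that by (simp add: field_simps)
    finally have "c (real m * (t / real (m * n))) = group_mult m (c (t / real (m * n)))" by (rule k)
    then have "c (t / real n) = group_mult m (c (t / real (m * n)))" using that by simp
    then show ?thesis by (simp add: group_mult_mult[symmetric] mult.commute)
  qed
  have g: "\<gamma> t = group_mult n (c (t / real n))" if "\<bar>t\<bar> < real n * T" "n > 0" for n t
  proof -
    have "\<gamma> t = group_mult (n * N t) (c (t / real (n * N t)))"
      unfolding \<gamma>_def using sub[of t "N t" n] N[of t "N t"] that by (simp add: N_def)
    also have "\<dots> = group_mult n (c (t / real n))"
      using sub[of t n "N t"] that by (simp add: N_def mult.commute)
    finally show ?thesis .
  qed
  show ?thesis
  proof (rule that[of \<gamma>])
    show "\<gamma> t = c t" if "\<bar>t\<bar> < T" for t using g[of t 1] that by simp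
    fix s t
    define n where "n = N s + N t + N (s + t)"
    have n: "n > 0" by (simp add: n_def N_def)
    have b: "\<bar>s\<bar> < real n * T" "\<bar>t\<bar> < real n * T" "\<bar>s + t\<bar> < real n * T"
      by (rule N, simp add: n_def)+
    then have b': "\<bar>s / real n\<bar> < T" "\<bar>t / real n\<bar> < T" "\<bar>s / real n + t / real n\<bar> < T"
      using n by (auto simp: abs_div field_simps add_divide_distrib[symmetric])
    have c1: "c (s / real n + t / real n) = c (s / real n) + c (t / real n)" by (rule hom) (rule b')+
    have c2: "c (t / real n + s / real n) = c (t / real n) + c (s / real n)"
      by (rule hom) (use b' in \<open>auto simp: add.commute\<close>)
    have "\<gamma> (s + t) = group_mult n (c (s / real n) + c (t / real n))"
      using g[OF b(3) n] c1 by (simp add: add_divide_distrib)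
    also have "\<dots> = group_mult n (c (s / real n)) + group_mult n (c (t / real n))"
      by (rule group_mult_distrib) (use c1 c2 in \<open>simp add: add.commute\<close>)
    also have "\<dots> = \<gamma> s + \<gamma> t" using g[OF b(1) n] g[OF b(2) n] by simp
    finally show "\<gamma> (s + t) = \<gamma> s + \<gamma> t" .
  qed
qed

lemma C1_lipschitz_on_ball:
  fixes F :: "'a::euclidean_space \<Rightarrow> 'b::real_normed_vector"
  assumes "open V" "cball x0 R \<subseteq> V" "Ck_on (Suc 0) F V"
  obtains K where "K > 0" "\<And>x y. x \<in> cball x0 R \<Longrightarrow> y \<in> cball x0 R \<Longrightarrow> dist (F x) (F y) \<le> K * dist x y"
proof -
  let ?D = "\<lambda>x. frechet_derivative F (at x)"
  have "\<exists>B. \<forall>x\<in>cball x0 R. norm (?D x i) \<le> B" for i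
  proof -
    have "continuous_on (cball x0 R) (\<lambda>x. ?D x i)"
      using assms(3) continuous_on_subset[OF _ assms(2)] by auto
    then have "bounded ((\<lambda>x. ?D x i) ` cball x0 R)"
      by (intro compact_imp_bounded compact_continuous_image) auto
    then show ?thesis by (auto simp: bounded_iff)
  qed
  then obtain B where B: "\<And>i x. x \<in> cball x0 R \<Longrightarrow> norm (?D x i) \<le> B i" by metis
  define K where "K = (\<Sum>i\<in>Basis. \<bar>B i\<bar>) + 1"
  have K: "K > 0" unfolding K_def by (intro add_nonneg_pos sum_nonneg) auto
  have D: "(F has_derivative ?D x) (at x)" if "x \<in> cball x0 R" for x
    using Ck_on_SucD[OF assms(3)] that assms(2) by blast
  have on: "onorm (?D x) \<le> K" if x: "x \<in> cball x0 R" for x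
  proof (rule onorm_le)
    fix v
    have l: "linear (?D x)" using has_derivative_linear[OF D[OF x]] .
    have "?D x v = (\<Sum>i\<in>Basis. (v \<bullet> i) *\<^sub>R ?D x i)"
      using linear_sum[OF l, of "\<lambda>b. (v \<bullet> b) *\<^sub>R b" Basis]
      by (simp only: euclidean_representation linear_cmul[OF l])
    also have "norm \<dots> \<le> (\<Sum>i\<in>Basis. norm ((v \<bullet> i) *\<^sub>R ?D x i))" by (rule norm_sum)
    also have "\<dots> \<le> (\<Sum>i\<in>Basis. norm v * \<bar>B i\<bar>)"
      using B[OF x] by (intro sum_mono) (auto intro!: mult_mono Basis_le_norm intro: order_trans[OF _ abs_ge_self])
    also have "\<dots> \<le> K * norm v" by (simp add: K_def sum_distrib_left[symmetric] algebra_simps)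
    finally show "norm (?D x v) \<le> K * norm v" .
  qed
  show ?thesis
  proof (rule that[OF K])
    fix x y assume "x \<in> cball x0 R" "y \<in> cball x0 R"
    then show "dist (F x) (F y) \<le> K * dist x y"
      using differentiable_bound[OF convex_cball, of x0 R F ?D K] D on
      by (auto simp: dist_norm intro: has_derivative_at_withinI)
  qed
qed

context lie_group_algebra
begin

text \<open>Solve the differential equation of the field in a chart at the identity. By left
  invariance g(s + x) and g(s) + g(x) both solve it as curves in \<open>x\<close>, so uniqueness
  makes the solution a local homomorphism, which then extends to the line.\<close>

lemma one_parameter_subgroup_exists: "\<exists>\<gamma>. one_parameter_subgroup A L v \<gamma>"
proof -
  obtain U \<phi> where U: "(U, \<phi>) \<in> A" "0 \<in> U" by (rule chart_exists)
  note ch = chart_props[OF U(1)]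
  let ?i = "inv_into U \<phi>"
  obtain u N where u: "\<And>i. u i \<in> S" "open N" "0 \<in> N" "N \<subseteq> U" "\<And>i x. x \<in> N \<Longrightarrow> u i x = \<phi> x \<bullet> i"
    and rep: "\<And>v f p. f \<in> S \<Longrightarrow> p \<in> N \<Longrightarrow>
      L v f p = (\<Sum>i\<in>Basis. L v (u i) p * frechet_derivative (\<lambda>x. f (inv_into U \<phi> x)) (at (\<phi> p)) i)"
    by (rule chart_coordinates[OF U]) (rule that)
  define F where "F y = (\<Sum>i\<in>Basis. L v (u i) (?i y) *\<^sub>R i)" for y
  have F: "Ck_on k F (\<phi> ` U)" for k
    unfolding F_def by (intro Ck_on_sum Ck_on_scaleR ch(2) smooth_functions_Ck[OF L_smooth[OF u(1)] U(1)] Ck_on_const)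
  have oN: "open (\<phi> ` (U \<inter> N))" by (rule chart_image_open[OF U(1) u(2)])
  moreover have "\<phi> 0 \<in> \<phi> ` (U \<inter> N)" using U u(3) by auto
  ultimately obtain R where R: "R > 0" "cball (\<phi> 0) R \<subseteq> \<phi> ` (U \<inter> N)" using open_contains_cball by metis
  have RU: "cball (\<phi> 0) R \<subseteq> \<phi> ` U" using R by auto
  obtain K where K: "K > 0" "\<And>x y. x \<in> cball (\<phi> 0) R \<Longrightarrow> y \<in> cball (\<phi> 0) R \<Longrightarrow> dist (F x) (F y) \<le> K * dist x y"
    using C1_lipschitz_on_ball[OF ch(2) RU F[of "Suc 0"]] by metis
  \<comment> \<open>Composition with the projection onto a ball makes the coefficient field globally
    Lipschitz without changing it on the ball, where the solution stays for short times.\<close>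
  define cp where "cp = closest_point (cball (\<phi> 0) R)"
  define G where "G y = F (cp y)" for y
  have cp: "cp y \<in> cball (\<phi> 0) R" "y \<in> cball (\<phi> 0) R \<Longrightarrow> cp y = y" "dist (cp y) (cp z) \<le> dist y z" for y z
    unfolding cp_def using R(1) 
    by (auto intro!: closest_point_in_set closest_point_self closest_point_lipschitz simp del: mem_cball dest: less_imp_le)
  have G: "dist (G x) (G y) \<le> K * dist x y" for x y
    unfolding G_def using K(2)[OF cp(1) cp(1), of x y] mult_left_mono[OF cp(3)[of x y], of K] K(1) by linarith
  obtain T0 c where c: "T0 > 0" "c 0 = \<phi> 0" "\<And>t. \<bar>t\<bar> < T0 \<Longrightarrow> (c has_vector_derivative G (c t)) (at t)"
    using picard_lindelof[OF K(1) G] by metis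
  define B where "B = {p \<in> U. \<phi> p \<in> ball (\<phi> 0) R}"
  have B: "open B" "0 \<in> B" unfolding B_def by (rule chart_preimage_open[OF U(1) open_ball]) (use U R in auto)
  have BN: "p \<in> N" if "p \<in> B" for p
  proof -
    have "\<phi> p \<in> \<phi> ` (U \<inter> N)" using that R(2) by (auto simp: B_def)
    then show ?thesis using that ch(5) by (auto simp: B_def inj_on_def)
  qed
  have iB: "?i y \<in> B" "\<phi> (?i y) = y" if "y \<in> ball (\<phi> 0) R" for y
  proof -
    have "y \<in> \<phi> ` U" using that RU by auto
    then show "\<phi> (?i y) = y" by (rule f_inv_into_f)
    then show "?i y \<in> B" using that \<open>y \<in> \<phi> ` U\<close> by (auto simp: B_def inv_into_into)
  qed
  have "isCont c 0" using c(3)[of 0] c(1) has_vector_derivative_continuous by fastforce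
  then have "\<forall>\<^sub>F t in nhds 0. c t \<in> ball (\<phi> 0) R"
    using c(2) R(1) by (intro isCont_eventually_nhds) auto
  then obtain T1 where T1: "T1 > 0" "\<And>t. \<bar>t\<bar> < T1 \<Longrightarrow> c t \<in> ball (\<phi> 0) R"
    unfolding eventually_nhds_metric by (auto simp: dist_real_def)
  define T2 where "T2 = min T0 T1"
  have T2: "T2 > 0" using c T1 by (simp add: T2_def)
  have cB: "c t \<in> ball (\<phi> 0) R" if "\<bar>t\<bar> < T2" for t using T1 that by (simp add: T2_def)
  have cG: "(c has_vector_derivative G (c t)) (at t)" if "\<bar>t\<bar> < T2" for t using c(3) that by (simp add: T2_def)
  define g where "g t = ?i (c t)" for t
  have g0: "g 0 = 0" using ch(6) U c(2) by (simp add: g_def)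
  have gB: "g t \<in> B" "\<phi> (g t) = c t" if "\<bar>t\<bar> < T2" for t unfolding g_def using iB[OF cB[OF that]] by auto
  have gd: "((\<lambda>t. f (g t)) has_real_derivative L v f (g t)) (at t)" if f: "f \<in> S" and t: "\<bar>t\<bar> < T2" for f t
  proof -
    let ?f = "\<lambda>x. f (?i x)"
    have ct: "c t \<in> \<phi> ` U" using cB[OF t] RU by auto
    have D: "(?f has_derivative frechet_derivative ?f (at (c t))) (at (c t))"
      using Ck_on_SucD[OF smooth_functions_Ck[OF f U(1), of "Suc 0"] ct] .
    have l: "linear (frechet_derivative ?f (at (c t)))" using has_derivative_linear[OF D] .
    have Gt: "G (c t) = F (c t)" unfolding G_def using cp(2)[of "c t"] cB[OF t] by auto
    have "((\<lambda>t. ?f (c t)) has_derivative (\<lambda>h. frechet_derivative ?f (at (c t)) (h *\<^sub>R G (c t)))) (at t)"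
      by (rule has_derivative_compose[OF cG[OF t, unfolded has_vector_derivative_def] D])
    then have "((\<lambda>t. f (g t)) has_real_derivative frechet_derivative ?f (at (c t)) (G (c t))) (at t)"
      unfolding has_field_derivative_def g_def linear_cmul[OF l] by (simp add: mult_commute_abs)
    also have "frechet_derivative ?f (at (c t)) (G (c t)) = (\<Sum>i\<in>Basis. L v (u i) (g t) * frechet_derivative ?f (at (c t)) i)"
      unfolding Gt F_def g_def by (simp add: linear_sum[OF l] linear_cmul[OF l])
    also have "\<dots> = L v f (g t)"
      using rep[OF f BN[OF gB(1)[OF t]], of v] gB(2)[OF t] by simp
    finally show ?thesis .
  qed
  have "isCont g 0"
  proof -
    have "isCont ?i (\<phi> 0)" using ch(4) ch(2) U(2) by (simp add: continuous_on_eq_continuous_at)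
    then show ?thesis unfolding g_def using \<open>isCont c 0\<close> c(2) by (intro isCont_o2[of 0 c ?i]) auto
  qed
  then have "isCont (\<lambda>z. g (fst z) + g (snd z)) (0, 0)"
    by (intro continuous_add isCont_o2[of _ fst g] isCont_o2[of _ snd g]) (auto intro!: continuous_intros)
  then have "\<forall>\<^sub>F z in nhds (0, 0). g (fst z) + g (snd z) \<in> B"
    using B g0 by (intro isCont_eventually_nhds) auto
  then obtain r where r: "r > 0" "\<And>s t. dist (s, t) (0::real, 0::real) < r \<Longrightarrow> g s + g t \<in> B"
    unfolding eventually_nhds_metric by auto
  define T where "T = min T2 (r / 2)"
  have T: "T > 0" using T2 r by (simp add: T_def)
  have sB: "g s + g t \<in> B" if "\<bar>s\<bar> < T" "\<bar>t\<bar> < T" for s t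
  proof (rule r(2))
    have "dist (s, t) (0::real, 0::real) \<le> \<bar>s\<bar> + \<bar>t\<bar>"
      using norm_Pair_le[of s t] by (simp add: dist_norm)
    then show "dist (s, t) (0::real, 0::real) < r" using that by (simp add: T_def)
  qed
  have hom: "g (s + t) = g s + g t" if s: "\<bar>s\<bar> < T" and t: "\<bar>t\<bar> < T" and st: "\<bar>s + t\<bar> < T" for s t
  proof -
    have seg: "\<bar>x\<bar> < T" "\<bar>s + x\<bar> < T" if "x \<in> closed_segment 0 t" for x
      using that s t st by (auto simp: closed_segment_eq_real_ivl split: if_splits)
    \<comment> \<open>The chart image of \<open>g s + g x\<close>, written with the global functions
      \<open>u i\<close> so that \<open>gd\<close> and \<open>L_left\<close> can differentiate
      it.\<close>
    define e where "e x = (\<Sum>i\<in>Basis. u i (g s + g x) *\<^sub>R i)" for x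
    have e: "e x = \<phi> (g s + g x)" if "x \<in> closed_segment 0 t" for x
      using u(5)[OF BN[OF sB[OF s seg(1)[OF that]]]] by (simp add: e_def euclidean_representation)
    have "c (s + t) = e t"
    proof (rule ode_unique[of G K "\<lambda>x. c (s + x)" e, OF G])
      show "c (s + 0) = e 0" using e[of 0] g0 gB(2)[of s] s by (simp add: T_def)
      fix x assume x: "x \<in> closed_segment 0 t"
      have "(c has_vector_derivative G (c (s + x))) (at (s + x))" using cG seg(2)[OF x] by (simp add: T_def)
      moreover have "((\<lambda>x. s + x) has_vector_derivative 1) (at x)" by (auto intro!: derivative_eq_intros)
      ultimately show "((\<lambda>x. c (s + x)) has_vector_derivative G (c (s + x))) (at x)"
        using vector_diff_chain_at by (fastforce simp: o_def)
      have "((\<lambda>x. u i (g s + g x)) has_real_derivative L v (u i) (g s + g x)) (at x)" for i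
        using gd[OF smooth_functions_left_translate[OF u(1)[of i], of "g s"], of x] seg(1)[OF x] L_left[OF u(1)]
        by (simp add: T_def)
      then have "(e has_vector_derivative (\<Sum>i\<in>Basis. L v (u i) (g s + g x) *\<^sub>R i)) (at x)"
        unfolding e_def
        by (intro has_vector_derivative_sum) (auto intro!: derivative_eq_intros)
      moreover have "(\<Sum>i\<in>Basis. L v (u i) (g s + g x) *\<^sub>R i) = G (e x)"
      proof -
        have b: "g s + g x \<in> B" using sB[OF s seg(1)[OF x]] .
        then have "e x \<in> cball (\<phi> 0) R" using e[OF x] by (auto simp: B_def)
        then have "G (e x) = F (e x)" unfolding G_def by (simp add: cp(2))
        then show ?thesis using e[OF x] ch(6)[of "g s + g x"] b by (simp add: F_def B_def)
      qed
      ultimately show "(e has_vector_derivative G (e x)) (at x)" by simp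
    qed
    then have "c (s + t) = \<phi> (g s + g t)" using e[of t] by simp
    then show ?thesis using ch(6)[of "g s + g t"] sB[OF s t] by (simp add: g_def B_def)
  qed
  obtain \<gamma> where \<gamma>: "\<And>s t. \<gamma> (s + t) = \<gamma> s + \<gamma> t" "\<And>t. \<bar>t\<bar> < T \<Longrightarrow> \<gamma> t = g t"
    using local_hom_extends[OF T, of g] hom by metis
  have "((\<lambda>t. f (\<gamma> t)) has_real_derivative L v f 0) (at 0)" if "f \<in> S" for f
    using gd[OF that, of 0] T2 g0
    by (auto intro!: has_field_derivative_transform_within_open[where S="{-T<..<T}" and f="\<lambda>t. f (g t)"] simp: \<gamma>(2) abs_less_iff T)
  then have "one_parameter_subgroup A L v \<gamma>"
    using \<gamma>(1) by (auto simp: one_parameter_subgroup_def o_def)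
  then show ?thesis by blast
qed

end

section \<open>Logarithmic derivatives of curves\<close>

lemma MVT_symmetric:
  fixes f :: "real \<Rightarrow> real"
  assumes "\<And>x. (f has_real_derivative f' x) (at x)"
  obtains z where "\<bar>z - a\<bar> \<le> \<bar>b - a\<bar>" "f b - f a = (b - a) * f' z"
proof -
  consider "a < b" | "b < a" | "a = b" by linarith
  then show ?thesis
  proof cases
    case 1
    then obtain z where "z > a" "z < b" "f b - f a = (b - a) * f' z" using MVT2[of a b f f'] assms by blast
    then show ?thesis using that[of z] by auto
  next
    case 2
    then obtain z where "z > b" "z < a" "f a - f b = (a - b) * f' z" using MVT2[of b a f f'] assms by blast
    then show ?thesis using that[of z] by (auto simp: algebra_simps)
  next
    case 3
    then show ?thesis using that[of a] by auto
  qed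
qed

lemma isCont_real_pairD:
  fixes F :: "real \<Rightarrow> real \<Rightarrow> real"
  assumes "isCont (\<lambda>(s, t). F s t) (a, b)" "e > 0"
  obtains d where "d > 0" "\<And>s t. \<bar>s - a\<bar> < d \<Longrightarrow> \<bar>t - b\<bar> < d \<Longrightarrow> \<bar>F s t - F a b\<bar> < e"
proof -
  obtain d where d: "d > 0" "\<And>z. dist z (a, b) < d \<Longrightarrow> dist (case z of (s, t) \<Rightarrow> F s t) (F a b) < e"
    using assms unfolding continuous_at_eps_delta by (auto simp: dist_commute)
  show ?thesis
  proof (rule that[of "d / 2"])
    fix s t assume st: "\<bar>s - a\<bar> < d / 2" "\<bar>t - b\<bar> < d / 2"
    have "dist (s, t) (a, b) \<le> \<bar>s - a\<bar> + \<bar>t - b\<bar>"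
      using norm_Pair_le[of "s - a" "t - b"] by (simp add: dist_norm)
    then show "\<bar>F s t - F a b\<bar> < e" using d(2)[of "(s, t)"] st by (simp add: dist_real_def)
  qed (use d in auto)
qed

lemma DERIV_I_eps:
  fixes f :: "real \<Rightarrow> real"
  assumes "\<And>e. e > 0 \<Longrightarrow> \<exists>d>0. \<forall>s. \<bar>s - t\<bar> < d \<longrightarrow> \<bar>f s - f t - (s - t) * D\<bar> \<le> e * \<bar>s - t\<bar>"
  shows "(f has_real_derivative D) (at t)"
  unfolding has_field_derivative_def has_derivative_at_alt
  using assms by (auto simp: bounded_linear_mult_right mult.commute)

lemma DERIV_diagonal:
  fixes F :: "real \<Rightarrow> real \<Rightarrow> real"
  assumes F: "\<And>s \<tau>. (F s has_real_derivative F' s \<tau>) (at \<tau>)" and c: "isCont (\<lambda>(s, \<tau>). F' s \<tau>) (t, t)"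
  shows "((\<lambda>s. F s s - F s t) has_real_derivative F' t t) (at t)"
proof (rule DERIV_I_eps)
  fix e :: real assume e: "e > 0"
  obtain d where d: "d > 0" "\<And>s \<tau>. \<bar>s - t\<bar> < d \<Longrightarrow> \<bar>\<tau> - t\<bar> < d \<Longrightarrow> \<bar>F' s \<tau> - F' t t\<bar> < e"
    using isCont_real_pairD[OF c e] by metis
  have "\<bar>F s s - F s t - (F t t - F t t) - (s - t) * F' t t\<bar> \<le> e * \<bar>s - t\<bar>" if s: "\<bar>s - t\<bar> < d" for s
  proof -
    obtain z where z: "\<bar>z - t\<bar> \<le> \<bar>s - t\<bar>" "F s s - F s t = (s - t) * F' s z" by (rule MVT_symmetric[OF F])
    have "\<bar>F s s - F s t - (F t t - F t t) - (s - t) * F' t t\<bar> = \<bar>F' s z - F' t t\<bar> * \<bar>s - t\<bar>"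
      unfolding z(2) by (simp add: abs_mult[symmetric] algebra_simps)
    also have "\<dots> \<le> e * \<bar>s - t\<bar>" using d(2)[OF s, of z] z(1) s by (intro mult_right_mono) auto
    finally show ?thesis .
  qed
  then show "\<exists>d>0. \<forall>s. \<bar>s - t\<bar> < d \<longrightarrow> \<bar>F s s - F s t - (F t t - F t t) - (s - t) * F' t t\<bar> \<le> e * \<bar>s - t\<bar>"
    using d(1) by blast
qed

text \<open>Schwarz's theorem with one mixed derivative given and the other obtained: two mean value
  steps turn the second difference into a value of \<open>\<Phi>sb\<close> at a nearby
  point.\<close>

lemma mixed_partials_swap:
  fixes \<Phi> :: "real \<Rightarrow> real \<Rightarrow> real"
  assumes a: "\<And>s b. (\<Phi> s has_real_derivative \<Phi>b s b) (at b)"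
    and b: "\<And>s b. ((\<lambda>s. \<Phi>b s b) has_real_derivative \<Phi>sb s b) (at s)"
    and c: "\<And>b. ((\<lambda>s. \<Phi> s b) has_real_derivative \<Phi>s b) (at 0)"
    and cont: "isCont (\<lambda>(s, b). \<Phi>sb s b) (0, b0)"
  shows "(\<Phi>s has_real_derivative \<Phi>sb 0 b0) (at b0)"
proof (rule DERIV_I_eps)
  fix e :: real assume e: "e > 0"
  obtain d where d: "d > 0" "\<And>s b. \<bar>s - 0\<bar> < d \<Longrightarrow> \<bar>b - b0\<bar> < d \<Longrightarrow> \<bar>\<Phi>sb s b - \<Phi>sb 0 b0\<bar> < e"
    using isCont_real_pairD[OF cont e] by metis
  have "\<bar>\<Phi>s b - \<Phi>s b0 - (b - b0) * \<Phi>sb 0 b0\<bar> \<le> e * \<bar>b - b0\<bar>" if bd: "\<bar>b - b0\<bar> < d" for b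
  proof -
    have q: "((\<lambda>s. (\<Phi> s b - \<Phi> 0 b) / s) \<longlongrightarrow> \<Phi>s b) (at 0)" for b
      using c[of b] by (simp add: has_field_derivative_iff)
    have lim: "((\<lambda>s. \<bar>(\<Phi> s b - \<Phi> 0 b) / s - (\<Phi> s b0 - \<Phi> 0 b0) / s - (b - b0) * \<Phi>sb 0 b0\<bar>) \<longlongrightarrow>
      \<bar>\<Phi>s b - \<Phi>s b0 - (b - b0) * \<Phi>sb 0 b0\<bar>) (at 0)"
      by (intro tendsto_rabs tendsto_diff q tendsto_const)
    have "\<bar>(\<Phi> s b - \<Phi> 0 b) / s - (\<Phi> s b0 - \<Phi> 0 b0) / s - (b - b0) * \<Phi>sb 0 b0\<bar> \<le> e * \<bar>b - b0\<bar>"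
      if s: "s \<noteq> 0" "\<bar>s\<bar> < d" for s
    proof -
      obtain b' where b': "\<bar>b' - b0\<bar> \<le> \<bar>b - b0\<bar>"
        "(\<Phi> s b - \<Phi> 0 b) - (\<Phi> s b0 - \<Phi> 0 b0) = (b - b0) * (\<Phi>b s b' - \<Phi>b 0 b')"
        by (rule MVT_symmetric[OF DERIV_diff[OF a a], of _ _ s 0])
      obtain s' where s': "\<bar>s' - 0\<bar> \<le> \<bar>s - 0\<bar>" "\<Phi>b s b' - \<Phi>b 0 b' = (s - 0) * \<Phi>sb s' b'"
        by (rule MVT_symmetric[OF b])
      have "(\<Phi> s b - \<Phi> 0 b) / s - (\<Phi> s b0 - \<Phi> 0 b0) / s = (b - b0) * \<Phi>sb s' b'"
        using s(1) by (simp add: diff_divide_distrib[symmetric] b'(2) s'(2))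
      then have "\<bar>(\<Phi> s b - \<Phi> 0 b) / s - (\<Phi> s b0 - \<Phi> 0 b0) / s - (b - b0) * \<Phi>sb 0 b0\<bar>
        = \<bar>\<Phi>sb s' b' - \<Phi>sb 0 b0\<bar> * \<bar>b - b0\<bar>"
        by (simp add: abs_mult[symmetric] algebra_simps)
      also have "\<dots> \<le> e * \<bar>b - b0\<bar>"
        using d(2)[of s' b'] b'(1) s'(1) s bd by (intro mult_right_mono) auto
      finally show ?thesis .
    qed
    then have "\<forall>\<^sub>F s in at 0. \<bar>(\<Phi> s b - \<Phi> 0 b) / s - (\<Phi> s b0 - \<Phi> 0 b0) / s - (b - b0) * \<Phi>sb 0 b0\<bar> \<le> e * \<bar>b - b0\<bar>"
      unfolding eventually_at using d(1) by (intro exI[of _ d]) (auto simp: dist_real_def)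
    from tendsto_upperbound[OF lim this] show ?thesis by simp
  qed
  then show "\<exists>d>0. \<forall>s. \<bar>s - b0\<bar> < d \<longrightarrow> \<bar>\<Phi>s s - \<Phi>s b0 - (s - b0) * \<Phi>sb 0 b0\<bar> \<le> e * \<bar>s - b0\<bar>"
    using d(1) by blast
qed

context lie_group_algebra
begin

text \<open>The left logarithmic derivative of the curve: its velocity, moved to the identity by
  left translation. Testing it on smooth functions keeps charts out.\<close>

definition log_deriv :: "(real \<Rightarrow> 'g) \<Rightarrow> 'v \<Rightarrow> real \<Rightarrow> bool" where
  "log_deriv c \<xi> t \<longleftrightarrow> (\<forall>f\<in>S. ((\<lambda>s. f (c s)) has_real_derivative L \<xi> f (c t)) (at t))"

lemma log_derivD: "log_deriv c \<xi> t \<Longrightarrow> f \<in> S \<Longrightarrow> ((\<lambda>s. f (c s)) has_real_derivative L \<xi> f (c t)) (at t)"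
  by (auto simp: log_deriv_def)

text \<open>Bump functions detect the topology: where a bump supported in \<open>W\<close> is
  nonzero along the curve, the curve is in \<open>W\<close>.\<close>

lemma log_deriv_isCont:
  assumes "log_deriv c \<xi> t" shows "isCont c t"
  unfolding isCont_def tendsto_def
proof (intro allI impI)
  fix W assume W: "open W" "c t \<in> W"
  obtain b N K where b: "b \<in> S" "c t \<in> N" "\<And>x. x \<in> N \<Longrightarrow> b x = 1" "K \<subseteq> W" "\<And>x. x \<notin> K \<Longrightarrow> b x = 0"
    using bump_exists[OF W] by metis
  have "isCont (\<lambda>s. b (c s)) t" using log_derivD[OF assms b(1)] DERIV_isCont by blast
  then have "\<forall>\<^sub>F s in at t. b (c s) > 1/2"
    unfolding isCont_def using b(2,3) by (intro order_tendstoD(1)) auto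
  then show "\<forall>\<^sub>F s in at t. c s \<in> W"
    by (rule eventually_mono) (use b(4,5) in force)
qed

lemma smooth_functions_separate:
  assumes "\<And>f. f \<in> S \<Longrightarrow> f x = f y" shows "x = y"
proof (rule ccontr)
  assume "x \<noteq> y"
  then obtain b N K where b: "b \<in> S" "x \<in> N" "\<And>x. x \<in> N \<Longrightarrow> b x = 1" "K \<subseteq> - {y}" "\<And>x. x \<notin> K \<Longrightarrow> b x = 0"
    using bump_exists[of "- {y}" x] by (metis ComplI open_Compl closed_singleton singletonD)
  then have "b x = 1" "b y = 0" by auto
  then show False using assms[OF b(1)] by simp
qed

lemma log_deriv_zero_const:
  assumes "\<And>t. log_deriv c 0 t" shows "c s = c t"
proof (rule smooth_functions_separate)
  fix f assume "f \<in> S"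
  then have "((\<lambda>s. f (c s)) has_real_derivative 0) (at t)" for t
    using log_derivD[OF assms[of t], of f] by simp
  then show "f (c s) = f (c t)" using DERIV_isconst_all by blast
qed

section \<open>The adjoint action\<close>

definition Ad :: "'g \<Rightarrow> 'v \<Rightarrow> 'v" where
  "Ad h v = (SOME w. \<forall>f\<in>S. \<forall>g. L w f g = L v (\<lambda>x. f (x + - h)) (g + h))"

text \<open>Right translations commute with left ones, so a right translation carries left-invariant
  fields to left-invariant fields; as \<open>L\<close> is onto, the choice in \<open>Ad\<close> is
  possible.\<close>

lemma L_Ad:
  assumes "f \<in> S"
  shows "L (Ad h v) f g = L v (\<lambda>x. f (x + - h)) (g + h)"
proof -
  define X where "X f = (if f \<in> S then (\<lambda>g. L v (\<lambda>x. f (x + - h)) (g + h)) else (\<lambda>_. 0))" for f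
  note r = smooth_functions_right_translate
  have "left_invariant_field A X"
    unfolding left_invariant_field_def
  proof (intro conjI ballI allI impI)
    fix f assume f: "f \<in> S"
    show "X f \<in> S" using r[OF L_smooth[OF r[OF f]]] f by (simp add: X_def del: add_uminus_conv_diff)
    show "X (\<lambda>g. f (p + g)) = (\<lambda>g. X f (p + g))" for p
      using f smooth_functions_left_translate[OF f, of p] L_left[OF r[OF f, of "- h"], of v p]
      by (simp add: X_def fun_eq_iff add.assoc del: add_uminus_conv_diff)
    fix k assume k: "k \<in> S"
    show "X (\<lambda>g. a * f g + b * k g) = (\<lambda>g. a * X f g + b * X k g)" for a b
      using f k L_fun_lin[OF r[OF f, of "- h"] r[OF k, of "- h"], of v a b]
      by (simp add: X_def smooth_functions_add smooth_functions_cmult)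
    show "X (\<lambda>g. f g * k g) = (\<lambda>g. f g * X k g + X f g * k g)"
      using f k L_fun_mult[OF r[OF f, of "- h"] r[OF k, of "- h"], of v]
      by (simp add: X_def smooth_functions_mult add.assoc)
  qed (simp add: X_def)
  then obtain w where "L w = X" by (rule L_surj)
  then have "\<forall>f\<in>S. \<forall>g. L w f g = L v (\<lambda>x. f (x + - h)) (g + h)" by (simp add: X_def)
  then have "\<forall>f\<in>S. \<forall>g. L (Ad h v) f g = L v (\<lambda>x. f (x + - h)) (g + h)"
    unfolding Ad_def by (rule someI)
  then show ?thesis using assms by blast
qed

lemma linear_Ad: "linear (Ad h)"
proof
  show "Ad h (a + b) = Ad h a + Ad h b" for a b by (rule L_eqI) (simp add: L_Ad L_add)
  show "Ad h (r *\<^sub>R a) = r *\<^sub>R Ad h a" for r a by (rule L_eqI) (simp add: L_Ad L_scale)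
qed

lemma Ad_plus: "Ad (h + k) v = Ad h (Ad k v)"
  by (rule L_eqI) (simp add: L_Ad smooth_functions_right_translate minus_add add.assoc del: add_uminus_conv_diff)

lemma Ad_0: "Ad 0 v = v"
  by (rule L_eqI) (simp add: L_Ad)

lemma log_deriv_right:
  assumes "log_deriv c \<xi> t" shows "log_deriv (\<lambda>s. c s + q) (Ad (- q) \<xi>) t"
  unfolding log_deriv_def
proof
  fix f assume f: "f \<in> S"
  show "((\<lambda>s. f (c s + q)) has_real_derivative L (Ad (- q) \<xi>) f (c t + q)) (at t)"
    using log_derivD[OF assms smooth_functions_right_translate[OF f, of q]] L_Ad[OF f, of "- q" \<xi> "c t + q"]
    by (simp add: add.assoc)
qed

lemma one_parameter_subgroup_0: "one_parameter_subgroup A L v \<gamma> \<Longrightarrow> \<gamma> 0 = 0"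
  by (metis add.right_neutral add_left_imp_eq one_parameter_subgroup_def)

lemma one_parameter_subgroup_minus:
  assumes "one_parameter_subgroup A L v \<gamma>" shows "\<gamma> (- t) = - \<gamma> t"
proof -
  have "\<gamma> (t + - t) = \<gamma> t + \<gamma> (- t)" using assms unfolding one_parameter_subgroup_def by blast
  then show ?thesis using one_parameter_subgroup_0[OF assms] by (simp add: eq_neg_iff_add_eq_0 minus_unique)
qed

lemma one_parameter_subgroup_log_deriv:
  assumes "one_parameter_subgroup A L v \<gamma>" shows "log_deriv \<gamma> v t"
  unfolding log_deriv_def
proof
  fix f assume f: "f \<in> S"
  have "((\<lambda>s. f (\<gamma> t + \<gamma> s)) has_real_derivative L v (\<lambda>x. f (\<gamma> t + x)) 0) (at 0)"
    using assms smooth_functions_left_translate[OF f, of "\<gamma> t"] by (auto simp: one_parameter_subgroup_def o_def)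
  then have "((\<lambda>s. f (\<gamma> (s + t))) has_real_derivative L v f (\<gamma> t)) (at 0)"
    using assms by (simp add: L_left f one_parameter_subgroup_def add.commute[of _ t])
  then show "((\<lambda>s. f (\<gamma> s)) has_real_derivative L v f (\<gamma> t)) (at t)"
    using DERIV_shift[of "\<lambda>s. f (\<gamma> s)" _ 0 t] by simp
qed

text \<open>A product rule: moving only the right factor contributes \<open>w\<close>, moving only
  the left one contributes \<xi> conjugated past \<gamma>(t). \<open>DERIV_diagonal\<close> combines
  the two although differentiability of \<open>c\<close> is given only at \<open>t\<close>.\<close>

lemma log_deriv_add:
  assumes c: "log_deriv c \<xi> t" and g: "one_parameter_subgroup A L w \<gamma>"
  shows "log_deriv (\<lambda>s. c s + \<gamma> s) (Ad (\<gamma> (- t)) \<xi> + w) t"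
  unfolding log_deriv_def
proof
  fix f assume f: "f \<in> S"
  have gc: "isCont \<gamma> s" for s by (rule log_deriv_isCont[OF one_parameter_subgroup_log_deriv[OF g]])
  have cc: "isCont c t" by (rule log_deriv_isCont[OF c])
  have 1: "((\<lambda>s. f (c s + \<gamma> t)) has_real_derivative L (Ad (\<gamma> (- t)) \<xi>) f (c t + \<gamma> t)) (at t)"
    using log_derivD[OF log_deriv_right[OF c, of "\<gamma> t"] f] by (simp add: one_parameter_subgroup_minus[OF g])
  have "((\<lambda>s. f (c s + \<gamma> s) - f (c s + \<gamma> t)) has_real_derivative L w f (c t + \<gamma> t)) (at t)"
  proof (rule DERIV_diagonal[where F = "\<lambda>s \<tau>. f (c s + \<gamma> \<tau>)" and F' = "\<lambda>s \<tau>. L w f (c s + \<gamma> \<tau>)"])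
    show "((\<lambda>\<tau>. f (c s + \<gamma> \<tau>)) has_real_derivative L w f (c s + \<gamma> \<tau>)) (at \<tau>)" for s \<tau>
      using log_derivD[OF one_parameter_subgroup_log_deriv[OF g] smooth_functions_left_translate[OF f, of "c s"]]
      by (simp add: L_left f)
    have "isCont (L w f) x" for x
      using L_continuous[OF f, of w] by (simp add: continuous_on_eq_continuous_at)
    then have "isCont (\<lambda>z. L w f (c (fst z) + \<gamma> (snd z))) (t, t)"
      by (rule isCont_o2[rotated])
         (auto intro!: continuous_add isCont_o2[of _ fst c] isCont_o2[of _ snd \<gamma>] continuous_intros cc gc)
    then show "isCont (\<lambda>(s, \<tau>). L w f (c s + \<gamma> \<tau>)) (t, t)" by (simp add: case_prod_unfold)
  qed
  from DERIV_add[OF this 1]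
  show "((\<lambda>s. f (c s + \<gamma> s)) has_real_derivative L (Ad (\<gamma> (- t)) \<xi> + w) f (c t + \<gamma> t)) (at t)"
    by (simp add: L_add add.commute)
qed

lemma Ad_one_parameter_self:
  assumes "one_parameter_subgroup A L v \<gamma>" shows "Ad (\<gamma> t) v = v"
proof (rule L_eqI)
  fix f g assume f: "f \<in> S"
  have c: "\<gamma> t + \<gamma> s + - \<gamma> t = \<gamma> s" for s
  proof -
    have "\<gamma> t + \<gamma> s = \<gamma> s + \<gamma> t" using assms unfolding one_parameter_subgroup_def by (metis add.commute)
    then show ?thesis by (simp add: add.assoc)
  qed
  let ?f = "\<lambda>x. f (x + - \<gamma> t)"
  have fS: "?f \<in> S" by (rule smooth_functions_right_translate[OF f])
  have "((\<lambda>s. ?f ((g + \<gamma> t) + \<gamma> s)) has_real_derivative L v ?f (g + \<gamma> t + \<gamma> 0)) (at 0)"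
    using log_derivD[OF one_parameter_subgroup_log_deriv[OF assms] smooth_functions_left_translate[OF fS, of "g + \<gamma> t"], of 0]
    by (simp only: L_left[OF fS])
  then have 1: "((\<lambda>s. f (g + \<gamma> s)) has_real_derivative L v ?f (g + \<gamma> t)) (at 0)"
    by (simp add: add.assoc c[simplified add.assoc] one_parameter_subgroup_0[OF assms] del: add_uminus_conv_diff)
  have 2: "((\<lambda>s. f (g + \<gamma> s)) has_real_derivative L v f (g + \<gamma> 0)) (at 0)"
    using log_derivD[OF one_parameter_subgroup_log_deriv[OF assms] smooth_functions_left_translate[OF f, of g], of 0]
    by (simp only: L_left[OF f])
  show "L (Ad (\<gamma> t) v) f g = L v f g"
    using DERIV_unique[OF 1 2] by (simp add: L_Ad[OF f] one_parameter_subgroup_0[OF assms])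
qed

lemma one_parameter_subgroup_scale:
  assumes "one_parameter_subgroup A L v \<gamma>" shows "one_parameter_subgroup A L (a *\<^sub>R v) (\<lambda>t. \<gamma> (a * t))"
  unfolding one_parameter_subgroup_def
proof (intro conjI allI ballI)
  show "\<gamma> (a * (s + t)) = \<gamma> (a * s) + \<gamma> (a * t)" for s t
    using assms by (simp add: one_parameter_subgroup_def distrib_left)
  fix f assume f: "f \<in> S"
  have "((\<lambda>s. f (\<gamma> s)) has_real_derivative L v f (\<gamma> (a * 0))) (at (a * 0))"
    using log_derivD[OF one_parameter_subgroup_log_deriv[OF assms] f] .
  from DERIV_chain2[where f = "\<lambda>s. f (\<gamma> s)" and g = "\<lambda>t. a * t", OF this DERIV_cmult_Id]
  have "((\<lambda>t. f (\<gamma> (a * t))) has_real_derivative L v f 0 * a) (at 0)"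
    using one_parameter_subgroup_0[OF assms] by simp
  then show "((f \<circ> (\<lambda>t. \<gamma> (a * t))) has_real_derivative L (a *\<^sub>R v) f 0) (at 0)"
    by (simp add: o_def L_scale mult.commute)
qed

text \<open>The curve \<gamma>(t) - \<delta>(t) has logarithmic derivative
  \<open>Ad (\<delta> t) v - v\<close>, which is 0 because \<delta>(t) commutes with the subgroup
  generated by \<open>v\<close>. Hence it is constant.\<close>

lemma one_parameter_subgroup_unique:
  assumes 1: "one_parameter_subgroup A L v \<gamma>" and 2: "one_parameter_subgroup A L v \<delta>"
  shows "\<gamma> = \<delta>"
proof
  fix t
  have m: "one_parameter_subgroup A L (- v) (\<lambda>t. \<delta> (- t))"
    using one_parameter_subgroup_scale[OF 2, of "-1"] by simp
  have "log_deriv (\<lambda>s. \<gamma> s + \<delta> (- s)) 0 t" for t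
    using log_deriv_add[OF one_parameter_subgroup_log_deriv[OF 1, of t] m] Ad_one_parameter_self[OF 2, of t] by simp
  then have "\<gamma> t + \<delta> (- t) = \<gamma> 0 + \<delta> (- 0)" by (rule log_deriv_zero_const)
  then have "\<gamma> t + - \<delta> t = 0"
    using one_parameter_subgroup_0[OF 1] one_parameter_subgroup_0[OF 2] by (simp add: one_parameter_subgroup_minus[OF 2])
  then show "\<gamma> t = \<delta> t" by (simp add: eq_neg_iff_add_eq_0[symmetric])
qed

section \<open>First properties of the exponential map\<close>

abbreviation E :: "'v \<Rightarrow> 'g" where "E \<equiv> lie_exp A L"

lemma exp_one_parameter: "one_parameter_subgroup A L v (\<lambda>t. E (t *\<^sub>R v))"
proof -
  obtain \<gamma> where g: "one_parameter_subgroup A L v \<gamma>" using one_parameter_subgroup_exists by blast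
  have "E (t *\<^sub>R v) = \<gamma> t" for t
  proof -
    have "(THE \<delta>. one_parameter_subgroup A L (t *\<^sub>R v) \<delta>) = (\<lambda>s. \<gamma> (t * s))"
      using one_parameter_subgroup_scale[OF g, of t] one_parameter_subgroup_unique by blast
    then show ?thesis by (simp add: lie_exp_def)
  qed
  then show ?thesis using g by simp
qed

lemma E_0 [simp]: "E 0 = 0" using one_parameter_subgroup_0[OF exp_one_parameter[of 0]] by simp

lemma E_minus: "E (- v) = - E v"
  using one_parameter_subgroup_minus[OF exp_one_parameter[of v], of 1] by simp

lemma E_add_scaleR: "E ((s + t) *\<^sub>R v) = E (s *\<^sub>R v) + E (t *\<^sub>R v)"
  using exp_one_parameter[of v] by (auto simp: one_parameter_subgroup_def)

lemma log_deriv_E: "log_deriv (\<lambda>t. E (t *\<^sub>R v)) v t"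
  by (rule one_parameter_subgroup_log_deriv[OF exp_one_parameter])

lemma isCont_E_line: "isCont (\<lambda>t. E (t *\<^sub>R v)) t"
  by (rule log_deriv_isCont[OF log_deriv_E])

text \<open>The functionals \<xi> \<mapsto> \<open>L \<xi> f 0\<close> span the dual space: a vector
  on which all of them vanish gives a field that is 0 at the identity, hence everywhere by left
  invariance. So a derivative tested on all \<open>f\<close> is a derivative in the Lie
  algebra.\<close>

lemma has_vector_derivative_via_L:
  assumes "\<And>f. f \<in> S \<Longrightarrow> ((\<lambda>t. L (x t) f 0) has_real_derivative L y f 0) (at t0)"
  shows "(x has_vector_derivative y) (at t0)"
proof -
  define a where "a f = (\<Sum>b\<in>Basis. L b f 0 *\<^sub>R b)" for f
  have a: "v \<bullet> a f = L v f 0" for v f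
  proof -
    have "L v f 0 = L (\<Sum>b\<in>Basis. (v \<bullet> b) *\<^sub>R b) f 0" by (simp only: euclidean_representation)
    also have "\<dots> = v \<bullet> a f" by (simp add: a_def L_sum L_scale inner_sum_right mult.commute)
    finally show ?thesis by simp
  qed
  have "span (a ` S) = UNIV"
  proof (rule ccontr)
    assume "span (a ` S) \<noteq> UNIV"
    then have "dim (a ` S) < DIM('v)" using dim_eq_full[of "a ` S"] dim_subset_UNIV[of "a ` S"] by linarith
    then obtain v where v: "v \<noteq> 0" "\<And>y. y \<in> span (a ` S) \<Longrightarrow> orthogonal v y"
      using orthogonal_to_subspace_exists by metis
    have "L v f g = L 0 f g" if f: "f \<in> S" for f g
    proof -
      have fg: "(\<lambda>x. f (g + x)) \<in> S" by (rule smooth_functions_left_translate[OF f])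
      then have "orthogonal v (a (\<lambda>x. f (g + x)))" by (intro v(2) span_base) blast
      then have "L v (\<lambda>x. f (g + x)) 0 = 0" by (simp add: orthogonal_def a)
      then show ?thesis by (simp add: L_left[OF f])
    qed
    then have "v = 0" by (rule L_eqI)
    then show False using v by simp
  qed
  then have "((\<lambda>t. x t \<bullet> b) has_real_derivative y \<bullet> b) (at t0)" for b
  proof -
    have "b \<in> span (a ` S)" using \<open>span (a ` S) = UNIV\<close> by simp
    then show ?thesis
    proof (induction rule: span_induct)
      show "subspace {b. ((\<lambda>t. x t \<bullet> b) has_real_derivative y \<bullet> b) (at t0)}"
        by (auto simp: subspace_def inner_add_right intro!: derivative_eq_intros)
    qed (use assms a in auto)
  qed
  then have "((\<lambda>t. \<Sum>b\<in>Basis. (x t \<bullet> b) *\<^sub>R b) has_vector_derivative (\<Sum>b\<in>Basis. (y \<bullet> b) *\<^sub>R b)) (at t0)"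
    by (intro has_vector_derivative_sum) (auto intro!: derivative_eq_intros)
  then show ?thesis by (simp add: euclidean_representation)
qed

section \<open>The bracket and the derivative of the adjoint action\<close>

abbreviation br :: "'v \<Rightarrow> 'v \<Rightarrow> 'v" where "br \<equiv> lie_bracket L"

text \<open>The commutator of two left-invariant derivations is again one, so exactly one vector
  meets the description in \<open>lie_bracket\<close>.\<close>

lemma L_br: "L (br v w) f g = L v (L w f) g - L w (L v f) g"
proof -
  let ?X = "\<lambda>f g. L v (L w f) g - L w (L v f) g"
  have z: "L u (\<lambda>_. 0) = (\<lambda>_. 0)" for u using L_fun_const[of u 0] .
  have "left_invariant_field A ?X"
    unfolding left_invariant_field_def
  proof (intro conjI ballI allI impI)
    fix f assume f: "f \<in> S"
    show "?X f \<in> S" by (intro smooth_functions_diff L_smooth f)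
    show "?X (\<lambda>g. f (p + g)) = (\<lambda>g. ?X f (p + g))" for p by (simp add: L_left L_smooth f)
    fix k assume k: "k \<in> S"
    show "?X (\<lambda>g. a * f g + b * k g) = (\<lambda>g. a * ?X f g + b * ?X k g)" for a b
      by (simp add: L_fun_lin L_smooth f k algebra_simps)
    show "?X (\<lambda>g. f g * k g) = (\<lambda>g. f g * ?X k g + ?X f g * k g)"
      by (simp add: L_fun_mult L_fun_add L_smooth smooth_functions_mult f k algebra_simps)
  next
    fix f assume "f \<notin> S"
    then show "?X f = (\<lambda>_. 0)" by (simp add: L_nonsmooth z)
  qed
  then obtain z where z: "L z = ?X" by (rule L_surj)
  then have "(THE z. L z = ?X) = z" by (intro the_equality) (auto intro: L_inj)
  then have "L (br v w) = ?X" using z by (simp add: lie_bracket_def)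
  then show ?thesis by simp
qed

lemma br_add_left: "br (u + v) w = br u w + br v w"
  by (rule L_eqI) (simp add: L_br L_add L_fun_add L_smooth ext[of "L (u + v) _", OF L_add])

lemma br_skew: "br v w = - br w v"
  by (rule L_eqI) (simp add: L_br L_minus)

lemma br_self [simp]: "br v v = 0"
  by (rule L_eqI) (simp add: L_br)

lemma br_scale_left: "br (a *\<^sub>R v) w = a *\<^sub>R br v w"
proof (rule L_eqI)
  fix f g assume f: "f \<in> S"
  have "L w (L (a *\<^sub>R v) f) g = a * L w (L v f) g"
    using L_fun_lin[OF L_smooth[OF f, of v] smooth_functions_const[of 0], of w a 0]
    by (simp add: ext[of "L (a *\<^sub>R v) f", OF L_scale])
  then show "L (br (a *\<^sub>R v) w) f g = L (a *\<^sub>R br v w) f g"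
    by (simp add: L_br L_scale algebra_simps)
qed

lemma br_add_right: "br w (u + v) = br w u + br w v"
  using br_add_left[of u v w] by (simp add: br_skew[of w])

lemma br_scale_right: "br w (a *\<^sub>R v) = a *\<^sub>R br w v"
  using br_scale_left[of a v w] by (simp add: br_skew[of w])

lemma br_Jacobi: "br u (br v w) = br (br u v) w + br v (br u w)"
proof (rule L_eqI)
  fix f g assume f: "f \<in> S"
  have d: "L a (L (br b c) f) g = L a (L b (L c f)) g - L a (L c (L b f)) g" for a b c
    by (simp add: ext[of "L (br b c) f", OF L_br] L_fun_diff L_smooth f)
  show "L (br u (br v w)) f g = L (br (br u v) w + br v (br u w)) f g"
    by (simp add: L_add L_br d)
qed

lemma bilinear_br: "bilinear br"
  unfolding bilinear_def
  by (auto intro!: linearI simp: br_add_left br_add_right br_scale_left br_scale_right)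

text \<open>Tested on \<open>f\<close>, the curve is the diagonal of \<open>G a b\<close>, where
  \<open>a\<close> moves the base point and \<open>b\<close> the translate of \<open>f\<close>. The
  derivative in \<open>a\<close> is w v f. The derivative in \<open>b\<close> has to be taken inside
  the derivative along \<open>v\<close>, whence the exchange of mixed partials; it is - v w
  f.\<close>

lemma Ad_E_derivative_0:
  "((\<lambda>t. Ad (E (t *\<^sub>R w)) v) has_vector_derivative br w v) (at 0)"
proof (rule has_vector_derivative_via_L)
  fix f assume f: "f \<in> S"
  define G where "G a b = L v (\<lambda>x. f (x + E ((- b) *\<^sub>R w))) (E (a *\<^sub>R w))" for a b
  define \<Psi> where "\<Psi> a s b = - L v (\<lambda>x. L w f (x + E ((- b) *\<^sub>R w))) (E (a *\<^sub>R w) + E (s *\<^sub>R v))" for a s b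
  note r = smooth_functions_right_translate and l = smooth_functions_left_translate
  have Eb: "isCont (\<lambda>b. E ((- b) *\<^sub>R w)) b" for b using isCont_E_line[where v = "- w" and t = b] by simp
  have cont: "isCont (\<lambda>z. - L v (\<lambda>x. L w f (x + E ((- b z) *\<^sub>R w))) (p z)) z0"
    if "isCont p z0" "isCont b z0" for p :: "real \<times> real \<Rightarrow> 'g" and b :: "real \<times> real \<Rightarrow> real" and z0
  proof -
    have "isCont (\<lambda>(p, q). L v (\<lambda>x. L w f (x + q)) p) y" for y
      using L_right_translate_continuous[OF L_smooth[OF f, of w], of v] by (cases y) (simp add: continuous_on_eq_continuous_at)
    moreover have "isCont (\<lambda>z. (p z, E ((- b z) *\<^sub>R w))) z0"
      by (rule continuous_Pair[OF that(1) isCont_o2[OF that(2) Eb]])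
    ultimately have "isCont (\<lambda>z. (case (p z, E ((- b z) *\<^sub>R w)) of (p, q) \<Rightarrow> L v (\<lambda>x. L w f (x + q)) p)) z0"
      by (intro isCont_o2[where f = "\<lambda>z. (p z, E ((- b z) *\<^sub>R w))" and g = "\<lambda>(p, q). L v (\<lambda>x. L w f (x + q)) p"])
    then show ?thesis by (intro continuous_minus) simp
  qed
  have G: "(G a has_real_derivative \<Psi> a 0 b) (at b)" for a b
    unfolding G_def[abs_def]
  proof (rule mixed_partials_swap[where \<Phi> = "\<lambda>s b. f (E (a *\<^sub>R w) + E (s *\<^sub>R v) + E ((- b) *\<^sub>R w))"
        and \<Phi>b = "\<lambda>s b. - L w f (E (a *\<^sub>R w) + E (s *\<^sub>R v) + E ((- b) *\<^sub>R w))" and \<Phi>sb = "\<Psi> a"])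
    show "((\<lambda>b. f (E (a *\<^sub>R w) + E (s *\<^sub>R v) + E ((- b) *\<^sub>R w))) has_real_derivative
       - L w f (E (a *\<^sub>R w) + E (s *\<^sub>R v) + E ((- b) *\<^sub>R w))) (at b)" for s b
      using log_derivD[OF log_deriv_E[of "- w" b] l[OF f, of "E (a *\<^sub>R w) + E (s *\<^sub>R v)"]]
      by (simp add: L_left[OF f] L_minus)
    show "((\<lambda>s. - L w f (E (a *\<^sub>R w) + E (s *\<^sub>R v) + E ((- b) *\<^sub>R w))) has_real_derivative \<Psi> a s b) (at s)" for s b
      using log_derivD[OF log_deriv_E[of v s] l[OF r[OF L_smooth[OF f, of w], of "E ((- b) *\<^sub>R w)"], of "E (a *\<^sub>R w)"]]
      unfolding L_left[OF r[OF L_smooth[OF f, of w], of "E ((- b) *\<^sub>R w)"]] \<Psi>_def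
      by (rule DERIV_minus)
    show "((\<lambda>s. f (E (a *\<^sub>R w) + E (s *\<^sub>R v) + E ((- b) *\<^sub>R w))) has_real_derivative
       L v (\<lambda>x. f (x + E ((- b) *\<^sub>R w))) (E (a *\<^sub>R w))) (at 0)" for b
      using log_derivD[OF log_deriv_E[of v 0] l[OF r[OF f, of "E ((- b) *\<^sub>R w)"], of "E (a *\<^sub>R w)"]]
      unfolding L_left[OF r[OF f, of "E ((- b) *\<^sub>R w)"]] by simp
    have "isCont (\<lambda>z. - L v (\<lambda>x. L w f (x + E ((- snd z) *\<^sub>R w))) (E (a *\<^sub>R w) + E (fst z *\<^sub>R v))) (0, b)"
      by (rule cont) (auto intro!: continuous_add isCont_o2[of _ fst "\<lambda>t. E (t *\<^sub>R v)"] isCont_E_line continuous_intros)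
    then show "isCont (\<lambda>(s, b). \<Psi> a s b) (0, b)" by (simp add: \<Psi>_def case_prod_unfold)
  qed
  have "((\<lambda>s. G s s - G s 0) has_real_derivative \<Psi> 0 0 0) (at 0)"
  proof (rule DERIV_diagonal[where F = G and F' = "\<lambda>a b. \<Psi> a 0 b", OF G])
    have "isCont (\<lambda>z. - L v (\<lambda>x. L w f (x + E ((- snd z) *\<^sub>R w))) (E (fst z *\<^sub>R w))) (0, 0)"
      by (rule cont) (auto intro!: isCont_o2[of _ fst "\<lambda>t. E (t *\<^sub>R w)"] isCont_E_line continuous_intros)
    then show "isCont (\<lambda>(s, b). \<Psi> s 0 b) (0, 0)" by (simp add: \<Psi>_def case_prod_unfold)
  qed
  moreover have "((\<lambda>s. G s 0) has_real_derivative L w (L v f) 0) (at 0)"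
    unfolding G_def using log_derivD[OF log_deriv_E[of w 0] L_smooth[OF f, of v]] by simp
  ultimately have "((\<lambda>s. (G s s - G s 0) + G s 0) has_real_derivative \<Psi> 0 0 0 + L w (L v f) 0) (at 0)"
    by (rule DERIV_add)
  then have "((\<lambda>s. G s s) has_real_derivative L (br w v) f 0) (at 0)"
    by (simp add: L_br \<Psi>_def)
  then show "((\<lambda>t. L (Ad (E (t *\<^sub>R w)) v) f 0) has_real_derivative L (br w v) f 0) (at 0)"
    by (simp add: L_Ad[OF f] G_def E_minus)
qed

lemma Ad_E_derivative:
  "((\<lambda>t. Ad (E (t *\<^sub>R w)) v) has_vector_derivative Ad (E (t *\<^sub>R w)) (br w v)) (at t)"
proof -
  have "bounded_linear (Ad (E (t *\<^sub>R w)))" using linear_Ad by (simp add: linear_conv_bounded_linear)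
  from bounded_linear.has_vector_derivative[OF this Ad_E_derivative_0[of w v]]
  have "((\<lambda>s. Ad (E ((s + t) *\<^sub>R w)) v) has_vector_derivative Ad (E (t *\<^sub>R w)) (br w v)) (at (t - t))"
    by (simp add: E_add_scaleR add.commute[of _ t] Ad_plus del: scaleR_add_left)
  moreover have "((\<lambda>s. s - t) has_vector_derivative 1) (at t)" by (auto intro!: derivative_eq_intros)
  ultimately have "((\<lambda>s. Ad (E ((s + t) *\<^sub>R w)) v) \<circ> (\<lambda>s. s - t) has_vector_derivative 1 *\<^sub>R Ad (E (t *\<^sub>R w)) (br w v)) (at t)"
    by (rule vector_diff_chain_at[rotated])
  then show ?thesis by (simp add: o_def)
qed

end

section \<open>The exponential map of a nilpotent Lie algebra\<close>

lemma has_vector_derivative_monomial: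
  "((\<lambda>t. (t ^ Suc k / fact (Suc k)) *\<^sub>R v) has_vector_derivative (t ^ k / fact k) *\<^sub>R v) (at t)"
proof -
  have "((\<lambda>t::real. t ^ Suc k / fact (Suc k)) has_real_derivative (real (Suc k) * t ^ k) / fact (Suc k)) (at t)"
    using DERIV_cdivide[OF DERIV_pow[of "Suc k" t UNIV], of "fact (Suc k)"] by simp
  moreover have "(real (Suc k) * t ^ k) / fact (Suc k) = t ^ k / fact k"
    by (simp add: field_simps del: of_nat_Suc)
  ultimately have "((\<lambda>t::real. t ^ Suc k / fact (Suc k)) has_real_derivative t ^ k / fact k) (at t)" by simp
  from has_vector_derivative_scaleR[OF this has_vector_derivative_const[of v]] show ?thesis by simp
qed

lemma has_vector_derivative_0_const:
  assumes "\<And>t::real. (f has_vector_derivative 0) (at t)" shows "f s = f t"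
  using has_vector_derivative_zero_constant[of UNIV f] assms by (metis UNIV_I convex_UNIV)

text \<open>Taylor's formula without remainder for a chain of derivatives that ends in 0. In
  \<open>Ad_E\<close> nilpotency ends the chain of iterated brackets.\<close>

lemma derivative_chain_polynomial:
  fixes a :: "nat \<Rightarrow> real \<Rightarrow> 'a::real_normed_vector"
  assumes "\<And>k t. (a k has_vector_derivative a (Suc k) t) (at t)" "\<And>t. a n t = 0"
  shows "a 0 t = (\<Sum>k<n. (t ^ k / fact k) *\<^sub>R a k 0)"
  using assms
proof (induction n arbitrary: a t)
  case (Suc n)
  have IH: "a (Suc 0) t = (\<Sum>k<n. (t ^ k / fact k) *\<^sub>R a (Suc k) 0)" for t
    using Suc.IH[of "\<lambda>k. a (Suc k)"] Suc.prems by simp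
  let ?p = "\<lambda>t. \<Sum>k<n. (t ^ Suc k / fact (Suc k)) *\<^sub>R a (Suc k) 0"
  have "(?p has_vector_derivative a (Suc 0) t) (at t)" for t
    unfolding IH by (intro has_vector_derivative_sum has_vector_derivative_monomial)
  from has_vector_derivative_diff[OF Suc.prems(1)[of 0] this]
  have "((\<lambda>t. a 0 t - ?p t) has_vector_derivative 0) (at t)" for t by simp
  from has_vector_derivative_0_const[OF this, of t 0]
  have "a 0 t = a 0 0 + ?p t" by (simp add: diff_eq_eq)
  then show ?case by (simp only: sum.lessThan_Suc_shift) simp
qed simp

locale nilpotent_lie_group_algebra = lie_group_algebra A L
  for A :: "('g::{topological_group_add, t2_space, second_countable_topology}, 'm::euclidean_space) chart set"
  and L :: "'v::euclidean_space \<Rightarrow> ('g \<Rightarrow> real) \<Rightarrow> ('g \<Rightarrow> real)" +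
  fixes n :: nat
  assumes nil: "(br x ^^ n) y = 0"
begin

lemma linear_br_pow: "linear (br x ^^ k)"
proof (induction k)
  case 0
  have "linear (\<lambda>x::'v. x)" by (rule linear_ident)
  then show ?case by (simp add: id_def)
next
  case (Suc k)
  have "linear (br x)" using bilinear_br by (simp add: bilinear_def)
  from linear_compose[OF Suc this] show ?case by (simp add: o_def)
qed

lemma bounded_bilinear_br: "bounded_bilinear br"
  using bilinear_br by (simp add: bilinear_conv_bounded_bilinear)

lemma tendsto_br_pow:
  assumes "(f \<longlongrightarrow> a) F" "(g \<longlongrightarrow> b) F" shows "((\<lambda>x. (br (f x) ^^ k) (g x)) \<longlongrightarrow> (br a ^^ k) b) F"
  by (induction k) (auto intro!: assms bounded_bilinear.tendsto[OF bounded_bilinear_br])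

lemma br_pow_bound: "\<exists>C>0. \<forall>x y. norm x \<le> R \<longrightarrow> norm ((br x ^^ k) y) \<le> C * norm y"
proof -
  obtain K where K: "K > 0" "\<And>a b. norm (br a b) \<le> norm a * norm b * K"
    using bounded_bilinear.pos_bounded[OF bounded_bilinear_br] by blast
  show ?thesis
  proof (induction k)
    case (Suc k)
    then obtain C where C: "C > 0" "\<And>x y. norm x \<le> R \<Longrightarrow> norm ((br x ^^ k) y) \<le> C * norm y" by blast
    have "norm ((br x ^^ Suc k) y) \<le> (\<bar>R\<bar> * C * K + 1) * norm y" if "norm x \<le> R" for x y
    proof -
      have "norm ((br x ^^ Suc k) y) \<le> norm x * norm ((br x ^^ k) y) * K" using K(2) by simp
      also have "\<dots> \<le> \<bar>R\<bar> * (C * norm y) * K"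
        using that C K by (intro mult_right_mono mult_mono) auto
      also have "\<dots> \<le> (\<bar>R\<bar> * C * K + 1) * norm y" by (simp add: algebra_simps)
      finally show ?thesis .
    qed
    moreover have "\<bar>R\<bar> * C * K + 1 > 0" using C K by (intro add_nonneg_pos) auto
    ultimately show ?case by blast
  qed (auto intro!: exI[of _ 1])
qed

text \<open>The operator exp(s ad x), whose series ends here by \<open>nil\<close>.\<close>

definition ad_exp :: "'v \<Rightarrow> real \<Rightarrow> 'v \<Rightarrow> 'v" where
  "ad_exp x s y = (\<Sum>k<n. (s ^ k / fact k) *\<^sub>R (br x ^^ k) y)"

text \<open>\<open>dexp x = (1 - e\<^sup>-\<^sup>a\<^sup>d\<^sup>x) / ad x\<close> is the logarithmic derivative of \<open>exp\<close> at \<open>x\<close>.\<close>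

definition dexp :: "'v \<Rightarrow> 'v \<Rightarrow> 'v" where
  "dexp x y = (\<Sum>k<n. ((-1) ^ k / fact (Suc k)) *\<^sub>R (br x ^^ k) y)"

lemma linear_dexp: "linear (dexp x)"
  unfolding dexp_def[abs_def] by (intro linear_compose_sum ballI linear_compose_scale_right linear_br_pow)

lemma tendsto_dexp:
  assumes "(f \<longlongrightarrow> a) F" "(g \<longlongrightarrow> b) F" shows "((\<lambda>x. dexp (f x) (g x)) \<longlongrightarrow> dexp a b) F"
  unfolding dexp_def by (intro tendsto_sum tendsto_scaleR tendsto_const tendsto_br_pow assms)

lemma ad_exp_bound: "\<exists>C>0. \<forall>x s y. norm x \<le> R \<longrightarrow> \<bar>s\<bar> \<le> 1 \<longrightarrow> norm (ad_exp x s y) \<le> C * norm y"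
proof -
  have "\<forall>k. \<exists>C>0. \<forall>x y. norm x \<le> R \<longrightarrow> norm ((br x ^^ k) y) \<le> C * norm y" using br_pow_bound by blast
  then obtain C where C: "\<And>k. C k > 0" "\<And>k x y. norm x \<le> R \<Longrightarrow> norm ((br x ^^ k) y) \<le> C k * norm y"
    by metis
  have "norm (ad_exp x s y) \<le> ((\<Sum>k<n. C k) + 1) * norm y" if x: "norm x \<le> R" and s: "\<bar>s\<bar> \<le> 1" for x s y
  proof -
    have "norm ((s ^ k / fact k) *\<^sub>R (br x ^^ k) y) \<le> C k * norm y" for k
    proof -
      have "\<bar>s ^ k / fact k\<bar> \<le> 1"
        using power_le_one[of "\<bar>s\<bar>" k] s fact_ge_1[of k, where 'a = real]
        by (simp add: power_abs divide_le_eq_1 order_trans[OF _ fact_ge_1])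
      then have "norm ((s ^ k / fact k) *\<^sub>R (br x ^^ k) y) \<le> 1 * norm ((br x ^^ k) y)"
        unfolding norm_scaleR by (intro mult_right_mono) auto
      then show ?thesis using C(2)[OF x, of k y] by simp
    qed
    then have "norm (ad_exp x s y) \<le> (\<Sum>k<n. C k * norm y)"
      unfolding ad_exp_def by (intro order_trans[OF norm_sum] sum_mono) 
    also have "\<dots> = (\<Sum>k<n. C k) * norm y" by (simp add: sum_distrib_right)
    also have "\<dots> \<le> ((\<Sum>k<n. C k) + 1) * norm y" by (simp add: distrib_right)
    finally show ?thesis .
  qed
  moreover have "(\<Sum>k<n. C k) + 1 > 0" using C(1) by (intro add_nonneg_pos sum_nonneg) (auto intro: less_imp_le)
  ultimately show ?thesis by blast
qed

lemma Ad_E: "Ad (E (t *\<^sub>R w)) v = ad_exp w t v"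
proof -
  have "Ad (E (t *\<^sub>R w)) ((br w ^^ 0) v) = (\<Sum>k<n. (t ^ k / fact k) *\<^sub>R Ad (E (0 *\<^sub>R w)) ((br w ^^ k) v))"
  proof (rule derivative_chain_polynomial[where a = "\<lambda>k t. Ad (E (t *\<^sub>R w)) ((br w ^^ k) v)"])
    show "((\<lambda>t. Ad (E (t *\<^sub>R w)) ((br w ^^ k) v)) has_vector_derivative Ad (E (t *\<^sub>R w)) ((br w ^^ Suc k) v)) (at t)" for k t
      using Ad_E_derivative[of w "(br w ^^ k) v" t] by simp
  qed (simp add: nil linear_0[OF linear_Ad])
  then show ?thesis by (simp add: Ad_0 ad_exp_def)
qed

section \<open>Continuity and differential of the exponential map\<close>

lemma L_expand: "L \<xi> f g = (\<Sum>i\<in>Basis. (\<xi> \<bullet> i) * L i f g)"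
proof -
  have "L \<xi> f g = L (\<Sum>i\<in>Basis. (\<xi> \<bullet> i) *\<^sub>R i) f g" by (simp only: euclidean_representation)
  then show ?thesis by (simp add: L_sum L_scale)
qed

lemma L_bound:
  fixes e :: real
  assumes "\<And>i. i \<in> Basis \<Longrightarrow> \<bar>L i f g - L i f h\<bar> \<le> e"
  shows "\<bar>L \<xi> f g - L \<xi> f h\<bar> \<le> real DIM('v) * e * norm \<xi>"
proof -
  have "L \<xi> f g - L \<xi> f h = (\<Sum>i\<in>Basis. (\<xi> \<bullet> i) * (L i f g - L i f h))"
    unfolding L_expand[of \<xi>] by (simp add: sum_subtractf right_diff_distrib)
  also have "\<bar>\<dots>\<bar> \<le> (\<Sum>i\<in>Basis. \<bar>(\<xi> \<bullet> i) * (L i f g - L i f h)\<bar>)" by (rule sum_abs)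
  also have "\<dots> \<le> (\<Sum>i\<in>(Basis::'v set). norm \<xi> * e)"
    unfolding abs_mult using assms by (intro sum_mono mult_mono) (auto simp: Basis_le_norm)
  finally show ?thesis by (simp add: mult_ac)
qed

text \<open>A bump function that is 1 at the identity changes along the curve at a rate below 1 once
  the logarithmic derivative is small, so it cannot reach 0 in unit time. The bound comes from the
  bump alone, hence is uniform in the curve.\<close>

lemma small_log_deriv_curve:
  assumes "open W" "0 \<in> W"
  shows "\<exists>\<delta>>0. \<forall>c \<xi>. c 0 = 0 \<longrightarrow> (\<forall>s. log_deriv c (\<xi> s) s) \<longrightarrow>
    (\<forall>s\<in>{0..1}. norm (\<xi> s) < \<delta>) \<longrightarrow> (\<forall>s\<in>{0..1}. c s \<in> W)"
proof -
  obtain b N K where b: "b \<in> S" "0 \<in> N" "\<And>x. x \<in> N \<Longrightarrow> b x = 1" "compact K" "K \<subseteq> W" "\<And>x. x \<notin> K \<Longrightarrow> b x = 0"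
    using bump_exists[OF assms] by metis
  have "\<exists>M. \<forall>g. \<bar>L i b g\<bar> \<le> M" for i
  proof -
    have "bounded (L i b ` K)"
      using L_continuous[OF b(1)] b(4) by (intro compact_imp_bounded compact_continuous_image) (auto intro: continuous_on_subset)
    then obtain M where M: "\<And>g. g \<in> K \<Longrightarrow> \<bar>L i b g\<bar> \<le> M" by (auto simp: bounded_iff)
    have "\<bar>L i b g\<bar> \<le> \<bar>M\<bar>" for g
    proof (cases "g \<in> K")
      case False
      have "L i b g = L i (\<lambda>_. 0) g"
        by (rule L_local[OF b(1), of _ "- K"]) (use False b(6) compact_imp_closed[OF b(4)] in auto)
      then show ?thesis by (simp add: L_fun_const)
    qed (use M in force)
    then show ?thesis by blast
  qed
  then obtain M where M: "\<And>i g. \<bar>L i b g\<bar> \<le> M i" by metis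
  define B where "B = (\<Sum>i\<in>Basis. M i) + 1"
  have M0: "M i \<ge> 0" for i using M[of i 0] by linarith
  have B: "B > 0" unfolding B_def using M0 by (intro add_nonneg_pos sum_nonneg) auto
  have LB: "\<bar>L \<xi> b g\<bar> \<le> B * norm \<xi>" for \<xi> g
  proof -
    have "\<bar>L \<xi> b g\<bar> \<le> (\<Sum>i\<in>Basis. \<bar>(\<xi> \<bullet> i) * L i b g\<bar>)" unfolding L_expand[of \<xi>] by (rule sum_abs)
    also have "\<dots> \<le> (\<Sum>i\<in>Basis. norm \<xi> * M i)"
      unfolding abs_mult using M by (intro sum_mono mult_mono) (auto simp: Basis_le_norm)
    also have "\<dots> = norm \<xi> * (\<Sum>i\<in>Basis. M i)" by (simp add: sum_distrib_left)
    also have "\<dots> \<le> B * norm \<xi>" by (simp add: B_def algebra_simps)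
    finally show ?thesis .
  qed
  show ?thesis
  proof (intro exI[of _ "1 / B"] conjI allI impI ballI)
    fix c :: "real \<Rightarrow> 'g" and \<xi> :: "real \<Rightarrow> 'v" and s :: real
    assume c: "c 0 = 0" "\<forall>s. log_deriv c (\<xi> s) s" "\<forall>s\<in>{0..1}. norm (\<xi> s) < 1 / B" and s: "s \<in> {0..1}"
    show "c s \<in> W"
    proof (cases "s = 0")
      case False
      then have "0 < s" using s by auto
      then obtain z where z: "0 < z" "z < s" "b (c s) - b (c 0) = (s - 0) * L (\<xi> z) b (c z)"
        using MVT2[of 0 s "\<lambda>s. b (c s)" "\<lambda>s. L (\<xi> s) b (c s)"] log_derivD[OF c(2)[rule_format] b(1)] by blast
      have "\<bar>L (\<xi> z) b (c z)\<bar> \<le> B * norm (\<xi> z)" by (rule LB)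
      also have "\<dots> < 1" using bspec[OF c(3), of z] z s B by (simp add: field_simps)
      finally have "\<bar>(s - 0) * L (\<xi> z) b (c z)\<bar> < 1"
        using s mult_mono[of "\<bar>s\<bar>" 1 "\<bar>L (\<xi> z) b (c z)\<bar>" "\<bar>L (\<xi> z) b (c z)\<bar>"] by (simp add: abs_mult)
      then have "b (c s) \<noteq> 0" using z(3) c(1) b(2,3) by auto
      then show ?thesis using b(5,6) by blast
    qed (use c assms in auto)
  qed (use B in auto)
qed

text \<open>This curve joins 0 to exp(-z) exp(x), and its logarithmic derivative has the size of
  \<open>x - z\<close> all the way. Both the continuity and the differential of \<open>exp\<close>
  are read off it.\<close>

lemma log_deriv_difference_curve:
  "log_deriv (\<lambda>s. E ((- s) *\<^sub>R z) + E (s *\<^sub>R x)) (ad_exp x (- s) (x - z)) s"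
proof -
  have "log_deriv (\<lambda>s. E (s *\<^sub>R (- z)) + E (s *\<^sub>R x)) (Ad (E ((- s) *\<^sub>R x)) (- z) + x) s"
    by (rule log_deriv_add[OF log_deriv_E exp_one_parameter])
  moreover have "Ad (E ((- s) *\<^sub>R x)) (- z) + x = ad_exp x (- s) (x - z)"
  proof -
    have a: "Ad (E ((- s) *\<^sub>R x)) x = x" by (rule Ad_one_parameter_self[OF exp_one_parameter])
    have "Ad (E ((- s) *\<^sub>R x)) (- z) + x = Ad (E ((- s) *\<^sub>R x)) (- z) + Ad (E ((- s) *\<^sub>R x)) x" by (simp only: a)
    also have "\<dots> = Ad (E ((- s) *\<^sub>R x)) (x - z)"
      using linear_add[OF linear_Ad, of "E ((- s) *\<^sub>R x)" "- z" x] by simp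
    finally show ?thesis by (simp only: Ad_E)
  qed
  ultimately show ?thesis by simp
qed

lemma exp_difference_small:
  assumes "open W" "0 \<in> W"
  shows "\<exists>d>0. \<forall>x s. norm (x - z) < d \<longrightarrow> s \<in> {0..1} \<longrightarrow> E ((- s) *\<^sub>R z) + E (s *\<^sub>R x) \<in> W"
proof -
  obtain \<delta> where d: "\<delta> > 0" "\<forall>c \<xi>. c 0 = 0 \<longrightarrow> (\<forall>s. log_deriv c (\<xi> s) s) \<longrightarrow>
    (\<forall>s\<in>{0..1}. norm (\<xi> s) < \<delta>) \<longrightarrow> (\<forall>s\<in>{0..1}. c s \<in> W)"
    using small_log_deriv_curve[OF assms] by blast
  obtain C where C: "C > 0" "\<And>x s y. norm x \<le> norm z + 1 \<Longrightarrow> \<bar>s\<bar> \<le> 1 \<Longrightarrow> norm (ad_exp x s y) \<le> C * norm y"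
    using ad_exp_bound[of "norm z + 1"] by blast
  show ?thesis
  proof (intro exI[of _ "min 1 (\<delta> / C)"] conjI allI impI)
    fix x and s :: real assume x: "norm (x - z) < min 1 (\<delta> / C)" and s: "s \<in> {0..1}"
    have nx: "norm x \<le> norm z + 1" using x norm_triangle_sub[of x z] by simp
    have "norm (ad_exp x (- s) (x - z)) < \<delta>" if "s \<in> {0..1}" for s
    proof -
      have "norm (ad_exp x (- s) (x - z)) \<le> C * norm (x - z)" using that by (intro C(2) nx) auto
      also have "\<dots> < \<delta>" using x C(1) by (simp add: field_simps)
      finally show ?thesis .
    qed
    then show "E ((- s) *\<^sub>R z) + E (s *\<^sub>R x) \<in> W"
      using d(2)[rule_format, of "\<lambda>s. E ((- s) *\<^sub>R z) + E (s *\<^sub>R x)", OF _ log_deriv_difference_curve _ s] by simp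
  qed (use C d in auto)
qed

lemma continuous_E: "continuous_on UNIV E"
proof (rule continuous_at_imp_continuous_on, rule ballI)
  fix z
  have "((\<lambda>x. E (- z) + E x) \<longlongrightarrow> 0) (at z)"
    unfolding tendsto_def
  proof (intro allI impI)
    fix W :: "'g set" assume W: "open W" "0 \<in> W"
    obtain d where d: "d > 0" "\<And>x s. norm (x - z) < d \<Longrightarrow> s \<in> {0..1} \<Longrightarrow> E ((- s) *\<^sub>R z) + E (s *\<^sub>R x) \<in> W"
      using exp_difference_small[OF W] by blast
    show "\<forall>\<^sub>F x in at z. E (- z) + E x \<in> W"
      unfolding eventually_at using d(1) d(2)[of _ 1] by (auto simp: dist_norm intro!: exI[of _ d])
  qed
  then have "((\<lambda>x. E z + (E (- z) + E x)) \<longlongrightarrow> E z + 0) (at z)" by (intro tendsto_add tendsto_const)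
  then show "isCont E z" by (simp add: isCont_def E_minus add.assoc[symmetric])
qed

text \<open>The logarithmic derivative of the difference curve, integrated over [0, 1], is
  \<open>dexp x (x - z)\<close>. The error is controlled because the curve stays where each
  \<open>L i f\<close> is close to its value at the identity.\<close>

lemma exp_first_order:
  assumes f: "f \<in> S"
  shows "((\<lambda>x. (f (E (- z) + E x) - f 0 - L (dexp x (x - z)) f 0) / norm (x - z)) \<longlongrightarrow> 0) (at z)"
proof (rule tendstoI)
  fix e :: real assume e: "e > 0"
  obtain C where C: "C > 0" "\<And>x s y. norm x \<le> norm z + 1 \<Longrightarrow> \<bar>s\<bar> \<le> 1 \<Longrightarrow> norm (ad_exp x s y) \<le> C * norm y"
    using ad_exp_bound[of "norm z + 1"] by blast
  \<comment> \<open>\<open>DIM('v)\<close> is lost in \<open>L_bound\<close> and \<open>C\<close> in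
    the bound on \<open>ad_exp\<close>; the factor 2 leaves room for a strict inequality.\<close>
  define \<epsilon> where "\<epsilon> = e / (2 * DIM('v) * C)"
  have ep: "\<epsilon> > 0" using e C(1) by (simp add: \<epsilon>_def)
  define W where "W = (\<Inter>i\<in>Basis. {g. \<bar>L i f g - L i f 0\<bar> < \<epsilon>})"
  have "open {g. \<bar>L i f g - L i f 0\<bar> < \<epsilon>}" for i
    by (rule open_Collect_less[OF continuous_on_rabs[OF continuous_on_diff[OF L_continuous[OF f] continuous_on_const]] continuous_on_const])
  then have W: "open W" "0 \<in> W" unfolding W_def using ep by (auto intro!: open_INT)
  obtain d where d: "d > 0" "\<And>x s. norm (x - z) < d \<Longrightarrow> s \<in> {0..1} \<Longrightarrow> E ((- s) *\<^sub>R z) + E (s *\<^sub>R x) \<in> W"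
    using exp_difference_small[OF W] by blast
  have main: "\<bar>f (E (- z) + E x) - f 0 - L (dexp x (x - z)) f 0\<bar> \<le> e / 2 * norm (x - z)"
    if x: "norm (x - z) < min 1 d" for x
  proof -
    define c where "c s = E ((- s) *\<^sub>R z) + E (s *\<^sub>R x)" for s
    \<comment> \<open>The primitive of the logarithmic derivative along the curve. Its value at 1 is
      \<open>dexp x (x - z)\<close>, which is where the \<open>fact (Suc k)\<close> in
      \<open>dexp\<close> comes from.\<close>
    define \<Theta> where "\<Theta> s = (\<Sum>k<n. (s ^ Suc k / fact (Suc k)) *\<^sub>R ((-1) ^ k *\<^sub>R (br x ^^ k) (x - z)))" for s :: real
    define \<eta> where "\<eta> s = ad_exp x (- s) (x - z)" for s
    have "(\<Theta> has_vector_derivative (\<Sum>k<n. (s ^ k / fact k) *\<^sub>R ((-1) ^ k *\<^sub>R (br x ^^ k) (x - z)))) (at s)" for s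
      unfolding \<Theta>_def by (intro has_vector_derivative_sum has_vector_derivative_monomial)
    moreover have "(\<Sum>k<n. (s ^ k / fact k) *\<^sub>R ((-1) ^ k *\<^sub>R (br x ^^ k) (x - z))) = \<eta> s" for s
      unfolding \<eta>_def ad_exp_def by (intro sum.cong refl) (simp add: power_minus[of s] mult_ac)
    ultimately have \<Theta>': "(\<Theta> has_vector_derivative \<eta> s) (at s)" for s by simp
    have "bounded_linear (\<lambda>\<xi>. L \<xi> f 0)"
      by (rule linear_conv_bounded_linear[THEN iffD1]) (auto intro!: linearI simp: L_add L_scale)
    from bounded_linear.has_vector_derivative[OF this \<Theta>']
    have "((\<lambda>s. L (\<Theta> s) f 0) has_real_derivative L (\<eta> s) f 0) (at s)" for s
      by (simp add: has_real_derivative_iff_has_vector_derivative)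
    moreover have "((\<lambda>s. f (c s)) has_real_derivative L (\<eta> s) f (c s)) (at s)" for s
      unfolding c_def \<eta>_def by (rule log_derivD[OF log_deriv_difference_curve f])
    ultimately have der: "((\<lambda>s. f (c s) - L (\<Theta> s) f 0) has_real_derivative L (\<eta> s) f (c s) - L (\<eta> s) f 0) (at s)" for s
      by (intro DERIV_diff)
    obtain s where s: "0 < s" "s < 1" "(f (c 1) - L (\<Theta> 1) f 0) - (f (c 0) - L (\<Theta> 0) f 0) =
       (1 - 0) * (L (\<eta> s) f (c s) - L (\<eta> s) f 0)"
      using MVT2[of 0 1 "\<lambda>s. f (c s) - L (\<Theta> s) f 0", OF _ der] by auto
    have cW: "c s \<in> W" unfolding c_def using d(2)[of x s] x s by auto
    have "\<bar>L (\<eta> s) f (c s) - L (\<eta> s) f 0\<bar> \<le> DIM('v) * \<epsilon> * norm (\<eta> s)"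
      by (rule L_bound) (use cW in \<open>auto simp: W_def intro: less_imp_le\<close>)
    also have "\<dots> \<le> DIM('v) * \<epsilon> * (C * norm (x - z))"
      unfolding \<eta>_def using s x norm_triangle_sub[of x z] ep by (intro mult_left_mono C(2)) auto
    also have "\<dots> = e / 2 * norm (x - z)" using C(1) by (simp add: \<epsilon>_def)
    finally have b: "\<bar>L (\<eta> s) f (c s) - L (\<eta> s) f 0\<bar> \<le> e / 2 * norm (x - z)" .
    have "\<Theta> 1 = dexp x (x - z)" unfolding \<Theta>_def dexp_def by (intro sum.cong) auto
    moreover have "\<Theta> 0 = 0" by (simp add: \<Theta>_def)
    moreover have "c 1 = E (- z) + E x" "c 0 = 0" by (auto simp: c_def)
    ultimately have "f (E (- z) + E x) - f 0 - L (dexp x (x - z)) f 0 = L (\<eta> s) f (c s) - L (\<eta> s) f 0"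
      using s(3) by simp
    then show ?thesis using b by simp
  qed
  show "\<forall>\<^sub>F x in at z. dist ((f (E (- z) + E x) - f 0 - L (dexp x (x - z)) f 0) / norm (x - z)) 0 < e"
    unfolding eventually_at
  proof (intro exI[of _ "min 1 d"] conjI ballI impI)
    fix x assume x: "x \<noteq> z \<and> dist x z < min 1 d"
    then have p: "norm (x - z) > 0" by simp
    have "\<bar>f (E (- z) + E x) - f 0 - L (dexp x (x - z)) f 0\<bar> \<le> e / 2 * norm (x - z)"
      using main[of x] x by (simp add: dist_norm)
    also have "\<dots> < e * norm (x - z)" using p e by simp
    finally show "dist ((f (E (- z) + E x) - f 0 - L (dexp x (x - z)) f 0) / norm (x - z)) 0 < e"
      using p by (simp add: dist_norm abs_div field_simps)
  qed (use d in auto)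
qed

lemma has_vector_derivative_quotient:
  "(z has_vector_derivative z') (at t) \<Longrightarrow> ((\<lambda>s. (z s - z t) /\<^sub>R (s - t)) \<longlongrightarrow> z') (at t)" for z :: "real \<Rightarrow> 'v"
proof -
  assume "(z has_vector_derivative z') (at t)"
  then have "((\<lambda>s. norm (z s - z t - (s - t) *\<^sub>R z') / norm (s - t)) \<longlongrightarrow> 0) (at t)"
    unfolding has_vector_derivative_def has_derivative_iff_norm by simp
  then have "((\<lambda>s. norm ((z s - z t) /\<^sub>R (s - t) - z')) \<longlongrightarrow> 0) (at t)"
  proof (rule Lim_transform_eventually)
    show "\<forall>\<^sub>F s in at t. norm (z s - z t - (s - t) *\<^sub>R z') / norm (s - t) = norm ((z s - z t) /\<^sub>R (s - t) - z')"
    proof (rule eventually_at_filter[THEN iffD2], rule always_eventually, intro allI impI)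
      fix s assume "s \<noteq> t"
      then have "(z s - z t) /\<^sub>R (s - t) - z' = (z s - z t - (s - t) *\<^sub>R z') /\<^sub>R (s - t)"
        by (simp add: scaleR_diff_right)
      then show "norm (z s - z t - (s - t) *\<^sub>R z') / norm (s - t) = norm ((z s - z t) /\<^sub>R (s - t) - z')"
        by (simp add: divide_inverse mult.commute)
    qed
  qed
  then show ?thesis using Lim_null tendsto_norm_zero_iff by blast
qed

text \<open>A left translation moves the base point to the identity, where
  \<open>exp_first_order\<close> applies. There \<open>dexp\<close> is taken at the moving point
  \<open>z s\<close>; its continuity brings it back to \<open>z t\<close>.\<close>

lemma log_deriv_exp_curve:
  assumes z: "(z has_vector_derivative z') (at t)"
  shows "log_deriv (\<lambda>s. E (z s)) (dexp (z t) z') t"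
  unfolding log_deriv_def
proof
  fix f assume f: "f \<in> S"
  define h where "h x = f (E (z t) + x)" for x
  have h: "h \<in> S" unfolding h_def by (rule smooth_functions_left_translate[OF f])
  define \<rho> where "\<rho> x = (h (E (- z t) + E x) - h 0 - L (dexp x (x - z t)) h 0) / norm (x - z t)" for x
  have "isCont \<rho> (z t)"
    using exp_first_order[OF h, of "z t"] by (simp add: isCont_def \<rho>_def[abs_def])
  moreover have zc: "isCont z t" using z has_vector_derivative_continuous by blast
  ultimately have "isCont (\<lambda>s. \<rho> (z s)) t" by (intro isCont_o2[where f = z and g = \<rho>])
  then have \<rho>0: "((\<lambda>s. \<rho> (z s)) \<longlongrightarrow> 0) (at t)" by (simp add: isCont_def \<rho>_def)
  note q = has_vector_derivative_quotient[OF z]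
  have "((\<lambda>s. \<bar>\<rho> (z s)\<bar> * norm ((z s - z t) /\<^sub>R (s - t))) \<longlongrightarrow> 0 * norm z') (at t)"
    by (intro tendsto_mult tendsto_norm q tendsto_rabs_zero \<rho>0)
  then have "((\<lambda>s. \<bar>\<rho> (z s) * norm (z s - z t) / (s - t)\<bar>) \<longlongrightarrow> 0) (at t)"
    by (simp add: abs_mult divide_inverse mult_ac)
  then have r0: "((\<lambda>s. \<rho> (z s) * norm (z s - z t) / (s - t)) \<longlongrightarrow> 0) (at t)"
    by (rule tendsto_rabs_zero_cancel)
  have "bounded_linear (\<lambda>\<xi>. L \<xi> h 0)"
    by (rule linear_conv_bounded_linear[THEN iffD1]) (auto intro!: linearI simp: L_add L_scale)
  from bounded_linear.tendsto[OF this tendsto_dexp[OF zc[unfolded isCont_def] q]]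
  have "((\<lambda>s. L (dexp (z s) ((z s - z t) /\<^sub>R (s - t))) h 0 + \<rho> (z s) * norm (z s - z t) / (s - t)) \<longlongrightarrow> L (dexp (z t) z') h 0 + 0) (at t)"
    by (rule tendsto_add[OF _ r0])
  moreover have "\<forall>\<^sub>F s in at t. L (dexp (z s) ((z s - z t) /\<^sub>R (s - t))) h 0 + \<rho> (z s) * norm (z s - z t) / (s - t)
     = (f (E (z s)) - f (E (z t))) / (s - t)"
  proof (rule always_eventually, rule allI)
    fix s
    have "L (dexp (z s) ((z s - z t) /\<^sub>R (s - t))) h 0 = L (dexp (z s) (z s - z t)) h 0 / (s - t)"
      by (simp add: linear_cmul[OF linear_dexp] L_scale divide_inverse mult.commute)
    moreover have "\<rho> (z s) * norm (z s - z t) = h (E (- z t) + E (z s)) - h 0 - L (dexp (z s) (z s - z t)) h 0"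
      by (cases "z s = z t") (auto simp: \<rho>_def E_minus linear_0[OF linear_dexp])
    moreover have "h (E (- z t) + E (z s)) = f (E (z s))" "h 0 = f (E (z t))"
      by (auto simp: h_def E_minus add.assoc[symmetric])
    ultimately show "L (dexp (z s) ((z s - z t) /\<^sub>R (s - t))) h 0 + \<rho> (z s) * norm (z s - z t) / (s - t)
     = (f (E (z s)) - f (E (z t))) / (s - t)"
      by (simp add: add_divide_distrib[symmetric])
  qed
  ultimately have "((\<lambda>s. (f (E (z s)) - f (E (z t))) / (s - t)) \<longlongrightarrow> L (dexp (z t) z') h 0 + 0) (at t)"
    by (rule Lim_transform_eventually)
  moreover have "L (dexp (z t) z') h 0 = L (dexp (z t) z') f (E (z t))"
    unfolding h_def by (simp add: L_left[OF f])
  ultimately show "((\<lambda>s. f (E (z s))) has_real_derivative L (dexp (z t) z') f (E (z t))) (at t)"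
    by (simp add: has_field_derivative_iff)
qed

text \<open>Both sides have logarithmic derivative \<open>y\<close>, so their difference is
  constant. From this equation the group law is built: a curve with dexp(z) z' = y multiplies by
  exp(ty).\<close>

lemma exp_curve_eq:
  assumes "\<And>t. (z has_vector_derivative z' t) (at t)" "\<And>t. dexp (z t) (z' t) = y"
  shows "E (z t) = E (z 0) + E (t *\<^sub>R y)"
proof -
  have "log_deriv (\<lambda>s. E (z s) + E (s *\<^sub>R (- y))) 0 s" for s
  proof -
    have "log_deriv (\<lambda>s. E (z s) + E (s *\<^sub>R (- y))) (Ad (E ((- s) *\<^sub>R (- y))) (dexp (z s) (z' s)) + - y) s"
      by (rule log_deriv_add[OF log_deriv_exp_curve[OF assms(1)] exp_one_parameter])
    moreover have "Ad (E (s *\<^sub>R y)) y = y" by (rule Ad_one_parameter_self[OF exp_one_parameter])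
    ultimately show ?thesis by (simp add: assms(2))
  qed
  then have "E (z t) + E (t *\<^sub>R (- y)) = E (z 0) + E (0 *\<^sub>R (- y))" by (rule log_deriv_zero_const)
  then have "E (z t) + - E (t *\<^sub>R y) = E (z 0)" by (simp add: E_minus)
  then show ?thesis by (metis diff_add_cancel diff_conv_add_uminus)
qed

end

section \<open>The group law of a stratified Lie algebra\<close>

locale stratified_lie_group = lie_group_algebra A L
  for A :: "('g::{topological_group_add, t2_space, second_countable_topology}, 'm::euclidean_space) chart set"
  and L :: "'v::euclidean_space \<Rightarrow> ('g \<Rightarrow> real) \<Rightarrow> ('g \<Rightarrow> real)" +
  fixes r :: nat and V :: "nat \<Rightarrow> 'v set"
  assumes strat: "stratification L r V"
begin


lemma r_pos: "r \<ge> 1"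
  and V_subspace: "j \<in> {1..r} \<Longrightarrow> subspace (V j)"
  and V_generate: "j \<in> {1..<r} \<Longrightarrow> span {br x y | x y. x \<in> V 1 \<and> y \<in> V j} = V (Suc j)"
  and V_last: "span {br x y | x y. x \<in> V 1 \<and> y \<in> V r} = {0}"
  using strat by (auto simp: stratification_def)

declare One_nat_def [simp del] Suc_eq_plus1 [symmetric, simp]

lemma V_decomp: "\<exists>!c. c \<in> PiE {1..r} V \<and> x = (\<Sum>j=1..r. c j)"
  using strat by (auto simp: stratification_def)

definition pr :: "nat \<Rightarrow> 'v \<Rightarrow> 'v" where
  "pr j x = (if j \<in> {1..r} then (THE c. c \<in> PiE {1..r} V \<and> x = (\<Sum>j=1..r. c j)) j else 0)"

lemma pr_in: "j \<in> {1..r} \<Longrightarrow> pr j x \<in> V j"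
  and pr_sum: "(\<Sum>j=1..r. pr j x) = x"
proof -
  define c where "c = (THE c. c \<in> PiE {1..r} V \<and> x = (\<Sum>j=1..r. c j))"
  have c: "c \<in> PiE {1..r} V \<and> x = (\<Sum>j=1..r. c j)" unfolding c_def by (rule theI'[OF V_decomp])
  have p: "pr j x = c j" if "j \<in> {1..r}" for j using that unfolding pr_def c_def by simp
  show "j \<in> {1..r} \<Longrightarrow> pr j x \<in> V j" using p[of j] c by (auto dest: PiE_mem)
  have "(\<Sum>j=1..r. pr j x) = (\<Sum>j=1..r. c j)" by (intro sum.cong p refl)
  then show "(\<Sum>j=1..r. pr j x) = x" using c by simp
qed

lemma pr_unique:
  assumes "\<And>j. j \<in> {1..r} \<Longrightarrow> c j \<in> V j" "x = (\<Sum>j=1..r. c j)" "j \<in> {1..r}"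
  shows "pr j x = c j"
proof -
  have 1: "restrict c {1..r} \<in> PiE {1..r} V \<and> x = (\<Sum>j=1..r. restrict c {1..r} j)" using assms by auto
  have "(THE c. c \<in> PiE {1..r} V \<and> x = (\<Sum>j=1..r. c j)) = restrict c {1..r}"
    using V_decomp[of x] theI'[OF V_decomp[of x]] 1 by blast
  then show ?thesis using assms(3) by (simp add: pr_def)
qed

lemma pr_outside: "j \<notin> {1..r} \<Longrightarrow> pr j x = 0"
  by (simp only: pr_def if_False)

lemma linear_pr: "linear (pr j)"
proof (cases "j \<in> {1..r}")
  case True
  show ?thesis
  proof
    show "pr j (x + y) = pr j x + pr j y" for x y
      by (rule pr_unique[OF _ _ True])
         (auto intro!: subspace_add[OF V_subspace] pr_in simp: sum.distrib pr_sum)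
    show "pr j (a *\<^sub>R x) = a *\<^sub>R pr j x" for a x
      by (rule pr_unique[OF _ _ True])
         (auto intro!: subspace_scale[OF V_subspace] pr_in simp: scaleR_sum_right[symmetric] pr_sum)
  qed
next
  case False
  then have "pr j = (\<lambda>x. 0)" by (auto simp: pr_def)
  then show ?thesis by (simp add: linear_zero)
qed

lemma bounded_linear_pr: "bounded_linear (pr j)"
  using linear_pr by (simp add: linear_conv_bounded_linear)

lemmas pr_add = linear_add[OF linear_pr] and pr_scale = linear_cmul[OF linear_pr]
  and pr_diff = linear_diff[OF linear_pr] and pr_0 = linear_0[OF linear_pr] and pr_linear_sum = linear_sum[OF linear_pr]

lemma pr_V:
  assumes "x \<in> V i" "i \<in> {1..r}" shows "pr j x = (if j = i then x else 0)"
proof (cases "j \<in> {1..r}")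
  case True
  show ?thesis
    by (rule pr_unique[where c = "\<lambda>j. if j = i then x else 0", OF _ _ True])
       (use assms in \<open>auto intro: subspace_0[OF V_subspace]\<close>)
qed (use assms in \<open>auto simp: pr_def\<close>)

text \<open>The layers continued by {0}, so that the bracket of layers i and j lies in layer i + j
  even beyond the step \<open>r\<close>.\<close>

definition W :: "nat \<Rightarrow> 'v set" where "W j = (if j \<in> {1..r} then V j else {0})"

lemma subspace_W: "subspace (W j)"
  by (auto simp: W_def intro: V_subspace subspace_single_0)

lemma pr_W: "x \<in> W i \<Longrightarrow> pr j x = (if j = i then x else 0)"
  by (auto simp: W_def pr_V pr_0 split: if_splits)

lemma pr_in_W: "pr j x \<in> W j"
proof (cases "j \<in> {1..r}")
  case False
  then have "pr j x = 0" "W j = {0}" by (simp_all only: pr_def W_def if_False)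
  then show ?thesis by simp
qed (simp add: W_def pr_in)

lemma br_V1_W:
  assumes "x \<in> V 1" "y \<in> W j" "j \<ge> 1" shows "br x y \<in> W (Suc j)"
proof -
  consider "j < r" | "j = r" | "j > r" by linarith
  then show ?thesis
  proof cases
    case 1
    then have "br x y \<in> span {br x y | x y. x \<in> V 1 \<and> y \<in> V j}"
      using assms by (intro span_base) (auto simp: W_def)
    then show ?thesis using V_generate[of j] 1 assms(3) by (simp add: W_def)
  next
    case 2
    then have "br x y \<in> span {br x y | x y. x \<in> V 1 \<and> y \<in> V r}"
      using assms by (intro span_base) (auto simp: W_def)
    then show ?thesis using V_last 2 by (simp add: W_def)
  next
    case 3
    then have "br x y = 0" using assms(2) bilinear_rzero[OF bilinear_br] by (simp add: W_def)
    then show ?thesis using subspace_0[OF subspace_W] by simp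
  qed
qed

text \<open>Only brackets with \<open>V 1\<close> are given. Layer i + 1 is spanned by brackets
  [a, b] with a in \<open>V 1\<close> and b in layer i, and the Jacobi identity rewrites [[a, b], y]
  as [a, [b, y]] - [b, [a, y]], to which the induction applies.\<close>

lemma br_W:
  assumes "x \<in> W i" "y \<in> W j" "i \<ge> 1" "j \<ge> 1" shows "br x y \<in> W (i + j)"
  using assms
proof (induction i arbitrary: x y j)
  case (Suc i)
  show ?case
  proof (cases "i = 0")
    case True
    then show ?thesis using br_V1_W[of x y j] Suc.prems r_pos by (simp add: W_def One_nat_def)
  next
    case False
    show ?thesis
    proof (cases "Suc i \<le> r")
      case True
      then have "x \<in> span {br a b | a b. a \<in> V 1 \<and> b \<in> V i}"
        using Suc.prems(1) V_generate[of i] False by (simp add: W_def)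
      then show ?thesis
      proof (induction rule: span_induct)
        show "subspace {x. br x y \<in> W (Suc i + j)}"
          by (auto simp: subspace_def bilinear_lzero[OF bilinear_br] br_add_left br_scale_left
              intro: subspace_0[OF subspace_W] subspace_add[OF subspace_W] subspace_scale[OF subspace_W])
        fix x assume "x \<in> {br a b | a b. a \<in> V 1 \<and> b \<in> V i}"
        then obtain a b where ab: "x = br a b" "a \<in> V 1" "b \<in> V i" by auto
        have bW: "b \<in> W i" using ab True False by (simp add: W_def)
        have 1: "br a (br b y) \<in> W (Suc (i + j))"
          using br_V1_W[OF ab(2) Suc.IH[OF bW Suc.prems(2) _ Suc.prems(4)]] False Suc.prems by simp
        have 2: "br b (br a y) \<in> W (Suc (i + j))"
          using Suc.IH[OF bW br_V1_W[OF ab(2) Suc.prems(2,4)]] False by simp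
        have "br x y = br a (br b y) - br b (br a y)" using br_Jacobi[of a b y] ab by simp
        then show "br x y \<in> W (Suc i + j)" using subspace_diff[OF subspace_W 1 2] by simp
      qed
    next
      case False
      then have "x = 0" using Suc.prems(1) by (simp add: W_def)
      then show ?thesis using subspace_0[OF subspace_W] by (simp add: bilinear_lzero[OF bilinear_br])
    qed
  qed
qed simp

text \<open>The descending filtration, from the whole space at 1 to {0} at r + 1. Every bracket
  climbs it, so equations can be solved layer by layer.\<close>

definition Fil :: "nat \<Rightarrow> 'v set" where "Fil j = {x. \<forall>i<j. pr i x = 0}"

lemma subspace_Fil: "subspace (Fil j)"
  by (auto simp: subspace_def Fil_def pr_add pr_scale pr_0)

lemmas Fil_add = subspace_add[OF subspace_Fil] and Fil_diff = subspace_diff[OF subspace_Fil]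
  and Fil_scale = subspace_scale[OF subspace_Fil] and Fil_0 = subspace_0[OF subspace_Fil]
  and Fil_sum = subspace_sum[OF subspace_Fil]

lemma Fil_1 [simp]: "Fil (Suc 0) = UNIV"
  by (auto simp: Fil_def pr_def)

lemma Fil_mono: "i \<le> j \<Longrightarrow> x \<in> Fil j \<Longrightarrow> x \<in> Fil i"
  by (auto simp: Fil_def)

lemma Fil_top: "r < j \<Longrightarrow> x \<in> Fil j \<Longrightarrow> x = 0"
  using pr_sum[of x] by (simp add: Fil_def)

lemma W_Fil: "x \<in> W i \<Longrightarrow> j \<le> i \<Longrightarrow> x \<in> Fil j"
  by (auto simp: Fil_def pr_W)

lemma br_expand: "br x y = (\<Sum>a=1..r. \<Sum>b=1..r. br (pr a x) (pr b y))"
proof -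
  have "br x y = br (\<Sum>a=1..r. pr a x) (\<Sum>b=1..r. pr b y)" by (simp only: pr_sum)
  also have "\<dots> = (\<Sum>(a, b)\<in>{1..r} \<times> {1..r}. br (pr a x) (pr b y))" by (rule bilinear_sum[OF bilinear_br])
  finally show ?thesis by (simp add: sum.cartesian_product)
qed

lemma br_Fil:
  assumes "x \<in> Fil i" "y \<in> Fil j" shows "br x y \<in> Fil (i + j)"
  unfolding br_expand[of x y]
proof (intro Fil_sum)
  fix a b assume ab: "a \<in> {1..r}" "b \<in> {1..r}"
  show "br (pr a x) (pr b y) \<in> Fil (i + j)"
  proof (cases "a < i \<or> b < j")
    case True
    then have "br (pr a x) (pr b y) = 0"
      using assms by (auto simp: Fil_def bilinear_lzero[OF bilinear_br] bilinear_rzero[OF bilinear_br])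
    then show ?thesis by (simp add: Fil_0)
  next
    case False
    then show ?thesis using br_W[OF pr_in_W pr_in_W, of a b x y] ab by (intro W_Fil) auto
  qed
qed

lemma br_pow_Fil: "y \<in> Fil j \<Longrightarrow> (br x ^^ k) y \<in> Fil (j + k)"
proof (induction k)
  case (Suc k)
  then show ?case using br_Fil[of x "Suc 0" "(br x ^^ k) y" "j + k"] by simp
qed simp

end

text \<open>Each bracket with \<open>x\<close> climbs the filtration by one step, so r of them lead
  from index 1 to index r + 1, where only 0 is left.\<close>

sublocale stratified_lie_group \<subseteq> nilpotent_lie_group_algebra A L r
proof
  show "(br x ^^ r) y = 0" for x y
    using br_pow_Fil[of y "Suc 0" r x] Fil_top[of "Suc 0 + r"] by simp
qed

context stratified_lie_group
begin

section \<open>Dilations and the inverse of \<open>dexp\<close>\<close>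

definition dil :: "real \<Rightarrow> 'v \<Rightarrow> 'v" where "dil s x = (\<Sum>j=1..r. s ^ j *\<^sub>R pr j x)"

lemma linear_dil: "linear (dil s)"
  unfolding dil_def[abs_def] by (intro linear_compose_sum ballI linear_compose_scale_right linear_pr)

lemma bounded_linear_dil: "bounded_linear (dil s)"
  using linear_dil by (simp add: linear_conv_bounded_linear)

lemma pr_dil: "pr j (dil s x) = s ^ j *\<^sub>R pr j x"
proof (cases "j \<in> {1..r}")
  case True
  then show ?thesis
    unfolding dil_def by (intro pr_unique[OF _ refl] subspace_scale[OF V_subspace] pr_in)
qed (simp add: pr_outside)

lemma dil_dil: "dil s (dil t x) = dil (s * t) x"
  unfolding dil_def[of s] dil_def[of "s * t"] pr_dil by (simp add: power_mult_distrib)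

lemma dil_1: "dil 1 x = x"
  by (simp add: dil_def pr_sum)

lemma dil_W:
  assumes "x \<in> W j" shows "dil s x = s ^ j *\<^sub>R x"
proof (cases "j \<in> {1..r}")
  case True
  have "dil s x = (\<Sum>i=1..r. if i = j then s ^ j *\<^sub>R x else 0)"
    unfolding dil_def using pr_W[OF assms] by (intro sum.cong) auto
  then show ?thesis using True by simp
next
  case False
  then show ?thesis using assms by (auto simp: W_def linear_0[OF linear_dil] split: if_splits)
qed

text \<open>Weights add under the bracket, so dilations are automorphisms. Everything built from
  brackets inherits this, up to \<open>mul\<close>.\<close>

lemma dil_br: "dil s (br x y) = br (dil s x) (dil s y)"
proof -
  have "dil s (br (pr a x) (pr b y)) = br (pr a (dil s x)) (pr b (dil s y))" if "a \<in> {1..r}" "b \<in> {1..r}" for a b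
    using dil_W[OF br_W[OF pr_in_W pr_in_W]] that
    by (simp add: pr_dil br_scale_left br_scale_right power_add)
  then show ?thesis
    unfolding br_expand[of x y] br_expand[of "dil s x"] by (simp add: linear_sum[OF linear_dil])
qed

lemma dil_br_pow: "dil s ((br x ^^ k) y) = (br (dil s x) ^^ k) (dil s y)"
  by (induction k) (auto simp: dil_br)

lemma dil_dexp: "dil s (dexp x y) = dexp (dil s x) (dil s y)"
  by (simp add: dexp_def linear_sum[OF linear_dil] linear_cmul[OF linear_dil] dil_br_pow)

definition Nx :: "'v \<Rightarrow> 'v \<Rightarrow> 'v" where "Nx x y = y - dexp x y"

text \<open>\<open>Px x\<close> is the inverse of \<open>dexp x\<close>, by the finite Neumann series.\<close>

definition Px :: "'v \<Rightarrow> 'v \<Rightarrow> 'v" where "Px x y = (\<Sum>k<r. (Nx x ^^ k) y)"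

lemma linear_Nx: "linear (Nx x)"
  unfolding Nx_def[abs_def] by (intro linear_compose_sub linear_ident linear_dexp)

lemma linear_Nx_pow: "linear (Nx x ^^ k)"
proof (induction k)
  case 0
  have "linear (\<lambda>x::'v. x)" by (rule linear_ident)
  then show ?case by (simp add: id_def)
next
  case (Suc k)
  from linear_compose[OF Suc linear_Nx] show ?case by (simp add: o_def)
qed

lemma linear_Px: "linear (Px x)"
  unfolding Px_def[abs_def] by (intro linear_compose_sum ballI linear_Nx_pow)

lemma tendsto_Nx_pow:
  assumes "(f \<longlongrightarrow> a) F" "(g \<longlongrightarrow> b) F" shows "((\<lambda>x. (Nx (f x) ^^ k) (g x)) \<longlongrightarrow> (Nx a ^^ k) b) F"
proof (induction k)
  case (Suc k)
  from tendsto_diff[OF Suc tendsto_dexp[OF assms(1) Suc]] show ?case by (simp add: Nx_def)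
qed (simp add: assms)

lemma tendsto_Px:
  assumes "(f \<longlongrightarrow> a) F" "(g \<longlongrightarrow> b) F" shows "((\<lambda>x. Px (f x) (g x)) \<longlongrightarrow> Px a b) F"
  unfolding Px_def by (intro tendsto_sum tendsto_Nx_pow assms)

lemma continuous_on_Px:
  "continuous_on X f \<Longrightarrow> continuous_on X g \<Longrightarrow> continuous_on X (\<lambda>x. Px (f x) (g x))"
  unfolding continuous_on_def by (auto intro: tendsto_Px)

lemma dexp_split: "dexp x y = y + (\<Sum>k\<in>{1..<r}. ((-1) ^ k / fact (Suc k)) *\<^sub>R (br x ^^ k) y)"
proof -
  have "{..<r} = insert 0 {1..<r}" using r_pos by auto
  then show ?thesis by (simp add: dexp_def)
qed

text \<open>Apart from the identity, every term of \<open>dexp x\<close> applies ad x at least once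
  and so climbs the filtration. This ends the Neumann series of \<open>Px\<close> after
  \<open>r\<close> terms.\<close>

lemma Nx_Fil: "y \<in> Fil j \<Longrightarrow> Nx x y \<in> Fil (Suc j)"
proof -
  assume y: "y \<in> Fil j"
  have "(\<Sum>k\<in>{1..<r}. ((-1) ^ k / fact (Suc k)) *\<^sub>R (br x ^^ k) y) \<in> Fil (Suc j)"
    by (intro Fil_sum Fil_scale Fil_mono[OF _ br_pow_Fil[OF y]]) auto
  then have "0 - (\<Sum>k\<in>{1..<r}. ((-1) ^ k / fact (Suc k)) *\<^sub>R (br x ^^ k) y) \<in> Fil (Suc j)"
    by (intro Fil_diff Fil_0)
  then show ?thesis by (simp add: Nx_def dexp_split)
qed

lemma Nx_pow_Fil: "y \<in> Fil j \<Longrightarrow> (Nx x ^^ k) y \<in> Fil (j + k)"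
  by (induction k) (auto simp: Nx_Fil)

lemma dexp_Px: "dexp x (Px x y) = y"
proof -
  have "dexp x (Px x y) = Px x y - Nx x (Px x y)" by (simp add: Nx_def)
  also have "Nx x (Px x y) = (\<Sum>k<r. (Nx x ^^ Suc k) y)" by (simp add: Px_def linear_sum[OF linear_Nx])
  also have "Px x y - \<dots> = (\<Sum>k<r. (Nx x ^^ k) y - (Nx x ^^ Suc k) y)" by (simp add: Px_def sum_subtractf)
  also have "\<dots> = (Nx x ^^ 0) y - (Nx x ^^ r) y" by (rule sum_lessThan_telescope')
  also have "(Nx x ^^ r) y = 0" using Nx_pow_Fil[of y "Suc 0" r x] Fil_top[of "Suc r"] by simp
  finally show ?thesis by simp
qed

lemma Px_Fil: "y \<in> Fil j \<Longrightarrow> Px x y - y \<in> Fil (Suc j)"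
proof -
  assume y: "y \<in> Fil j"
  have "{..<r} = insert 0 {1..<r}" using r_pos by auto
  then have "Px x y - y = (\<Sum>k\<in>{1..<r}. (Nx x ^^ k) y)" by (simp add: Px_def)
  also have "\<dots> \<in> Fil (Suc j)"
    by (intro Fil_sum Fil_mono[OF _ Nx_pow_Fil[OF y]]) auto
  finally show ?thesis .
qed

lemma br_pow_cong:
  assumes "x - x' \<in> Fil j" shows "(br x ^^ k) y - (br x' ^^ k) y \<in> Fil (Suc j)"
proof (induction k)
  case (Suc k)
  let ?u = "(br x ^^ k) y" and ?u' = "(br x' ^^ k) y"
  have "br x ?u - br x' ?u' = br (x - x') ?u + br x' (?u - ?u')"
    by (simp add: bilinear_lsub[OF bilinear_br] bilinear_rsub[OF bilinear_br])
  moreover have "br (x - x') ?u \<in> Fil (Suc j)" using br_Fil[OF assms, of ?u "Suc 0"] by simp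
  moreover have "br x' (?u - ?u') \<in> Fil (Suc j)"
    using br_Fil[of x' "Suc 0", OF _ Suc] by (auto intro: Fil_mono[rotated])
  ultimately show ?case by (simp add: Fil_add)
qed (simp add: Fil_0)

lemma Nx_cong:
  assumes "x - x' \<in> Fil j" shows "Nx x y - Nx x' y \<in> Fil (Suc j)"
proof -
  have "Nx x y - Nx x' y = (\<Sum>k<r. ((-1) ^ k / fact (Suc k)) *\<^sub>R ((br x' ^^ k) y - (br x ^^ k) y))"
    by (simp add: Nx_def dexp_def sum_subtractf scaleR_diff_right)
  also have "\<dots> \<in> Fil (Suc j)"
    using br_pow_cong[of x' x j] assms Fil_diff[OF Fil_0 assms] by (intro Fil_sum Fil_scale) auto
  finally show ?thesis .
qed

text \<open>Triangularity: \<open>x\<close> enters only through brackets, so a change of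
  \<open>x\<close> from layer j on is felt only from layer j + 1 on. This makes the Picard iteration
  stationary, its solutions unique and right translations triangular.\<close>

lemma Px_cong:
  assumes "x - x' \<in> Fil j" shows "Px x y - Px x' y \<in> Fil (Suc j)"
proof -
  have "(Nx x ^^ k) y - (Nx x' ^^ k) y \<in> Fil (Suc j)" for k
  proof (induction k)
    case (Suc k)
    let ?u = "(Nx x ^^ k) y" and ?u' = "(Nx x' ^^ k) y"
    have "Nx x' (?u - ?u') \<in> Fil (Suc j)"
      using Nx_Fil[OF Suc, of x'] by (rule Fil_mono[rotated]) simp
    from Fil_add[OF Nx_cong[OF assms, of ?u] this] show ?case by (simp add: linear_diff[OF linear_Nx])
  qed (simp add: Fil_0)
  then have "(\<Sum>k<r. (Nx x ^^ k) y - (Nx x' ^^ k) y) \<in> Fil (Suc j)" by (intro Fil_sum)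
  then show ?thesis by (simp add: Px_def sum_subtractf)
qed

lemma dil_Px: "dil s (Px x y) = Px (dil s x) (dil s y)"
proof -
  have "dil s ((Nx x ^^ k) y) = (Nx (dil s x) ^^ k) (dil s y)" for k
    by (induction k) (auto simp: Nx_def linear_diff[OF linear_dil] dil_dexp)
  then show ?thesis by (simp add: Px_def linear_sum[OF linear_dil])
qed

lemma Px_commuting: "br x y = 0 \<Longrightarrow> Px x y = y"
proof -
  assume b: "br x y = 0"
  have "(br x ^^ k) y = 0" if "k \<ge> 1" for k
    using that by (induction k rule: dec_induct) (auto simp: b bilinear_rzero[OF bilinear_br] One_nat_def)
  then have "dexp x y = y" by (simp add: dexp_split)
  then have N0: "Nx x y = 0" by (simp add: Nx_def)
  have "(Nx x ^^ k) y = 0" if "k \<ge> 1" for k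
    using that by (induction k rule: dec_induct) (auto simp: N0 linear_0[OF linear_Nx] One_nat_def)
  moreover have "{..<r} = insert 0 {1..<r}" using r_pos by auto
  ultimately show ?thesis by (simp add: Px_def)
qed

text \<open>\<open>mul\<close> is the group law in exponential coordinates: \<open>t \<mapsto> mul x (t y)\<close> solves \<open>c' = Px c y\<close>.
  Since \<open>Px\<close> is triangular, the Picard iteration \<open>mulk\<close> becomes stationary after \<open>r\<close> steps.\<close>

fun mulk :: "nat \<Rightarrow> 'v \<Rightarrow> 'v \<Rightarrow> 'v" where
  "mulk 0 x y = x"
| "mulk (Suc k) x y = x + integral {0..1} (\<lambda>s. Px (mulk k x (s *\<^sub>R y)) y)"

definition mul :: "'v \<Rightarrow> 'v \<Rightarrow> 'v" where "mul = mulk r"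

lemma continuous_mulk: "continuous_on UNIV (\<lambda>z. mulk k (fst z) (snd z))"
proof (induction k)
  case (Suc k)
  have "continuous_on (UNIV \<times> cbox 0 1) (\<lambda>(z, s). Px (mulk k (fst z) (s *\<^sub>R snd z)) (snd z))"
    unfolding case_prod_unfold
  proof (rule continuous_on_Px)
    show "continuous_on (UNIV \<times> cbox 0 1) (\<lambda>p. mulk k (fst (fst p)) (snd p *\<^sub>R snd (fst p)))"
      using continuous_on_compose2[OF Suc, of "UNIV \<times> cbox 0 1" "\<lambda>p. (fst (fst p), snd p *\<^sub>R snd (fst p))"]
      by (simp add: continuous_intros)
  qed (intro continuous_intros)
  from integral_continuous_on_param[OF this]
  have "continuous_on UNIV (\<lambda>z. integral {0..1} (\<lambda>s. Px (mulk k (fst z) (s *\<^sub>R snd z)) (snd z)))" by simp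
  then show ?case by (simp add: continuous_intros)
qed (simp add: continuous_intros)

lemma continuous_on_mulk:
  assumes "continuous_on X f" "continuous_on X g" shows "continuous_on X (\<lambda>z. mulk k (f z) (g z))"
  using continuous_on_compose2[OF continuous_mulk continuous_on_Pair[OF assms], of k] by simp

lemma mulk_integrable: "(\<lambda>s. Px (mulk k x (s *\<^sub>R y)) y') integrable_on {0..1}"
  by (intro integrable_continuous_interval continuous_on_Px continuous_on_mulk continuous_intros)

lemma Fil_integral:
  assumes "f integrable_on {0..1::real}" "\<And>s. s \<in> {0..1} \<Longrightarrow> f s \<in> Fil j"
  shows "integral {0..1} f \<in> Fil j"
  unfolding Fil_def
proof (intro CollectI allI impI)
  fix i assume i: "i < j"
  have "pr i (integral {0..1} f) = integral {0..1} (pr i \<circ> f)"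
    by (rule integral_linear[OF assms(1) bounded_linear_pr, symmetric])
  also have "\<dots> = integral {0..1} (\<lambda>s::real. 0)"
    by (rule integral_cong) (use assms(2) i in \<open>auto simp: Fil_def\<close>)
  finally show "pr i (integral {0..1} f) = 0" by simp
qed

lemma mulk_stationary: "mulk (Suc k) x y - mulk k x y \<in> Fil (Suc k)"
proof (induction k arbitrary: y)
  case (Suc k)
  have "mulk (Suc (Suc k)) x y - mulk (Suc k) x y =
     integral {0..1} (\<lambda>s. Px (mulk (Suc k) x (s *\<^sub>R y)) y - Px (mulk k x (s *\<^sub>R y)) y)"
    by (subst integral_diff[OF mulk_integrable mulk_integrable]) simp
  also have "\<dots> \<in> Fil (Suc (Suc k))"
    by (rule Fil_integral[OF integrable_diff[OF mulk_integrable mulk_integrable] Px_cong[OF Suc]])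
  finally show ?case .
qed simp

lemma mul_fixpoint: "mul x y = x + integral {0..1} (\<lambda>s. Px (mul x (s *\<^sub>R y)) y)"
  using Fil_top[OF _ mulk_stationary[of r x y]] by (simp add: mul_def)

lemma continuous_on_mul:
  "continuous_on X f \<Longrightarrow> continuous_on X g \<Longrightarrow> continuous_on X (\<lambda>z. mul (f z) (g z))"
  unfolding mul_def by (rule continuous_on_mulk)

text \<open>To leading order, right multiplication by \<open>y\<close> preserves differences. Hence
  component k of \<open>mul x y - x\<close> depends only on the components of \<open>x\<close> below
  k, which is what splits a right translation into shears.\<close>

lemma mulk_cong:
  assumes "x - x' \<in> Fil j" shows "(mulk k x y - mulk k x' y) - (x - x') \<in> Fil (Suc j)"
proof (induction k arbitrary: y)
  case (Suc k)
  have "(mulk (Suc k) x y - mulk (Suc k) x' y) - (x - x') =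
     integral {0..1} (\<lambda>s. Px (mulk k x (s *\<^sub>R y)) y - Px (mulk k x' (s *\<^sub>R y)) y)"
    by (subst integral_diff[OF mulk_integrable mulk_integrable]) simp
  also have "\<dots> \<in> Fil (Suc j)"
  proof (rule Fil_integral[OF integrable_diff[OF mulk_integrable mulk_integrable] Px_cong])
    fix s
    have "((mulk k x (s *\<^sub>R y) - mulk k x' (s *\<^sub>R y)) - (x - x')) + (x - x') \<in> Fil j"
      by (rule Fil_add[OF Fil_mono[OF _ Suc] assms]) simp
    then show "mulk k x (s *\<^sub>R y) - mulk k x' (s *\<^sub>R y) \<in> Fil j" by simp
  qed
  finally show ?case .
qed (simp add: Fil_0)

lemma mul_cong: "x - x' \<in> Fil j \<Longrightarrow> (mul x y - mul x' y) - (x - x') \<in> Fil (Suc j)"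
  unfolding mul_def by (rule mulk_cong)

lemma mul_Fil: "y \<in> Fil j \<Longrightarrow> mul x y - (x + y) \<in> Fil (Suc j)"
proof -
  assume y: "y \<in> Fil j"
  have i: "(\<lambda>s. Px (mul x (s *\<^sub>R y)) y) integrable_on {0..1}" unfolding mul_def by (rule mulk_integrable)
  have "mul x y - (x + y) = integral {0..1} (\<lambda>s. Px (mul x (s *\<^sub>R y)) y - y)"
    by (subst mul_fixpoint, subst integral_diff[OF i]) auto
  also have "\<dots> \<in> Fil (Suc j)"
    by (rule Fil_integral[OF integrable_diff[OF i] Px_Fil[OF y]]) auto
  finally show ?thesis .
qed

lemma dil_mul: "dil s (mul x y) = mul (dil s x) (dil s y)"
proof -
  have "dil s (mulk k x y) = mulk k (dil s x) (dil s y)" for k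
  proof (induction k arbitrary: y)
    case (Suc k)
    have "dil s (integral {0..1} (\<lambda>u. Px (mulk k x (u *\<^sub>R y)) y)) = integral {0..1} (dil s \<circ> (\<lambda>u. Px (mulk k x (u *\<^sub>R y)) y))"
      by (rule integral_linear[OF mulk_integrable bounded_linear_dil, symmetric])
    then show ?case by (simp add: linear_add[OF linear_dil] o_def dil_Px Suc linear_cmul[OF linear_dil])
  qed simp
  then show ?thesis by (simp add: mul_def)
qed

text \<open>The substitution u = ts: the integral over the fixed interval is that of
  \<open>g\<close> from 0 to \<open>t\<close>, for either sign of \<open>t\<close>. The fixpoint
  equation of \<open>mul\<close> has this form.\<close>

lemma has_vector_derivative_rescaled_integral:
  fixes g :: "real \<Rightarrow> 'v"
  assumes "continuous_on UNIV g"
  shows "((\<lambda>t. integral {0..1} (\<lambda>s. t *\<^sub>R g (t * s))) has_vector_derivative g t) (at t)"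
proof -
  define T where "T = \<bar>t\<bar> + 1"
  define F where "F u = integral {-T..u} g" for u
  have F: "(F has_vector_derivative g u) (at u within {-T..T})" if "u \<in> {-T..T}" for u
    unfolding F_def by (rule integral_has_vector_derivative[OF continuous_on_subset[OF assms]]) (use that in auto)
  have e: "integral {0..1} (\<lambda>s. \<tau> *\<^sub>R g (\<tau> * s)) = F \<tau> - F 0" if \<tau>: "\<tau> \<in> {-T..T}" for \<tau>
  proof -
    have m: "(\<lambda>s. \<tau> * s) ` {0..1} \<subseteq> {-T..T}"
    proof
      fix x assume "x \<in> (\<lambda>s. \<tau> * s) ` {0..1}"
      then obtain s where s: "x = \<tau> * s" "s \<in> {0..1}" by (rule imageE)
      then have "\<bar>x\<bar> \<le> \<bar>\<tau>\<bar>" by (simp add: abs_mult mult_left_le)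
      then show "x \<in> {-T..T}" using \<tau> by auto
    qed
    have "((\<lambda>s. F (\<tau> * s)) has_vector_derivative \<tau> *\<^sub>R g (\<tau> * s)) (at s within {0..1})" if s: "s \<in> {0..1}" for s
    proof -
      have "((\<lambda>s. \<tau> * s) has_vector_derivative \<tau>) (at s within {0..1})" by (auto intro!: derivative_eq_intros)
      moreover have "(F has_vector_derivative g (\<tau> * s)) (at (\<tau> * s) within (\<lambda>s. \<tau> * s) ` {0..1})"
        by (rule has_vector_derivative_within_subset[OF F m]) (use m s in blast)
      ultimately show ?thesis using vector_diff_chain_within[of "\<lambda>s. \<tau> * s" \<tau> s "{0..1}" F] by (simp add: o_def)
    qed
    then have "((\<lambda>s. \<tau> *\<^sub>R g (\<tau> * s)) has_integral (F (\<tau> * 1) - F (\<tau> * 0))) {0..1}"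
      by (intro fundamental_theorem_of_calculus) auto
    from integral_unique[OF this] show ?thesis by simp
  qed
  have "at t within {-T..T} = at t" by (rule at_within_interior) (auto simp: T_def)
  moreover have "t \<in> {-T..T}" by (auto simp: T_def abs_if)
  ultimately have "(F has_vector_derivative g t) (at t)" using F[of t] by simp
  then have "((\<lambda>u. F u - F 0) has_vector_derivative g t) (at t)" by (auto intro!: derivative_eq_intros)
  then show ?thesis
  proof (rule has_vector_derivative_transform_within_open[where S="{-T<..<T}"])
    show "F u - F 0 = integral {0..1} (\<lambda>s. u *\<^sub>R g (u * s))" if "u \<in> {-T<..<T}" for u
      using e[of u] that by simp
  qed (auto simp: T_def)
qed

lemma mul_curve_derivative:
  "((\<lambda>t. mul x (t *\<^sub>R y)) has_vector_derivative Px (mul x (t *\<^sub>R y)) y) (at t)"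
proof -
  have "continuous_on UNIV (\<lambda>t. Px (mul x (t *\<^sub>R y)) y)"
    by (intro continuous_on_Px continuous_on_mul continuous_intros)
  from has_vector_derivative_add[OF has_vector_derivative_const[of x] has_vector_derivative_rescaled_integral[OF this]]
  have "((\<lambda>t. x + integral {0..1} (\<lambda>s. t *\<^sub>R Px (mul x ((t * s) *\<^sub>R y)) y)) has_vector_derivative 0 + Px (mul x (t *\<^sub>R y)) y) (at t)" .
  moreover have "x + integral {0..1} (\<lambda>s. t *\<^sub>R Px (mul x ((t * s) *\<^sub>R y)) y) = mul x (t *\<^sub>R y)" for t
    by (subst mul_fixpoint) (simp add: linear_cmul[OF linear_Px] mult.commute)
  ultimately show ?thesis by simp
qed

lemma mul_0 [simp]: "mul x 0 = x"
  by (subst mul_fixpoint) (simp add: linear_0[OF linear_Px])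

text \<open>Once two solutions agree in the layers below i, triangularity of \<open>Px\<close> makes
  the derivative of their difference vanish in layer i. So uniqueness climbs the filtration.\<close>

lemma mul_curve_unique:
  assumes "\<And>t. (c has_vector_derivative Px (c t) y) (at t)"
  shows "c t = mul (c 0) (t *\<^sub>R y)"
proof -
  let ?d = "\<lambda>t. c t - mul (c 0) (t *\<^sub>R y)"
  have D: "(?d has_vector_derivative Px (c t) y - Px (mul (c 0) (t *\<^sub>R y)) y) (at t)" for t
    by (intro has_vector_derivative_diff assms mul_curve_derivative)
  have "\<forall>t. ?d t \<in> Fil (Suc j)" for j
  proof (induction j)
    case (Suc j)
    show ?case
    proof
      fix t
      have "pr i (?d t) = 0" if i: "i < Suc (Suc j)" for i
      proof -
        have "((\<lambda>t. pr i (?d t)) has_vector_derivative 0) (at t)" for t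
        proof -
          have "Px (c t) y - Px (mul (c 0) (t *\<^sub>R y)) y \<in> Fil (Suc (Suc j))"
            by (rule Px_cong) (use Suc in blast)
          then have "pr i (Px (c t) y - Px (mul (c 0) (t *\<^sub>R y)) y) = 0" using i by (simp add: Fil_def)
          then show ?thesis using bounded_linear.has_vector_derivative[OF bounded_linear_pr D, of i t] by simp
        qed
        from has_vector_derivative_0_const[OF this, of t 0] show ?thesis by (simp add: pr_0)
      qed
      then show "?d t \<in> Fil (Suc (Suc j))" by (simp add: Fil_def)
    qed
  qed simp
  then have "?d t \<in> Fil (Suc r)" by blast
  then show ?thesis using Fil_top[of "Suc r" "?d t"] by simp
qed

lemma mul_add_scaleR: "mul (mul x (s *\<^sub>R y)) (t *\<^sub>R y) = mul x ((s + t) *\<^sub>R y)"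
proof -
  have "((\<lambda>t. mul x ((s + t) *\<^sub>R y)) has_vector_derivative Px (mul x ((s + t) *\<^sub>R y)) y) (at t)" for t
  proof -
    have "((\<lambda>t. s + t) has_vector_derivative 1) (at t)" by (auto intro!: derivative_eq_intros)
    from vector_diff_chain_at[OF this mul_curve_derivative[of x y]] show ?thesis by (simp add: o_def)
  qed
  from mul_curve_unique[OF this, of t] show ?thesis by simp
qed

lemma mul_minus_right [simp]: "mul (mul x y) (- y) = x" "mul (mul x (- y)) y = x"
  using mul_add_scaleR[of x 1 y "-1"] mul_add_scaleR[of x "-1" y 1] by auto

lemma mul_0_left [simp]: "mul 0 y = y"
proof -
  have "((\<lambda>t. t *\<^sub>R y) has_vector_derivative Px (t *\<^sub>R y) y) (at t)" for t
    by (subst Px_commuting) (auto simp: br_scale_left intro!: derivative_eq_intros)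
  from mul_curve_unique[OF this, of 1] show ?thesis by simp
qed

lemma E_mul: "E (mul x y) = E x + E y"
  using exp_curve_eq[of "\<lambda>t. mul x (t *\<^sub>R y)" "\<lambda>t. Px (mul x (t *\<^sub>R y)) y" y 1, OF mul_curve_derivative dexp_Px]
  by simp

end

section \<open>Invariance of Lebesgue measure\<close>

lemma countable_net_subset:
  fixes X :: "'a::{metric_space, second_countable_topology} set"
  assumes "e > 0" "X \<noteq> {}"
  obtains d :: "nat \<Rightarrow> 'a" where "\<And>k. d k \<in> X" "\<And>x. x \<in> X \<Longrightarrow> \<exists>k. dist x (d k) < e"
proof -
  obtain D :: "'a set" where D: "countable D" "\<And>Y. open Y \<Longrightarrow> Y \<noteq> {} \<Longrightarrow> \<exists>d\<in>D. d \<in> Y"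
    by (rule countable_dense_setE) blast
  obtain x0 where x0: "x0 \<in> X" using assms by auto
  define p where "p d = (if \<exists>x\<in>X. dist d x < e / 2 then SOME x. x \<in> X \<and> dist d x < e / 2 else x0)" for d
  have p: "p d \<in> X" "(\<exists>x\<in>X. dist d x < e / 2) \<Longrightarrow> dist d (p d) < e / 2" for d
  proof -
    have "p d \<in> X \<and> dist d (p d) < e / 2" if "\<exists>x\<in>X. dist d x < e / 2"
      using that someI_ex[of "\<lambda>x. x \<in> X \<and> dist d x < e / 2"] unfolding p_def by auto
    then show "p d \<in> X" "(\<exists>x\<in>X. dist d x < e / 2) \<Longrightarrow> dist d (p d) < e / 2"
      using x0 by (auto simp: p_def)
  qed
  show ?thesis
  proof (rule that[of "\<lambda>k. p (from_nat_into D k)"])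
    fix x assume x: "x \<in> X"
    obtain d where d: "d \<in> D" "d \<in> ball x (e / 2)" using D(2)[of "ball x (e / 2)"] assms(1) by auto
    obtain k where k: "from_nat_into D k = d" using from_nat_into_surj[OF D(1) d(1)] by blast
    have "\<exists>x\<in>X. dist d x < e / 2" using x d(2) by (intro bexI[of _ x]) (auto simp: dist_commute)
    then have "dist d (p d) < e / 2" by (rule p(2))
    then have "dist x (p d) < e" using d(2) dist_triangle_half_r[of d x e "p d"] by (auto simp: dist_commute)
    then show "\<exists>k. dist x (p (from_nat_into D k)) < e" using k by blast
  qed (use p in auto)
qed

lemma emeasure_lborel_translate:
  fixes c :: "'a::euclidean_space"
  assumes "X \<in> sets borel" shows "emeasure lborel {x. x + c \<in> X} = emeasure lborel X"
proof -
  have "emeasure lborel X = emeasure (distr lborel borel ((+) c)) X" by (simp add: lborel_distr_plus)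
  also have "\<dots> = emeasure lborel {x. x + c \<in> X}"
    using assms by (subst emeasure_distr) (auto simp: vimage_def add.commute)
  finally show ?thesis by simp
qed

text \<open>As \<open>h\<close> is merely continuous, there is no Jacobian. The space is cut into
  countably many \<open>W\<close>-invariant Borel pieces on which \<open>h\<close> is nearly
  constant; on each of them the shear is within \<open>e\<close> of a translation along
  \<open>W\<close>, which preserves both the piece and the measure. So the preimage is no larger
  than the \<open>e\<close>-neighbourhood of \<open>A\<close>, and \<open>e\<close> tends to
  0.\<close>

lemma shear_emeasure_le:
  fixes h :: "'a::euclidean_space \<Rightarrow> 'a"
  assumes W: "subspace W" and h: "continuous_on UNIV h" "\<And>x. h x \<in> W" "\<And>x w. w \<in> W \<Longrightarrow> h (x + w) = h x"
    and A: "compact A"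
  shows "emeasure lborel {x. x + h x \<in> A} \<le> emeasure lborel A"
proof (cases "A = {}")
  case False
  have hm [measurable]: "h \<in> borel_measurable borel" using h(1) by (rule borel_measurable_continuous_onI)
  have cA: "closed A" using A by (rule compact_imp_closed)
  have Am [measurable]: "A \<in> sets borel" using cA by simp
  define Ae where "Ae e = {y. infdist y A \<le> e}" for e
  have Aem [measurable]: "Ae e \<in> sets borel" for e
    unfolding Ae_def by (intro borel_closed closed_Collect_le continuous_intros)
  have le: "emeasure lborel {x. x + h x \<in> A} \<le> emeasure lborel (Ae e)" if e: "e > 0" for e
  proof -
    have "W \<noteq> {}" using subspace_0[OF W] by blast
    then obtain d :: "nat \<Rightarrow> 'a" where d: "\<And>k. d k \<in> W" "\<And>x. x \<in> W \<Longrightarrow> \<exists>k. dist x (d k) < e"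
      by (rule countable_net_subset[OF e]) (rule that)
    define C where "C k = {x. dist (h x) (d k) < e}" for k :: nat
    have Cm: "range C \<subseteq> sets borel" unfolding C_def by (auto intro!: borel_measurable_less)
    define B where "B = disjointed C"
    have Bm [measurable]: "B k \<in> sets borel" for k
      using sets.range_disjointed_sets[OF Cm] by (auto simp: B_def)
    have BU: "(\<Union>k. B k) = UNIV" using d(2)[OF h(2)] by (auto simp: B_def UN_disjointed_eq C_def)
    have Bd: "disjoint_family B" unfolding B_def by (rule disjoint_family_disjointed)
    have BC: "B k \<subseteq> C k" for k unfolding B_def by (rule disjointed_subset)
    have Bi: "x + w \<in> B k \<longleftrightarrow> x \<in> B k" if "w \<in> W" for x w k
      using h(3)[OF that] by (simp add: B_def disjointed_def C_def)
    have "emeasure lborel {x. x + h x \<in> A} = emeasure lborel (\<Union>k. B k \<inter> {x. x + h x \<in> A})"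
      by (rule arg_cong[where f = "emeasure lborel"]) (use BU in auto)
    also have "\<dots> = (\<Sum>k. emeasure lborel (B k \<inter> {x. x + h x \<in> A}))"
      using Bd by (intro suminf_emeasure[symmetric]) (auto simp: disjoint_family_on_def)
    also have "\<dots> \<le> (\<Sum>k. emeasure lborel {x. x + d k \<in> B k \<inter> Ae e})"
    proof (intro suminf_le allI)
      fix k
      have "x + d k \<in> B k \<inter> Ae e" if x: "x \<in> B k" "x + h x \<in> A" for x
      proof -
        have "dist (x + d k) (x + h x) < e" using BC[of k] x(1) by (auto simp: C_def dist_norm norm_minus_commute)
        then have "infdist (x + d k) A \<le> e" using infdist_le2[OF x(2), of "x + d k" e] by simp
        then show ?thesis using x Bi[OF d(1)] by (simp add: Ae_def)
      qed
      then show "emeasure lborel (B k \<inter> {x. x + h x \<in> A}) \<le> emeasure lborel {x. x + d k \<in> B k \<inter> Ae e}"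
        by (intro emeasure_mono) auto
    qed auto
    also have "\<dots> = (\<Sum>k. emeasure lborel (B k \<inter> Ae e))"
      by (intro suminf_cong emeasure_lborel_translate) auto
    also have "\<dots> = emeasure lborel (\<Union>k. B k \<inter> Ae e)"
      using Bd by (intro suminf_emeasure) (auto simp: disjoint_family_on_def)
    also have "(\<Union>k. B k \<inter> Ae e) = Ae e" using BU by auto
    finally show ?thesis .
  qed
  have Ab: "bounded (Ae e)" for e
  proof -
    obtain R where R: "\<And>x. x \<in> A \<Longrightarrow> norm x \<le> R" using A compact_imp_bounded bounded_iff by metis
    have "norm y \<le> R + e + 1" if "y \<in> Ae e" for y
    proof -
      have "infdist y A < e + 1" using that by (simp add: Ae_def)
      then obtain a where "a \<in> A" "dist y a < e + 1"
        using infdist_notempty[OF False, of y] cInf_lessD[of "(dist y) ` A"] False by auto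
      then show ?thesis using R[of a] norm_triangle_sub[of y a] by (simp add: dist_norm)
    qed
    then show ?thesis by (auto simp: bounded_iff)
  qed
  have "(\<lambda>n. emeasure lborel (Ae (1 / real (Suc n)))) \<longlonglongrightarrow> emeasure lborel (\<Inter>n. Ae (1 / real (Suc n)))"
  proof (rule Lim_emeasure_decseq)
    show "decseq (\<lambda>n. Ae (1 / real (Suc n)))"
      by (rule decseq_SucI) (auto simp: Ae_def intro: order_trans[OF _ divide_left_mono])
    show "emeasure lborel (Ae (1 / real (Suc n))) \<noteq> \<infinity>" for n
      using emeasure_bounded_finite[OF Ab, of "1 / real (Suc n)"] by simp
  qed auto
  moreover have "(\<Inter>n. Ae (1 / real (Suc n))) = A"
  proof
    show "A \<subseteq> (\<Inter>n. Ae (1 / real (Suc n)))" by (auto simp: Ae_def)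
    show "(\<Inter>n. Ae (1 / real (Suc n))) \<subseteq> A"
    proof
      fix y assume y: "y \<in> (\<Inter>n. Ae (1 / real (Suc n)))"
      have "infdist y A \<le> 0"
      proof (rule field_le_epsilon)
        fix e :: real assume "e > 0"
        then obtain n where "1 / real (Suc n) < e" using nat_approx_posE by blast
        then show "infdist y A \<le> 0 + e" using y by (auto simp: Ae_def intro: order_trans[OF _ less_imp_le])
      qed
      then have "infdist y A = 0" using infdist_nonneg[of y A] by linarith
      then show "y \<in> A" using in_closed_iff_infdist_zero[OF cA False] by simp
    qed
  qed
  ultimately have "(\<lambda>n. emeasure lborel (Ae (1 / real (Suc n)))) \<longlonglongrightarrow> emeasure lborel A" by simp
  then show ?thesis by (rule LIMSEQ_le_const) (auto intro!: exI[of _ 0] le)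
qed simp

lemma lborel_eqI_compact:
  fixes M :: "'a::euclidean_space measure"
  assumes s: "sets M = sets borel" and c: "\<And>A. compact A \<Longrightarrow> emeasure M A = emeasure lborel A"
  shows "M = lborel"
proof (rule lborel_eqI[symmetric])
  fix l u :: 'a assume lu: "\<And>b. b \<in> Basis \<Longrightarrow> l \<bullet> b \<le> u \<bullet> b"
  have "\<exists>C. (\<forall>n. compact (C n)) \<and> (\<forall>n. C n \<subseteq> interior (C (Suc n))) \<and> \<Union>(range C) = box l u"
  proof (rule open_Union_compact_subsets[OF open_box[of l u]])
    fix C :: "nat \<Rightarrow> 'a set"
    assume C: "\<And>n. compact (C n)" "\<And>n. C n \<subseteq> interior (C (Suc n))" "\<Union>(range C) = box l u"
    show ?thesis by (intro exI[of _ C] conjI allI C)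
  qed
  then obtain C :: "nat \<Rightarrow> 'a set" where C: "\<And>n. compact (C n)" "\<And>n. C n \<subseteq> interior (C (Suc n))" "\<Union>(range C) = box l u"
    by blast
  have m: "C n \<in> sets borel" for n using borel_compact[OF C(1)] .
  have i: "incseq C" by (intro incseq_SucI) (rule subset_trans[OF C(2) interior_subset])
  have "emeasure M (box l u) = (SUP n. emeasure M (C n))"
    using SUP_emeasure_incseq[OF _ i, of M] m s C(3) by (simp add: image_subset_iff)
  also have "\<dots> = (SUP n. emeasure lborel (C n))" using c[OF C(1)] by simp
  also have "\<dots> = emeasure lborel (box l u)" using SUP_emeasure_incseq[OF _ i, of lborel] m C(3) by (simp add: image_subset_iff)
  finally show "emeasure M (box l u) = (\<Prod>b\<in>Basis. (u - l) \<bullet> b)" using lu by (simp add: emeasure_lborel_box)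
qed (use s in simp)

text \<open>The inverse of the shear by \<open>g\<close> is the shear by \<open>- g\<close>, so the
  inequality for compact sets holds in both directions.\<close>

lemma shear_preserves_lborel:
  fixes g :: "'a::euclidean_space \<Rightarrow> 'a"
  assumes W: "subspace W" and g: "continuous_on UNIV g" "\<And>x. g x \<in> W" "\<And>x w. w \<in> W \<Longrightarrow> g (x + w) = g x"
  shows "distr lborel borel (\<lambda>x. x + g x) = lborel"
proof (rule lborel_eqI_compact)
  fix A :: "'a set" assume A: "compact A"
  have gm [measurable]: "g \<in> borel_measurable borel" using g(1) by (rule borel_measurable_continuous_onI)
  have Am [measurable]: "A \<in> sets borel" by (rule borel_compact[OF A])
  have inv: "g (x - g x) = g x" "g (x + g x) = g x" for x
    using g(3)[OF subspace_neg[OF W g(2)], of x x] g(3)[OF g(2), of x x] by auto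
  define A' where "A' = {x. x + g x \<in> A}"
  have "A' = (\<lambda>y. y - g y) ` A"
  proof
    show "A' \<subseteq> (\<lambda>y. y - g y) ` A"
    proof
      fix x assume "x \<in> A'"
      then have "x = (x + g x) - g (x + g x)" "x + g x \<in> A" using inv by (auto simp: A'_def)
      then show "x \<in> (\<lambda>y. y - g y) ` A" by (rule image_eqI)
    qed
  qed (auto simp: A'_def inv)
  then have A': "compact A'"
    using A g(1) by (auto intro!: compact_continuous_image continuous_intros intro: continuous_on_subset)
  have "emeasure lborel A' \<le> emeasure lborel A"
    unfolding A'_def by (rule shear_emeasure_le[OF W g A])
  moreover have "emeasure lborel {x. x + (- g x) \<in> A'} \<le> emeasure lborel A'"
    by (rule shear_emeasure_le[OF W _ _ _ A']) (use g subspace_neg[OF W] in \<open>auto intro!: continuous_intros\<close>)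
  moreover have "{x. x + (- g x) \<in> A'} = A" by (auto simp: A'_def inv)
  ultimately have "emeasure lborel A' = emeasure lborel A" by simp
  then show "emeasure (distr lborel borel (\<lambda>x. x + g x)) A = emeasure lborel A"
    by (subst emeasure_distr) (auto simp: vimage_def A'_def)
qed simp

text \<open>Integrate the indicator of \<open>X\<close> at x times that of the unit cube at x + y
  against both measures. Invariance of Lebesgue measure evaluates the integral in one order,
  invariance of \<open>M\<close> in the other.\<close>

lemma translation_invariant_eq_lborel:
  fixes M :: "'a::euclidean_space measure"
  assumes s [measurable_cong]: "sets M = sets borel" and "sigma_finite_measure M"
    and inv: "\<And>c. distr M borel (\<lambda>x. x + c) = M"
    and X [measurable]: "X \<in> sets borel"
  shows "emeasure M X = emeasure M (cbox 0 One) * emeasure lborel X"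
proof -
  interpret M: sigma_finite_measure M by fact
  interpret P: pair_sigma_finite lborel M by unfold_locales
  let ?B = "cbox 0 One :: 'a set"
  have One: "emeasure lborel ?B = 1" by (simp add: emeasure_lborel_cbox inner_diff_left)
  have tr: "(\<integral>\<^sup>+y. indicator X (x - y) \<partial>lborel) = emeasure lborel X" for x
  proof -
    have "lborel = density (distr lborel borel (\<lambda>y. x - y)) (\<lambda>_. 1)"
      using lborel_affine[of "-1" x] by simp
    then have "distr lborel borel (\<lambda>y. x - y) = lborel" by (simp add: density_1)
    moreover have "(\<integral>\<^sup>+y. indicator X (x - y) \<partial>lborel) = (\<integral>\<^sup>+y. indicator X y \<partial>distr lborel borel (\<lambda>y. x - y))"
      by (rule nn_integral_distr[symmetric]) auto
    ultimately show ?thesis by simp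
  qed
  have tl: "(\<integral>\<^sup>+y. indicator ?B (x + y) \<partial>lborel) = 1" for x
  proof -
    have "(\<integral>\<^sup>+y. indicator ?B (x + y) \<partial>lborel) = (\<integral>\<^sup>+y. indicator ?B y \<partial>distr lborel borel ((+) x))"
      by (rule nn_integral_distr[symmetric]) auto
    then show ?thesis by (simp add: lborel_distr_plus One)
  qed
  have "emeasure M X = (\<integral>\<^sup>+x. indicator X x * (\<integral>\<^sup>+y. indicator ?B (x + y) \<partial>lborel) \<partial>M)" by (simp add: tl s)
  also have "\<dots> = (\<integral>\<^sup>+x. (\<integral>\<^sup>+y. indicator X x * indicator ?B (x + y) \<partial>lborel) \<partial>M)"
    by (intro nn_integral_cong nn_integral_cmult[symmetric]) auto
  also have "\<dots> = (\<integral>\<^sup>+y. (\<integral>\<^sup>+x. indicator X x * indicator ?B (x + y) \<partial>M) \<partial>lborel)"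
    by (rule P.Fubini') measurable
  also have "\<dots> = (\<integral>\<^sup>+y. (\<integral>\<^sup>+x. indicator X (x - y) * indicator ?B x \<partial>M) \<partial>lborel)"
  proof (rule nn_integral_cong)
    fix y
    have "(\<integral>\<^sup>+x. indicator X (x - y) * indicator ?B x \<partial>M) = (\<integral>\<^sup>+x. indicator X (x - y) * indicator ?B x \<partial>distr M borel (\<lambda>x. x + y))"
      by (simp add: inv)
    also have "\<dots> = (\<integral>\<^sup>+x. indicator X x * indicator ?B (x + y) \<partial>M)" by (simp add: nn_integral_distr)
    finally show "(\<integral>\<^sup>+x. indicator X x * indicator ?B (x + y) \<partial>M) = (\<integral>\<^sup>+x. indicator X (x - y) * indicator ?B x \<partial>M)" by simp
  qed
  also have "\<dots> = (\<integral>\<^sup>+x. (\<integral>\<^sup>+y. indicator X (x - y) * indicator ?B x \<partial>lborel) \<partial>M)"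
    by (rule P.Fubini'[symmetric]) measurable
  also have "\<dots> = (\<integral>\<^sup>+x. emeasure lborel X * indicator ?B x \<partial>M)"
    by (intro nn_integral_cong) (simp add: nn_integral_multc tr)
  also have "\<dots> = emeasure M ?B * emeasure lborel X" by (simp add: nn_integral_cmult s mult.commute)
  finally show ?thesis .
qed

text \<open>The image measure is translation invariant, hence a multiple of Lebesgue measure.
  Existence of the factor is enough, as it cancels in \<open>dil_emeasure\<close>.\<close>

lemma linear_emeasure_lborel:
  fixes T :: "'a::euclidean_space \<Rightarrow> 'a"
  assumes T: "linear T" "bij T"
  obtains c where "0 < c" "c < \<infinity>" "\<And>X. X \<in> sets borel \<Longrightarrow> emeasure lborel (T -` X) = c * emeasure lborel X"
proof -
  obtain T' where T': "linear T'" "\<And>x. T' (T x) = x" "\<And>x. T (T' x) = x"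
    using linear_injective_isomorphism[OF T(1)] T(2) bij_is_inj by metis
  have Tc: "continuous_on UNIV T" "continuous_on UNIV T'"
    using T(1) T'(1) by (auto intro: linear_continuous_on simp: linear_conv_bounded_linear)
  have Tm [measurable]: "T \<in> borel_measurable borel" using Tc(1) by (rule borel_measurable_continuous_onI)
  define M where "M = distr lborel borel T"
  have sM: "sets M = sets borel" by (simp add: M_def)
  have Me: "emeasure M X = emeasure lborel (T -` X)" if "X \<in> sets borel" for X
    unfolding M_def using that by (subst emeasure_distr) auto
  have vim: "T -` X = T' ` X" for X using T' by (auto simp: image_iff) metis
  have bd: "bounded (T -` X)" if "bounded X" for X
    unfolding vim using that T'(1) by (intro bounded_linear_image) (auto simp: linear_conv_bounded_linear)
  have sf: "sigma_finite_measure M"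
  proof
    show "\<exists>A. countable A \<and> A \<subseteq> sets M \<and> \<Union> A = space M \<and> (\<forall>a\<in>A. emeasure M a \<noteq> \<infinity>)"
    proof (intro exI[of _ "range (\<lambda>n::nat. cball 0 (real n))"] conjI ballI)
      have "\<exists>n. norm x \<le> real n" for x :: 'a by (rule real_arch_simple)
      then show "\<Union> (range (\<lambda>n. cball 0 (real n))) = space M" by (auto simp: M_def)
      fix a assume "a \<in> range (\<lambda>n::nat. cball (0::'a) (real n))"
      then obtain n :: nat where a: "a = cball 0 (real n)" by auto
      show "emeasure M a \<noteq> \<infinity>"
        unfolding a using emeasure_bounded_finite[OF bd[OF bounded_cball[of 0 "real n"]]] by (subst Me) auto
    qed (auto simp: M_def)
  qed
  have inv: "distr M borel (\<lambda>x. x + c) = M" for c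
  proof -
    have "distr M borel (\<lambda>x. x + c) = distr lborel borel (\<lambda>x. T x + c)"
      unfolding M_def by (subst distr_distr) (auto simp: o_def)
    also have "\<dots> = distr (distr lborel borel (\<lambda>x. x + T' c)) borel T"
      by (subst distr_distr) (auto simp: o_def linear_add[OF T(1)] T')
    also have "distr lborel borel (\<lambda>x. x + T' c) = lborel"
      using lborel_distr_plus[of "T' c"] by (simp add: add.commute[of _ "T' c"])
    finally show ?thesis by (simp add: M_def)
  qed
  note eq = translation_invariant_eq_lborel[OF sM sf inv]
  let ?c = "emeasure M (cbox 0 One)"
  show ?thesis
  proof (rule that[of ?c])
    show "?c < \<infinity>" using emeasure_bounded_finite[OF bd[OF bounded_cbox[of 0 One]]] by (subst Me) auto
    have "emeasure M UNIV = \<infinity>" by (subst Me) (auto simp: emeasure_lborel_UNIV)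
    then have "?c \<noteq> 0" using eq[of UNIV] by auto
    then show "0 < ?c" by (simp add: zero_less_iff_neq_zero)
    show "emeasure lborel (T -` X) = ?c * emeasure lborel X" if "X \<in> sets borel" for X
      using eq[OF that] Me[OF that] by simp
  qed
qed

context stratified_lie_group
begin

text \<open>The components of \<open>G\<close> are added one layer at a time, from the top layer
  down. Component k of \<open>G\<close> depends only on layers below k, so the corrections already
  made do not disturb it, and each addition is a shear along \<open>V k\<close>.\<close>

lemma mul_right_preserves_lborel: "distr lborel borel (\<lambda>x. mul x y) = lborel"
proof -
  define G where "G x = mul x y - x" for x
  have Gc: "continuous_on UNIV G" unfolding G_def by (intro continuous_on_diff continuous_on_mul continuous_intros)
  have Gcong: "pr k (G x) = pr k (G x')" if "x - x' \<in> Fil k" for k x x'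
  proof -
    have "(mul x y - mul x' y) - (x - x') \<in> Fil (Suc k)" by (rule mul_cong[OF that])
    then have "pr k (G x - G x') = 0" by (simp add: Fil_def G_def algebra_simps)
    then show ?thesis by (simp add: pr_diff)
  qed
  \<comment> \<open>Interpolates between the identity at k = r + 1 and the translation at k =
    1.\<close>
  define T where "T k x = x + (\<Sum>j\<in>{k..r}. pr j (G x))" for k x
  have prG: "continuous_on UNIV (\<lambda>x. pr j (G x))" for j
    by (rule bounded_linear.continuous_on[OF bounded_linear_pr Gc])
  have Tm: "T k \<in> borel_measurable borel" for k
    unfolding T_def by (intro borel_measurable_continuous_onI continuous_intros prG)
  have step: "distr lborel borel (\<lambda>x. x + pr k (G x)) = lborel" if k: "k \<in> {1..r}" for k
  proof (rule shear_preserves_lborel[OF V_subspace[OF k] prG pr_in[OF k]])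
    fix x w assume "w \<in> V k"
    then have "w \<in> Fil k" using k by (intro W_Fil[of w k k]) (auto simp: W_def)
    then show "pr k (G (x + w)) = pr k (G x)" by (intro Gcong) simp
  qed
  have rec: "T k x = T (Suc k) x + pr k (G (T (Suc k) x))" if k: "k \<le> r" for k x
  proof -
    have "T (Suc k) x - x \<in> Fil k"
      unfolding T_def by (simp, intro Fil_sum W_Fil[OF pr_in_W]) auto
    then have "pr k (G (T (Suc k) x)) = pr k (G x)" by (rule Gcong)
    moreover have "{k..r} = insert k {Suc k..r}" using k by auto
    ultimately show ?thesis by (simp add: T_def)
  qed
  have "distr lborel borel (T (Suc r - i)) = lborel" if "i \<le> r" for i
    using that
  proof (induction i)
    case 0
    have "T (Suc r) = (\<lambda>x. x)" by (simp add: T_def fun_eq_iff)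
    then show ?case using distr_id2[of borel lborel] by simp
  next
    case (Suc i)
    define k where "k = r - i"
    have k: "k \<in> {1..r}" "Suc r - Suc i = k" "Suc r - i = Suc k" using Suc.prems by (auto simp: k_def)
    have gm: "(\<lambda>x. x + pr k (G x)) \<in> borel_measurable borel"
      by (intro borel_measurable_continuous_onI continuous_intros prG)
    have Tk: "T k = (\<lambda>x. x + pr k (G x)) \<circ> T (Suc k)" using rec[of k] k(1) by (auto simp: fun_eq_iff)
    have "distr lborel borel (T k) = distr (distr lborel borel (T (Suc k))) borel (\<lambda>x. x + pr k (G x))"
      unfolding Tk by (rule distr_distr[symmetric]) (use gm Tm in auto)
    also have "distr lborel borel (T (Suc k)) = lborel" using Suc k by simp
    finally show ?case using step[OF k(1)] k by simp
  qed
  from this[of r] have "distr lborel borel (T 1) = lborel" by (simp add: One_nat_def)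
  moreover have "T 1 = (\<lambda>x. mul x y)" by (simp add: T_def pr_sum G_def fun_eq_iff)
  ultimately show ?thesis by simp
qed

text \<open>In a basis adapted to the layers the dilation is diagonal, with \<open>dim (V j)\<close>
  entries s^j, whose product is s^Q. The layers may fail to be orthogonal, so a linear change of
  basis \<open>T\<close> comes in; its factor \<open>c\<close> cancels.\<close>

lemma dil_emeasure:
  assumes s: "s > 0" and X [measurable]: "X \<in> sets borel"
  shows "ennreal (s ^ homogeneous_dimension r V) * emeasure lborel (dil s -` X) = emeasure lborel X"
proof -
  have "\<forall>j. \<exists>B. j \<in> {1..r} \<longrightarrow> B \<subseteq> V j \<and> independent B \<and> V j \<subseteq> span B \<and> card B = dim (V j)"
    using basis_exists by metis
  then obtain B where B: "\<And>j. j \<in> {1..r} \<Longrightarrow> B j \<subseteq> V j" "\<And>j. j \<in> {1..r} \<Longrightarrow> independent (B j)"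
     "\<And>j. j \<in> {1..r} \<Longrightarrow> V j \<subseteq> span (B j)" "\<And>j. j \<in> {1..r} \<Longrightarrow> card (B j) = dim (V j)" by metis
  define U where "U = (\<Union>j\<in>{1..r}. B j)"
  have fB: "finite (B j)" if "j \<in> {1..r}" for j using B(2)[OF that] independent_explicit by blast
  have fU: "finite U" unfolding U_def using fB by blast
  have nz: "b \<noteq> 0" if "b \<in> B j" "j \<in> {1..r}" for b j using B(2)[OF that(2)] that(1) dependent_zero by blast
  have prB: "pr i b = (if i = j then b else 0)" if "b \<in> B j" "j \<in> {1..r}" for b i j
    using pr_V[of b j i] B(1) that by blast
  have disj: "i = j" if "b \<in> B i" "b \<in> B j" "i \<in> {1..r}" "j \<in> {1..r}" for b i j
    using prB[OF that(1,3), of i] prB[OF that(2,4), of i] nz[OF that(1,3)] by (auto split: if_splits)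
  define wt where "wt b = (THE j. j \<in> {1..r} \<and> b \<in> B j)" for b
  have wt: "wt b = j" if "b \<in> B j" "j \<in> {1..r}" for b j
    unfolding wt_def using that disj by (intro the_equality) auto
  have sumU: "(\<Sum>b\<in>U. F b) = (\<Sum>j\<in>{1..r}. \<Sum>b\<in>B j. F b)" for F :: "'v \<Rightarrow> 'z::comm_monoid_add"
    unfolding U_def using fB disj by (intro sum.UNION_disjoint) auto
  have ind: "independent U"
    unfolding independent_explicit
  proof (intro conjI fU allI impI ballI)
    fix c v assume c: "(\<Sum>v\<in>U. c v *\<^sub>R v) = 0" and v: "v \<in> U"
    obtain j where j: "j \<in> {1..r}" "v \<in> B j" using v by (auto simp: U_def)
    have "0 = pr j (\<Sum>v\<in>U. c v *\<^sub>R v)" by (simp add: c pr_0)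
    also have "\<dots> = (\<Sum>i\<in>{1..r}. \<Sum>b\<in>B i. c b *\<^sub>R pr j b)" by (simp only: sumU pr_linear_sum pr_scale)
    also have "\<dots> = (\<Sum>i\<in>{1..r}. if i = j then (\<Sum>b\<in>B j. c b *\<^sub>R b) else 0)"
      using prB by (intro sum.cong refl) (auto intro!: sum.neutral)
    also have "\<dots> = (\<Sum>b\<in>B j. c b *\<^sub>R b)" using j by simp
    finally have "(\<Sum>b\<in>B j. c b *\<^sub>R b) = 0" by simp
    then show "c v = 0" using B(2)[OF j(1)] j(2) unfolding independent_explicit by blast
  qed
  have "span U = UNIV"
  proof -
    have "x \<in> span U" for x
    proof -
      have "pr j x \<in> span U" if "j \<in> {1..r}" for j
      proof -
        have "pr j x \<in> span (B j)" using pr_in[OF that] B(3)[OF that] by blast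
        moreover have "span (B j) \<subseteq> span U" by (rule span_mono) (use that in \<open>auto simp: U_def\<close>)
        ultimately show ?thesis by blast
      qed
      then have "(\<Sum>j=1..r. pr j x) \<in> span U" by (intro span_sum) auto
      then show ?thesis by (simp add: pr_sum)
    qed
    then show ?thesis by auto
  qed
  then have cU: "card U = DIM('v)" using dim_eq_card[OF _ ind, of UNIV] by simp
  obtain \<kappa> where \<kappa>: "bij_betw \<kappa> (Basis :: 'v set) U"
    using finite_same_card_bij[OF finite_Basis fU] cU by auto
  define T where "T x = (\<Sum>b\<in>Basis. (x \<bullet> b) *\<^sub>R \<kappa> b)" for x
  have Tl: "linear T" unfolding T_def by (auto intro!: linearI simp: inner_add_left scaleR_add_left sum.distrib scaleR_sum_right)
  have "inj T"
  proof (rule linear_injective_0[OF Tl, THEN iffD2], intro allI impI)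
    fix x assume "T x = 0"
    define c where "c v = x \<bullet> inv_into Basis \<kappa> v" for v
    have "(\<Sum>v\<in>U. c v *\<^sub>R v) = T x"
      unfolding T_def c_def sum.reindex_bij_betw[OF \<kappa>, symmetric]
      using bij_betw_imp_inj_on[OF \<kappa>] by (intro sum.cong) auto
    then have "(\<Sum>v\<in>U. c v *\<^sub>R v) = 0" using \<open>T x = 0\<close> by simp
    then have "c v = 0" if "v \<in> U" for v using ind that unfolding independent_explicit by blast
    then have "x \<bullet> b = 0" if "b \<in> Basis" for b
      using that bij_betw_imp_inj_on[OF \<kappa>] bij_betwE[OF \<kappa>] by (metis c_def inv_into_f_f)
    then show "x = 0" by (simp add: euclidean_eq_iff[of x 0])
  qed
  then have Tb: "bij T" using linear_inj_imp_surj[OF Tl] by (simp add: bij_def)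
  obtain c where c: "0 < c" "c < \<infinity>" "\<And>X. X \<in> sets borel \<Longrightarrow> emeasure lborel (T -` X) = c * emeasure lborel X"
    using linear_emeasure_lborel[OF Tl Tb] by blast
  \<comment> \<open>The summand 0 gives \<open>D\<close> the affine shape of
    \<open>lborel_affine_euclidean\<close>.\<close>
  define D where "D x = 0 + (\<Sum>b\<in>Basis. (s ^ wt (\<kappa> b) * (x \<bullet> b)) *\<^sub>R b)" for x
  have lT [measurable]: "T \<in> borel_measurable borel" "dil s \<in> borel_measurable borel"
    using Tl linear_dil
    by (auto intro!: borel_measurable_continuous_onI linear_continuous_on simp: linear_conv_bounded_linear)
  have [measurable]: "D \<in> borel_measurable borel" by (simp add: D_def[abs_def])
  have DT: "dil s (T x) = T (D x)" for x
  proof -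
    have "dil s (\<kappa> b) = s ^ wt (\<kappa> b) *\<^sub>R \<kappa> b" if "b \<in> Basis" for b
    proof -
      have "\<kappa> b \<in> U" using that bij_betwE[OF \<kappa>] by blast
      then obtain j where j: "j \<in> {1..r}" "\<kappa> b \<in> B j" by (auto simp: U_def)
      then have "\<kappa> b \<in> W j" using B(1) by (auto simp: W_def)
      then show ?thesis using dil_W wt[OF j(2,1)] by simp
    qed
    moreover have "D x \<bullet> b = s ^ wt (\<kappa> b) * (x \<bullet> b)" if "b \<in> Basis" for b
      using that by (simp add: D_def)
    ultimately show ?thesis by (simp add: T_def linear_sum[OF linear_dil] linear_cmul[OF linear_dil] mult.commute)
  qed
  have "(\<Sum>b\<in>Basis. wt (\<kappa> b)) = (\<Sum>v\<in>U. wt v)" by (rule sum.reindex_bij_betw[OF \<kappa>])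
  also have "\<dots> = (\<Sum>j\<in>{1..r}. \<Sum>b\<in>B j. j)" unfolding sumU by (intro sum.cong refl) (auto simp: wt)
  also have "\<dots> = homogeneous_dimension r V"
    unfolding homogeneous_dimension_def by (intro sum.cong refl) (auto simp: B(4))
  finally have Q: "(\<Prod>b\<in>Basis. \<bar>s ^ wt (\<kappa> b)\<bar>) = s ^ homogeneous_dimension r V"
    using s by (simp add: power_sum[symmetric])
  have lD: "emeasure lborel Y = ennreal (s ^ homogeneous_dimension r V) * emeasure lborel (D -` Y)" if Y: "Y \<in> sets borel" for Y
  proof -
    have "lborel = density (distr lborel borel D) (\<lambda>_. ennreal (\<Prod>b\<in>Basis. \<bar>s ^ wt (\<kappa> b)\<bar>))"
      unfolding D_def[abs_def] by (rule lborel_affine_euclidean) (use s in auto)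
    then have "emeasure lborel Y = emeasure (density (distr lborel borel D) (\<lambda>_. ennreal (s ^ homogeneous_dimension r V))) Y"
      unfolding Q by (rule arg_cong)
    then show ?thesis using Y by (simp add: emeasure_density nn_integral_cmult emeasure_distr)
  qed
  have m: "dil s -` X \<in> sets borel" "T -` X \<in> sets borel"
    using measurable_sets[OF lT(2) X] measurable_sets[OF lT(1) X] by auto
  have "c * (ennreal (s ^ homogeneous_dimension r V) * emeasure lborel (dil s -` X))
      = ennreal (s ^ homogeneous_dimension r V) * emeasure lborel (T -` (dil s -` X))"
    using c(3)[OF m(1)] by (simp add: mult_ac)
  also have "T -` (dil s -` X) = D -` (T -` X)" using DT by auto
  also have "ennreal (s ^ homogeneous_dimension r V) * emeasure lborel (D -` (T -` X)) = c * emeasure lborel X"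
    using lD[OF m(2)] c(3)[OF X] by simp
  finally show ?thesis
    using c(1,2) by (metis ennreal_mult_cancel_left less_irrefl infinity_ennreal_def not_less_zero)
qed

end

section \<open>Horizontal paths and test functions\<close>

context stratified_lie_group
begin

lemma dil_Fil: "x \<in> Fil j \<Longrightarrow> dil s x \<in> Fil j"
  by (simp add: Fil_def pr_dil)

lemma emeasure_mul_right:
  assumes "X \<in> sets borel" shows "emeasure lborel {x. mul x y \<in> X} = emeasure lborel X"
proof -
  have "(\<lambda>x. mul x y) \<in> borel_measurable borel"
    by (intro borel_measurable_continuous_onI continuous_on_mul continuous_intros)
  then have "emeasure (distr lborel borel (\<lambda>x. mul x y)) X = emeasure lborel {x. mul x y \<in> X}"
    using assms by (subst emeasure_distr) (auto simp: vimage_def)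
  then show ?thesis by (simp add: mul_right_preserves_lborel)
qed

text \<open>If \<open>exp\<close> had a kernel, preimages under \<open>exp\<close> would be invariant under infinitely many disjoint
  translates of any bounded set; so only null sets of \<open>G\<close> would have finite measure, and no appeal
  to simple connectedness is needed.\<close>

lemma finite_measure_null_if_not_inj:
  assumes "\<not> inj E" and B: "E -` B \<in> sets borel" and fin: "emeasure lborel (E -` B) < \<infinity>"
  shows "emeasure lborel (E -` B) = 0"
proof -
  let ?S = "E -` B"
  obtain x y where xy: "E x = E y" "x \<noteq> y" using assms(1) by (auto simp: inj_def)
  define v where "v = mul x (- y)"
  have Ev: "E v = 0" using xy by (simp add: v_def E_mul E_minus)
  have v0: "v \<noteq> 0"
  proof
    assume "v = 0"
    then have "mul 0 y = x" unfolding v_def by (metis mul_minus_right(2))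
    then show False using xy by simp
  qed
  have Ek: "E (real k *\<^sub>R v) = 0" for k :: nat
    by (induction k) (auto simp: E_add_scaleR[of 1, simplified] Ev scaleR_add_left[symmetric] simp del: scaleR_add_left)
  have "\<exists>j. pr j v \<noteq> 0"
  proof (rule ccontr)
    assume "\<not> ?thesis"
    then show False using pr_sum[of v] v0 by simp
  qed
  \<comment> \<open>The lowest layer in which \<open>v\<close> is visible. There right
    multiplication by a multiple of \<open>v\<close> acts as addition, which tells the translates
    apart.\<close>
  define j where "j = (LEAST j. pr j v \<noteq> 0)"
  have j: "pr j v \<noteq> 0" unfolding j_def by (rule LeastI_ex) fact
  have vF: "v \<in> Fil j" unfolding Fil_def j_def using not_less_Least by blast
  have prm: "pr j (mul x (c *\<^sub>R v)) = pr j x + c *\<^sub>R pr j v" for x c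
  proof -
    have "mul x (c *\<^sub>R v) - (x + c *\<^sub>R v) \<in> Fil (Suc j)" by (rule mul_Fil[OF Fil_scale[OF vF]])
    then have "pr j (mul x (c *\<^sub>R v) - (x + c *\<^sub>R v)) = 0" by (simp add: Fil_def)
    then show ?thesis by (simp add: pr_diff pr_add pr_scale)
  qed
  obtain M where M: "\<And>x. norm (pr j x) \<le> norm x * M"
    using bounded_linear.bounded[OF bounded_linear_pr, of j] by blast
  have null: "emeasure lborel (?S \<inter> ball 0 (real n)) = 0" for n :: nat
  proof -
    let ?K = "?S \<inter> ball 0 (real n)"
    have Km: "?K \<in> sets borel" using B by auto
    \<comment> \<open>A shift by \<open>N\<close> times \<open>v\<close> moves component
      \<open>j\<close> farther than two points of the bounded piece can differ in it, so the
      translates are disjoint.\<close>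
    have "\<exists>N::nat. real N * norm (pr j v) > 2 * (real n * \<bar>M\<bar>)"
      using reals_Archimedean3[of "norm (pr j v)"] j by auto
    then obtain N :: nat where N: "real N * norm (pr j v) > 2 * (real n * \<bar>M\<bar>)" by blast
    have KM: "norm (pr j x) \<le> real n * \<bar>M\<bar>" if "x \<in> ?K" for x
    proof -
      have "norm (pr j x) \<le> norm x * M" by (rule M)
      also have "\<dots> \<le> norm x * \<bar>M\<bar>" by (intro mult_left_mono) auto
      also have "\<dots> \<le> real n * \<bar>M\<bar>" using that by (intro mult_right_mono) auto
      finally show ?thesis .
    qed
    define K where "K i = {x. mul x (- (real (i * N) *\<^sub>R v)) \<in> ?K}" for i :: nat
    have Kim: "K i \<in> sets borel" for i
    proof -
      have "(\<lambda>x. mul x (- (real (i * N) *\<^sub>R v))) \<in> borel_measurable borel"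
        by (intro borel_measurable_continuous_onI continuous_on_mul continuous_intros)
      from measurable_sets[OF this Km] show ?thesis by (simp add: K_def vimage_def)
    qed
    have Ke: "emeasure lborel (K i) = emeasure lborel ?K" for i
      unfolding K_def by (rule emeasure_mul_right[OF Km])
    have KS: "K i \<subseteq> ?S" for i
    proof
      fix x assume "x \<in> K i"
      then have "E (mul x (- (real (i * N) *\<^sub>R v))) \<in> B" by (simp add: K_def)
      then show "x \<in> ?S" using Ek[of "i * N"] by (simp add: E_mul E_minus)
    qed
    have dis: "K i \<inter> K l = {}" if "i < l" for i l
    proof (rule ccontr)
      assume "K i \<inter> K l \<noteq> {}"
      then obtain x where x: "x \<in> K i" "x \<in> K l" by auto
      have "norm (pr j (mul x ((- real (i * N)) *\<^sub>R v))) \<le> real n * \<bar>M\<bar>"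
        "norm (pr j (mul x ((- real (l * N)) *\<^sub>R v))) \<le> real n * \<bar>M\<bar>"
        using x KM by (auto simp: K_def)
      then have "norm ((pr j x + (- real (i * N)) *\<^sub>R pr j v) - (pr j x + (- real (l * N)) *\<^sub>R pr j v)) \<le> 2 * (real n * \<bar>M\<bar>)"
        unfolding prm by (intro order_trans[OF norm_triangle_ineq4]) linarith
      also have "(pr j x + (- real (i * N)) *\<^sub>R pr j v) - (pr j x + (- real (l * N)) *\<^sub>R pr j v) = (real (l - i) * real N) *\<^sub>R pr j v"
      proof -
        have "real (l - i) * real N = real (l * N) - real (i * N)" using that by (simp add: of_nat_diff left_diff_distrib)
        then show ?thesis by (simp add: scaleR_left_diff_distrib)
      qed
      finally have "real (l - i) * (real N * norm (pr j v)) \<le> 2 * (real n * \<bar>M\<bar>)" by (simp add: mult.assoc)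
      moreover have "1 * (real N * norm (pr j v)) \<le> real (l - i) * (real N * norm (pr j v))"
        using that by (intro mult_right_mono) auto
      ultimately show False using N by linarith
    qed
    have fK: "emeasure lborel ?K < \<infinity>"
      using emeasure_mono[of ?K ?S lborel] B fin by (auto intro: le_less_trans)
    obtain a where a: "a \<ge> 0" "emeasure lborel ?K = ennreal a" using fK by (cases "emeasure lborel ?K") auto
    obtain b where b: "b \<ge> 0" "emeasure lborel ?S = ennreal b" using fin by (cases "emeasure lborel ?S") auto
    have "real q * a \<le> b" for q :: nat
    proof -
      have "disjoint_family_on K {..<q}"
        unfolding disjoint_family_on_def
      proof (intro ballI impI)
        fix i l :: nat assume "i \<noteq> l"
        then show "K i \<inter> K l = {}" using dis[of i l] dis[of l i] by (cases "i < l") auto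
      qed
      then have "(\<Sum>i<q. emeasure lborel (K i)) = emeasure lborel (\<Union>i<q. K i)"
        using Kim by (intro sum_emeasure) auto
      also have "\<dots> \<le> emeasure lborel ?S" using KS B by (intro emeasure_mono) auto
      finally have "ennreal (real q * a) \<le> ennreal b"
        by (simp add: Ke a b ennreal_mult ennreal_of_nat_eq_real_of_nat)
      then show ?thesis using b by simp
    qed
    then have "a = 0" using reals_Archimedean3[of a] a(1) by (metis leD less_eq_real_def)
    then show ?thesis using a by simp
  qed
  have "?S = (\<Union>n. ?S \<inter> ball 0 (real n))"
    using reals_Archimedean2 by (auto simp: dist_norm)
  moreover have "(\<Union>n. ?S \<inter> ball 0 (real n)) \<in> null_sets lborel"
    using null B by (intro null_sets_UN) (auto simp: null_sets_def)
  ultimately show ?thesis by (metis null_setsD1)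
qed

lemma E_conjugate: "h + E v + - h = E (Ad h v)"
proof -
  have "one_parameter_subgroup A L (Ad h v) (\<lambda>t. h + E (t *\<^sub>R v) + - h)"
    unfolding one_parameter_subgroup_def
  proof (intro conjI allI ballI)
    show "h + E ((s + t) *\<^sub>R v) + - h = (h + E (s *\<^sub>R v) + - h) + (h + E (t *\<^sub>R v) + - h)" for s t
      by (simp add: E_add_scaleR add.assoc del: add_uminus_conv_diff)
    fix f assume f: "f \<in> S"
    let ?f = "\<lambda>x. f (x + - h)"
    have fS: "?f \<in> S" by (rule smooth_functions_right_translate[OF f])
    have "((\<lambda>t. ?f (h + E (t *\<^sub>R v))) has_real_derivative L v ?f (h + E (0 *\<^sub>R v))) (at 0)"
      using log_derivD[OF log_deriv_E smooth_functions_left_translate[OF fS]] by (simp only: L_left[OF fS])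
    then show "((f \<circ> (\<lambda>t. h + E (t *\<^sub>R v) + - h)) has_real_derivative L (Ad h v) f 0) (at 0)"
      by (simp add: o_def L_Ad[OF f])
  qed
  from one_parameter_subgroup_unique[OF this exp_one_parameter]
  have "(\<lambda>t. h + E (t *\<^sub>R v) + - h) 1 = E (1 *\<^sub>R Ad h v)" by metis
  then show ?thesis by simp
qed

end

locale carnot_coordinates = stratified_lie_group A L r V
  for A :: "('g::{topological_group_add, t2_space, second_countable_topology}, 'm::euclidean_space) chart set"
  and L :: "'v::euclidean_space \<Rightarrow> ('g \<Rightarrow> real) \<Rightarrow> ('g \<Rightarrow> real)" and r V +
  fixes m :: nat and e :: "nat \<Rightarrow> 'v"
  assumes inj_E: "inj E" and span_e: "span (e ` {1..m}) = V 1"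
begin

text \<open>The group axioms for \<open>mul\<close> are inherited from the group, since
  \<open>exp\<close> is an injective homomorphism.\<close>

lemma mul_assoc: "mul (mul x y) z = mul x (mul y z)"
  by (rule injD[OF inj_E]) (simp add: E_mul add.assoc)

lemma mul_neg_left [simp]: "mul (- x) x = 0" "mul x (- x) = 0" "mul (- x) (mul x y) = y" "mul x (mul (- x) y) = y"
  by (rule injD[OF inj_E], simp add: E_mul E_minus add.assoc[symmetric])+

lemma neg_mul: "- mul x y = mul (- y) (- x)"
  by (rule injD[OF inj_E]) (simp add: E_mul E_minus minus_add)

lemma mul_conjugate: "mul (mul w y) (- w) = Ad (E w) y"
  by (rule injD[OF inj_E]) (use E_conjugate[of "E w" y] in \<open>simp add: E_mul E_minus\<close>)

text \<open>Moving a direction past a right factor conjugates it. Right translates of test functions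
  are differentiated in this way.\<close>

lemma mul_shift: "mul (mul x (t *\<^sub>R y)) w = mul (mul x w) (t *\<^sub>R Ad (E (- w)) y)"
proof -
  have "t *\<^sub>R Ad (E (- w)) y = mul (mul (- w) (t *\<^sub>R y)) w"
    using mul_conjugate[of "- w" "t *\<^sub>R y"] by (simp add: linear_cmul[OF linear_Ad])
  then show ?thesis by (simp add: mul_assoc)
qed

lemma emeasure_mul_left:
  assumes X: "X \<in> sets borel" shows "emeasure lborel {y. mul x y \<in> X} = emeasure lborel X"
proof -
  have u: "emeasure lborel {y. - y \<in> Y} = emeasure lborel Y" if Y: "Y \<in> sets borel" for Y :: "'v set"
  proof -
    have "lborel = density (distr lborel borel uminus) (\<lambda>_::'v. 1)"
      using lborel_affine[of "-1" "0::'v"] by simp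
    then have "distr lborel borel uminus = (lborel :: 'v measure)" by (simp add: density_1)
    moreover have "emeasure (distr lborel borel uminus) Y = emeasure lborel {y. - y \<in> Y}"
      using Y by (subst emeasure_distr) (auto simp: vimage_def)
    ultimately show ?thesis by simp
  qed
  have nm: "(uminus :: 'v \<Rightarrow> 'v) \<in> borel_measurable borel" by simp
  have X': "{z. - z \<in> X} \<in> sets borel" using measurable_sets[OF nm X] by (simp add: vimage_def)
  have "(\<lambda>z. mul z (- x)) \<in> borel_measurable borel"
    by (intro borel_measurable_continuous_onI continuous_on_mul continuous_intros)
  from measurable_sets[OF this X'] have X'': "{z. mul z (- x) \<in> {z. - z \<in> X}} \<in> sets borel" by (simp add: vimage_def)
  have "{y. mul x y \<in> X} = {y. - y \<in> {z. mul z (- x) \<in> {z. - z \<in> X}}}"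
    by (auto simp: neg_mul)
  then have "emeasure lborel {y. mul x y \<in> X} = emeasure lborel {z. mul z (- x) \<in> {z. - z \<in> X}}"
    using u[OF X''] by simp
  also have "\<dots> = emeasure lborel X" by (simp only: emeasure_mul_right[OF X'] u[OF X])
  finally show ?thesis .
qed

section \<open>Horizontal products fill the group\<close>

fun Gen :: "nat \<Rightarrow> 'v set" where
  "Gen 0 = {0}"
| "Gen (Suc k) = (\<Union>i\<in>{1..m}. (\<lambda>(x, t). mul x (t *\<^sub>R e i)) ` (Gen k \<times> {-1..1}))"

text \<open>The bound 1 on the times is there for compactness, hence finite measure; other time
  bounds are reached by dilation.\<close>

lemma compact_Gen: "compact (Gen k)"
proof (induction k)
  case (Suc k)
  have "continuous_on (Gen k \<times> {-1..1}) (\<lambda>(x, t). mul x (t *\<^sub>R e i))" for i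
    unfolding case_prod_unfold by (intro continuous_on_mul continuous_intros)
  then show ?case using Suc by (auto intro!: compact_UN compact_continuous_image compact_Times)
qed simp

definition H :: "'v set" where "H = (\<Union>k. Gen k)"

lemma H_0: "0 \<in> H" unfolding H_def by (rule UN_I[of 0]) auto

lemma H_step: "x \<in> H \<Longrightarrow> i \<in> {1..m} \<Longrightarrow> mul x (t *\<^sub>R e i) \<in> H"
proof -
  assume x: "x \<in> H" and i: "i \<in> {1..m}"
  have small: "mul x (t *\<^sub>R e i) \<in> H" if xH: "x \<in> H" and t1: "\<bar>t\<bar> \<le> 1" for x t
  proof -
    obtain k where "x \<in> Gen k" using xH by (auto simp: H_def)
    then have "mul x (t *\<^sub>R e i) \<in> Gen (Suc k)" using i t1 by (auto simp: abs_le_iff intro!: bexI[of _ i] image_eqI[of _ _ "(x, t)"])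
    then show ?thesis unfolding H_def by blast
  qed
  obtain n :: nat where n: "\<bar>t\<bar> < real n" using reals_Archimedean2 by blast
  then have n0: "n > 0" by (cases n) auto
  have "mul x ((real k * (t / real n)) *\<^sub>R e i) \<in> H" for k :: nat
  proof (induction k)
    case (Suc k)
    have "mul x ((real (Suc k) * (t / real n)) *\<^sub>R e i) = mul (mul x ((real k * (t / real n)) *\<^sub>R e i)) ((t / real n) *\<^sub>R e i)"
      unfolding mul_add_scaleR by (simp add: algebra_simps add_divide_distrib)
    moreover have "\<bar>t / real n\<bar> \<le> 1" using n n0 by simp
    ultimately show ?case using small[OF Suc] by simp
  qed (use x in simp)
  from this[of n] show ?thesis using n0 by simp
qed

lemma H_induct [consumes 1, case_names zero step]:
  assumes "x \<in> H" "P 0" "\<And>x i t. x \<in> H \<Longrightarrow> P x \<Longrightarrow> i \<in> {1..m} \<Longrightarrow> P (mul x (t *\<^sub>R e i))"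
  shows "P x"
proof -
  have "x \<in> Gen k \<Longrightarrow> P x" for k x
  proof (induction k arbitrary: x)
    case (Suc k)
    then obtain i y t where x: "x = mul y (t *\<^sub>R e i)" "i \<in> {1..m}" "y \<in> Gen k" by auto
    then have "y \<in> H" by (auto simp: H_def)
    then show ?case using assms(3) Suc.IH[OF x(3)] x by blast
  qed (use assms(2) in simp)
  then show ?thesis using assms(1) by (auto simp: H_def)
qed

lemma H_mul: "y \<in> H \<Longrightarrow> x \<in> H \<Longrightarrow> mul x y \<in> H"
proof (induction rule: H_induct)
  case (step y i t)
  then show ?case by (simp add: mul_assoc[symmetric] H_step)
qed simp

lemma H_neg: "x \<in> H \<Longrightarrow> - x \<in> H"
proof (induction rule: H_induct)
  case (step x i t)
  have "mul 0 ((- t) *\<^sub>R e i) \<in> H" by (rule H_step[OF H_0 \<open>i \<in> {1..m}\<close>])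
  then have "(- t) *\<^sub>R e i \<in> H" by simp
  then show ?case using H_mul[OF \<open>- x \<in> H\<close>] by (simp add: neg_mul)
qed (simp add: H_0)

lemma e_V1: "i \<in> {1..m} \<Longrightarrow> e i \<in> V 1"
  using span_base[of "e i" "e ` {1..m}"] span_e by simp

lemma dil_e: "i \<in> {1..m} \<Longrightarrow> dil s (e i) = s *\<^sub>R e i"
  using dil_W[of "e i" 1 s] e_V1[of i] r_pos by (simp add: W_def)

lemma dil_mul_e: "i \<in> {1..m} \<Longrightarrow> dil s (mul x (t *\<^sub>R e i)) = mul (dil s x) ((s * t) *\<^sub>R e i)"
  by (simp add: dil_mul linear_cmul[OF linear_dil] dil_e mult.commute)

lemma H_dil: "x \<in> H \<Longrightarrow> dil s x \<in> H"
proof (induction rule: H_induct)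
  case (step x i t)
  then show ?case using H_step by (simp add: dil_mul_e)
qed (simp add: linear_0[OF linear_dil] H_0)

text \<open>The leading terms of elements of \<open>H\<close> fill each layer: the group commutator of \<open>exp (e i)\<close> with
  \<open>exp (b + \<dots>)\<close> has leading term \<open>[e i, b]\<close>.\<close>

definition lead :: "nat \<Rightarrow> 'v set" where "lead j = {w. \<exists>u\<in>Fil (Suc j). w + u \<in> H}"

lemma V_Fil: "j \<in> {1..r} \<Longrightarrow> w \<in> V j \<Longrightarrow> w \<in> Fil j"
  using W_Fil[of w j j] by (simp add: W_def)

text \<open>Each linear operation has a group counterpart that acts on leading terms: sums come from
  products, negatives from inverses, positive multiples from dilation by a j-th root.\<close>

lemma subspace_lead: "j \<in> {1..r} \<Longrightarrow> subspace (V j \<inter> lead j)"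
proof -
  assume j: "j \<in> {1..r}"
  have neg: "- w \<in> lead j" if w: "w \<in> lead j" for w
  proof -
    obtain u where u: "u \<in> Fil (Suc j)" "w + u \<in> H" using w by (auto simp: lead_def)
    have "- w + - u \<in> H" using H_neg[OF u(2)] by simp
    then show ?thesis using subspace_neg[OF subspace_Fil u(1)] unfolding lead_def by blast
  qed
  have pos: "c *\<^sub>R w \<in> lead j" if w: "w \<in> V j" "w \<in> lead j" and c: "c > 0" for c w
  proof -
    obtain u where u: "u \<in> Fil (Suc j)" "w + u \<in> H" using w by (auto simp: lead_def)
    have s: "root j c ^ j = c" using j c by simp
    have "dil (root j c) (w + u) = c *\<^sub>R w + dil (root j c) u"
      using dil_W[of w j "root j c"] w(1) j s by (simp add: linear_add[OF linear_dil] W_def)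
    then have "c *\<^sub>R w + dil (root j c) u \<in> H" using H_dil[OF u(2), of "root j c"] by simp
    then show ?thesis using dil_Fil[OF u(1)] unfolding lead_def by blast
  qed
  have z: "0 \<in> lead j" using H_0 Fil_0 by (auto simp: lead_def intro!: bexI[of _ 0])
  show ?thesis
    unfolding subspace_def
  proof (intro conjI ballI allI)
    show "0 \<in> V j \<inter> lead j" using z subspace_0[OF V_subspace[OF j]] by simp
    fix x assume x: "x \<in> V j \<inter> lead j"
    show "c *\<^sub>R x \<in> V j \<inter> lead j" for c
    proof -
      consider "c > 0" | "c = 0" | "c < 0" by linarith
      then have "c *\<^sub>R x \<in> lead j"
      proof cases
        case 3
        then have "- ((- c) *\<^sub>R x) \<in> lead j" using x pos[of x "- c"] by (intro neg) auto
        then show ?thesis by simp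
      qed (use x pos z in auto)
      then show ?thesis using x subspace_scale[OF V_subspace[OF j]] by simp
    qed
    fix y assume y: "y \<in> V j \<inter> lead j"
    obtain u where u: "u \<in> Fil (Suc j)" "x + u \<in> H" using x by (auto simp: lead_def)
    obtain u' where u': "u' \<in> Fil (Suc j)" "y + u' \<in> H" using y by (auto simp: lead_def)
    have "y + u' \<in> Fil j" using V_Fil[OF j] y Fil_mono[OF _ u'(1), of j] by (auto intro: Fil_add)
    then have q: "mul (x + u) (y + u') - ((x + u) + (y + u')) \<in> Fil (Suc j)" by (rule mul_Fil)
    have "(u + u') + (mul (x + u) (y + u') - ((x + u) + (y + u'))) \<in> Fil (Suc j)"
      by (intro Fil_add u u' q)
    moreover have "(x + y) + ((u + u') + (mul (x + u) (y + u') - ((x + u) + (y + u')))) \<in> H"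
      using H_mul[OF u'(2) u(2)] by (simp add: algebra_simps)
    ultimately have "x + y \<in> lead j" unfolding lead_def by blast
    then show "x + y \<in> V j \<inter> lead j" using x y subspace_add[OF V_subspace[OF j]] by simp
  qed
qed

lemma e_lead: "i \<in> {1..m} \<Longrightarrow> e i \<in> lead 1"
  using H_step[OF H_0, of i 1] Fil_0 by (auto simp: lead_def intro!: bexI[of _ 0])

lemma bracket_lead:
  assumes i: "i \<in> {1..m}" and j: "j \<in> {1..<r}" and b: "b \<in> V j" "b \<in> lead j"
  shows "br (e i) b \<in> lead (Suc j)"
proof -
  obtain u where u: "u \<in> Fil (Suc j)" "b + u \<in> H" using b by (auto simp: lead_def)
  define y where "y = b + u"
  have yF: "y \<in> Fil j"
    using V_Fil[of j b] b j Fil_mono[OF _ u(1), of j] by (auto simp: y_def intro: Fil_add)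
  have yH: "y \<in> H" using u by (simp add: y_def)
  have eH: "e i \<in> H" using H_step[OF H_0 i, of 1] by simp
  have r2: "r \<ge> 2" using j by auto
  define c where "c = mul (mul (mul (e i) y) (- e i)) (- y)"
  have cH: "c \<in> H" unfolding c_def by (intro H_mul H_neg yH eH)
  have "mul (mul (e i) y) (- e i) = ad_exp (e i) 1 y"
    using Ad_E[of 1 "e i" y] by (simp add: mul_conjugate)
  moreover have "ad_exp (e i) 1 y = y + (br (e i) y + (\<Sum>k\<in>{2..<r}. (1 / fact k) *\<^sub>R (br (e i) ^^ k) y))"
  proof -
    have "{..<r} = insert 0 (insert 1 {2..<r})" using r2 by auto
    then show ?thesis by (simp add: ad_exp_def One_nat_def)
  qed
  moreover define q where "q = br (e i) y + (\<Sum>k\<in>{2..<r}. (1 / fact k) *\<^sub>R (br (e i) ^^ k) y)"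
  ultimately have c: "c = mul (y + q) (- y)" by (simp add: c_def)
  have tail: "(\<Sum>k\<in>{2..<r}. (1 / fact k) *\<^sub>R (br (e i) ^^ k) y) \<in> Fil (Suc (Suc j))"
    by (intro Fil_sum Fil_scale Fil_mono[OF _ br_pow_Fil[OF yF]]) auto
  have b1: "br (e i) y \<in> Fil (Suc j)" using br_pow_Fil[OF yF, of 1 "e i"] by (simp add: One_nat_def)
  have qF: "q \<in> Fil (Suc j)" unfolding q_def by (rule Fil_add[OF b1 Fil_mono[OF _ tail]]) simp
  \<comment> \<open>Compared with \<open>mul y (- y)\<close>, which is 0, the commutator has leading
    term \<open>q\<close>.\<close>
  have "(mul (y + q) (- y) - mul y (- y)) - ((y + q) - y) \<in> Fil (Suc (Suc j))"
    by (rule mul_cong) (use qF in simp)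
  then have cq: "c - q \<in> Fil (Suc (Suc j))" by (simp add: c)
  have bu: "br (e i) u \<in> Fil (Suc (Suc j))" using br_pow_Fil[OF u(1), of 1 "e i"] by (simp add: One_nat_def)
  have "(c - q) + (br (e i) u + (\<Sum>k\<in>{2..<r}. (1 / fact k) *\<^sub>R (br (e i) ^^ k) y)) \<in> Fil (Suc (Suc j))"
    by (intro Fil_add cq bu tail)
  moreover have "br (e i) b + ((c - q) + (br (e i) u + (\<Sum>k\<in>{2..<r}. (1 / fact k) *\<^sub>R (br (e i) ^^ k) y))) = c"
    by (simp add: q_def y_def br_add_right)
  ultimately show ?thesis using cH unfolding lead_def by (metis (mono_tags, lifting) mem_Collect_eq)
qed

lemma V_lead: "j \<in> {1..r} \<Longrightarrow> V j \<subseteq> lead j"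
proof (induction j)
  case (Suc j)
  show ?case
  proof (cases "j = 0")
    case True
    have 1: "1 \<in> {1..r}" using r_pos by simp
    have "span (e ` {1..m}) \<subseteq> V 1 \<inter> lead 1"
      by (rule span_minimal[OF _ subspace_lead[OF 1]]) (use e_V1 e_lead in blast)
    then show ?thesis using True span_e by (simp add: One_nat_def)
  next
    case False
    then have j: "j \<in> {1..<r}" "j \<in> {1..r}" using Suc.prems by auto
    have IH: "V j \<subseteq> lead j" using Suc.IH j by simp
    have SL: "subspace (V (Suc j) \<inter> lead (Suc j))" by (rule subspace_lead[OF Suc.prems])
    have VS: "br x b \<in> V (Suc j)" if "x \<in> V 1" "b \<in> V j" for x b
    proof -
      have "br x b \<in> span {br x y | x y. x \<in> V 1 \<and> y \<in> V j}" by (rule span_base) (use that in blast)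
      then show ?thesis using V_generate[OF j(1)] by simp
    qed
    have "br x b \<in> V (Suc j) \<inter> lead (Suc j)" if x: "x \<in> V 1" and b: "b \<in> V j" for x b
    proof -
      have "x \<in> span (e ` {1..m})" using x span_e by simp
      then show ?thesis
      proof (induction rule: span_induct)
        show "subspace {x. br x b \<in> V (Suc j) \<inter> lead (Suc j)}"
          using SL unfolding subspace_def by (simp add: bilinear_lzero[OF bilinear_br] br_add_left br_scale_left)
        fix x assume "x \<in> e ` {1..m}"
        then obtain i where i: "i \<in> {1..m}" "x = e i" by auto
        then show "br x b \<in> V (Suc j) \<inter> lead (Suc j)"
          using bracket_lead[OF i(1) j(1) b] IH b VS[OF e_V1[OF i(1)] b] by blast
      qed
    qed
    then have "span {br x y | x y. x \<in> V 1 \<and> y \<in> V j} \<subseteq> V (Suc j) \<inter> lead (Suc j)"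
      by (intro span_minimal SL) blast
    then show ?thesis using V_generate[OF j(1)] by simp
  qed
qed simp

text \<open>Descending induction on the filtration: an element of \<open>H\<close> with the same
  leading term as \<open>x\<close> is divided off from the left, and the quotient lies one step
  further down, where the induction hypothesis applies.\<close>

lemma H_UNIV: "H = UNIV"
proof -
  have "Fil (Suc r - i) \<subseteq> H" if "i \<le> r" for i
    using that
  proof (induction i)
    case 0
    then show ?case using Fil_top[of "Suc r"] H_0 by auto
  next
    case (Suc i)
    define k where "k = r - i"
    have k: "k \<in> {1..r}" "Suc r - Suc i = k" "Suc r - i = Suc k" using Suc.prems by (auto simp: k_def)
    have IH: "Fil (Suc k) \<subseteq> H" using Suc k by simp
    show ?case
    proof
      fix x assume "x \<in> Fil (Suc r - Suc i)"
      then have x: "x \<in> Fil k" by (simp only: k(2))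
      obtain u where u: "u \<in> Fil (Suc k)" "pr k x + u \<in> H"
        using V_lead[OF k(1)] pr_in[OF k(1), of x] by (auto simp: lead_def)
      define h where "h = pr k x + u"
      have prk: "pr i (pr k x) = (if i = k then pr k x else 0)" for i by (rule pr_W[OF pr_in_W])
      have xw: "x - pr k x \<in> Fil (Suc k)"
        using x by (auto simp: Fil_def pr_diff prk less_Suc_eq)
      have xh: "x - h \<in> Fil (Suc k)" using Fil_diff[OF xw u(1)] by (simp add: h_def algebra_simps)
      have "mul (- h) x - (- h + x) \<in> Fil (Suc k)" by (rule mul_Fil[OF x])
      from Fil_add[OF this xh] have "mul (- h) x \<in> Fil (Suc k)" by (simp add: algebra_simps)
      then have "mul (- h) x \<in> H" using IH by blast
      from H_mul[OF this u(2)] show "x \<in> H" by (simp add: h_def[symmetric])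
    qed
  qed
  from this[of r] show ?thesis by auto
qed

text \<open>Read in a chart, \<open>exp\<close> is continuous and injective, and by
  \<open>DIM_le\<close> its target is no larger in dimension than its source; so invariance of
  domain applies.\<close>

lemma E_open_map: "open X \<Longrightarrow> open (E ` X)"
proof -
  assume X: "open X"
  show ?thesis
  proof (subst open_subopen, intro ballI)
    fix p assume "p \<in> E ` X"
    obtain U \<phi> where U: "(U, \<phi>) \<in> A" "p \<in> U" by (rule chart_exists)
    note c = chart_props[OF U(1)]
    define Y where "Y = X \<inter> E -` U"
    have Y: "open Y" unfolding Y_def
      using continuous_open_preimage[OF continuous_E open_UNIV c(1)] X by auto
    have "open ((\<lambda>x. \<phi> (E x)) ` Y)"
    proof (rule invariance_of_domain_gen[OF Y])
      show "continuous_on Y (\<lambda>x. \<phi> (E x))"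
        by (rule continuous_on_compose2[OF c(3) continuous_on_subset[OF continuous_E]]) (auto simp: Y_def)
      show "inj_on (\<lambda>x. \<phi> (E x)) Y"
        using c(5) inj_E by (auto simp: inj_on_def Y_def)
    qed (rule DIM_le)
    then have "open {q \<in> U. \<phi> q \<in> (\<lambda>x. \<phi> (E x)) ` Y}" by (rule chart_preimage_open[OF U(1)])
    moreover have "{q \<in> U. \<phi> q \<in> (\<lambda>x. \<phi> (E x)) ` Y} = E ` Y"
      using c(5) by (auto simp: Y_def inj_on_def)
    moreover have "p \<in> E ` Y" using \<open>p \<in> E ` X\<close> U by (auto simp: Y_def)
    ultimately show "\<exists>T. open T \<and> p \<in> T \<and> T \<subseteq> E ` X" by (metis Y_def image_mono inf_le1)
  qed
qed

definition ext_log :: "('v \<Rightarrow> real) \<Rightarrow> 'g \<Rightarrow> real" where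
  "ext_log h g = (if g \<in> range E then h (inv E g) else 0)"

lemma ext_log_E [simp]: "ext_log h (E x) = h x"
  by (simp add: ext_log_def inv_f_f[OF inj_E])

text \<open>The range of \<open>exp\<close> is open, but it is not known to be the whole group. It
  covers the group together with the complement of the compact image of \<open>K\<close>, where the
  extension vanishes, so continuity can be checked on these two open sets.\<close>

lemma ext_log_compact_support:
  assumes h: "continuous_on UNIV h" and K: "compact K" "\<And>x. x \<notin> K \<Longrightarrow> h x = 0"
  shows "continuous_compact_support UNIV (ext_log h)"
proof -
  have EK: "compact (E ` K)" by (rule compact_continuous_image[OF continuous_on_subset[OF continuous_E] K(1)]) simp
  then have cEK: "closed (E ` K)" by (rule compact_imp_closed)
  have z: "ext_log h g = 0" if "g \<notin> E ` K" for g
  proof (cases "g \<in> range E")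
    case True
    then obtain x where "g = E x" by auto
    then show ?thesis using that K(2)[of x] by auto
  qed (simp add: ext_log_def)
  have oR: "open (range E)" by (rule E_open_map) simp
  have "continuous_on (range E \<union> - E ` K) (ext_log h)"
  proof (rule continuous_on_open_Un[OF oR])
    show "open (- E ` K)" using cEK by blast
    show "continuous_on (- E ` K) (ext_log h)" by (rule continuous_on_eq[of _ "\<lambda>x. 0"]) (use z in auto)
    show "continuous_on (range E) (ext_log h)"
      unfolding continuous_on_open_vimage[OF oR]
    proof (intro allI impI)
      fix B :: "real set" assume "open B"
      then have "open (h -` B)" using continuous_open_preimage[OF h open_UNIV] by simp
      moreover have "ext_log h -` B \<inter> range E = E ` (h -` B)" by auto
      ultimately show "open (ext_log h -` B \<inter> range E)" using E_open_map by metis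
    qed
  qed
  moreover have "range E \<union> - E ` K = UNIV" by auto
  moreover have "closure {x. ext_log h x \<noteq> 0} \<subseteq> E ` K" using z cEK by (intro closure_minimal) auto
  ultimately show ?thesis
    using EK compact_Int_closed[OF EK, of "closure {x. ext_log h x \<noteq> 0}"]
    by (auto simp: continuous_compact_support_def Int_absorb1)
qed

definition test_fun :: "('v \<Rightarrow> real) \<Rightarrow> ('v \<Rightarrow> 'v \<Rightarrow> real) \<Rightarrow> bool" where
  "test_fun \<beta> D \<longleftrightarrow> continuous_on UNIV \<beta> \<and> (\<exists>K. compact K \<and> (\<forall>x. x \<notin> K \<longrightarrow> \<beta> x = 0)) \<and>
     (\<forall>y x. ((\<lambda>t. \<beta> (mul x (t *\<^sub>R y))) has_real_derivative D y x) (at 0)) \<and> (\<forall>y. continuous_on UNIV (D y))"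

lemma test_fun_D_support:
  assumes t: "test_fun \<beta> D" and K: "compact K" "\<And>x. x \<notin> K \<Longrightarrow> \<beta> x = 0" and x: "x \<notin> K"
  shows "D y x = 0"
proof -
  have oK: "open (- K)" using K(1) compact_imp_closed by auto
  have "continuous_on UNIV (\<lambda>t. mul x (t *\<^sub>R y))" by (intro continuous_on_mul continuous_intros)
  then have "open ((\<lambda>t. mul x (t *\<^sub>R y)) -` (- K))"
    using continuous_open_preimage[OF _ open_UNIV oK] by fastforce
  moreover have "(0::real) \<in> (\<lambda>t. mul x (t *\<^sub>R y)) -` (- K)" using x by simp
  moreover have "((\<lambda>t. 0) has_real_derivative 0) (at (0::real))" by simp
  ultimately have "((\<lambda>t. \<beta> (mul x (t *\<^sub>R y))) has_real_derivative 0) (at 0)"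
    by (elim has_field_derivative_transform_within_open) (use K(2) in auto)
  moreover have "((\<lambda>t. \<beta> (mul x (t *\<^sub>R y))) has_real_derivative D y x) (at 0)"
    using t by (auto simp: test_fun_def)
  ultimately show ?thesis using DERIV_unique by blast
qed

lemma test_fun_derivative:
  assumes t: "test_fun \<beta> D"
  shows "((\<lambda>t. \<beta> (mul x (t *\<^sub>R y))) has_real_derivative D y (mul x (t *\<^sub>R y))) (at t)"
proof -
  have "((\<lambda>s. \<beta> (mul (mul x (t *\<^sub>R y)) (s *\<^sub>R y))) has_real_derivative D y (mul x (t *\<^sub>R y))) (at 0)"
    using t by (auto simp: test_fun_def)
  then have "((\<lambda>s. \<beta> (mul x ((s + t) *\<^sub>R y))) has_real_derivative D y (mul x (t *\<^sub>R y))) (at 0)"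
    by (simp add: mul_add_scaleR add.commute del: scaleR_add_left)
  then show ?thesis using DERIV_shift[of "\<lambda>s. \<beta> (mul x (s *\<^sub>R y))" _ 0 t] by simp
qed

lemma test_fun_right_translate:
  assumes t: "test_fun \<beta> D"
  shows "test_fun (\<lambda>x. \<beta> (mul x w)) (\<lambda>y x. D (Ad (E (- w)) y) (mul x w))"
  unfolding test_fun_def
proof (intro conjI allI)
  have c: "continuous_on UNIV (\<lambda>x. mul x w)" by (intro continuous_on_mul continuous_intros)
  show "continuous_on UNIV (\<lambda>x. \<beta> (mul x w))"
    by (rule continuous_on_compose2[OF _ c]) (use t in \<open>auto simp: test_fun_def\<close>)
  show "continuous_on UNIV (\<lambda>x. D (Ad (E (- w)) y) (mul x w))" for y
    by (rule continuous_on_compose2[OF _ c]) (use t in \<open>auto simp: test_fun_def\<close>)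
  obtain K where K: "compact K" "\<And>x. x \<notin> K \<Longrightarrow> \<beta> x = 0" using t by (auto simp: test_fun_def)
  show "\<exists>K. compact K \<and> (\<forall>x. x \<notin> K \<longrightarrow> \<beta> (mul x w) = 0)"
  proof (intro exI[of _ "(\<lambda>x. mul x (- w)) ` K"] conjI allI impI)
    show "compact ((\<lambda>x. mul x (- w)) ` K)"
      by (intro compact_continuous_image continuous_on_mul continuous_intros K)
    fix x assume x: "x \<notin> (\<lambda>x. mul x (- w)) ` K"
    have "mul x w \<notin> K"
    proof
      assume "mul x w \<in> K"
      then have "mul (mul x w) (- w) \<in> (\<lambda>x. mul x (- w)) ` K" by blast
      then show False using x by simp
    qed
    then show "\<beta> (mul x w) = 0" by (rule K(2))
  qed
  show "((\<lambda>t. \<beta> (mul (mul x (t *\<^sub>R y)) w)) has_real_derivative D (Ad (E (- w)) y) (mul x w)) (at 0)" for y x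
    using t by (simp add: mul_shift test_fun_def)
qed

lemma test_fun_uminus: "test_fun \<beta> D \<Longrightarrow> test_fun (\<lambda>x. - \<beta> x) (\<lambda>y x. - D y x)"
  by (auto simp: test_fun_def intro!: continuous_intros DERIV_minus)

lemma test_fun_C1:
  assumes \<beta>: "Ck_on (Suc 0) \<beta> UNIV" and K: "compact K" "\<And>x. x \<notin> K \<Longrightarrow> \<beta> x = 0"
  shows "\<exists>D. test_fun \<beta> D"
proof -
  define D where "D y x = frechet_derivative \<beta> (at x) (Px x y)" for y x
  have d: "(\<beta> has_derivative frechet_derivative \<beta> (at x)) (at x)" for x using Ck_on_SucD[OF \<beta>] by simp
  have "test_fun \<beta> D"
    unfolding test_fun_def
  proof (intro conjI allI)
    show "continuous_on UNIV \<beta>" using \<beta> by (rule Ck_on_imp_continuous_on)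
    show "\<exists>K. compact K \<and> (\<forall>x. x \<notin> K \<longrightarrow> \<beta> x = 0)" using K by blast
    show "((\<lambda>t. \<beta> (mul x (t *\<^sub>R y))) has_real_derivative D y x) (at 0)" for y x
    proof -
      have "((\<lambda>t. mul x (t *\<^sub>R y)) has_derivative (\<lambda>h. h *\<^sub>R Px x y)) (at 0)"
        using mul_curve_derivative[of x y 0] by (simp add: has_vector_derivative_def)
      moreover have "(\<beta> has_derivative frechet_derivative \<beta> (at x)) (at (mul x (0 *\<^sub>R y)))" using d[of x] by simp
      ultimately have "((\<lambda>t. \<beta> (mul x (t *\<^sub>R y))) has_derivative (\<lambda>h. frechet_derivative \<beta> (at x) (h *\<^sub>R Px x y))) (at 0)"
        by (rule has_derivative_compose)
      then show ?thesis
        by (simp add: D_def has_field_derivative_def linear_cmul[OF has_derivative_linear[OF d]] mult_commute_abs)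
    qed
    show "continuous_on UNIV (D y)" for y
    proof -
      have "D y x = (\<Sum>b\<in>Basis. (Px x y \<bullet> b) * frechet_derivative \<beta> (at x) b)" for x
        using linear_sum[OF has_derivative_linear[OF d], of x "\<lambda>b. (Px x y \<bullet> b) *\<^sub>R b" Basis]
        unfolding D_def by (simp only: euclidean_representation linear_cmul[OF has_derivative_linear[OF d]] real_scaleR_def)
      moreover have "continuous_on UNIV (\<lambda>x. \<Sum>b\<in>Basis. (Px x y \<bullet> b) * frechet_derivative \<beta> (at x) b)"
        using \<beta> by (intro continuous_on_sum continuous_on_mult continuous_on_inner continuous_on_Px continuous_on_const continuous_on_id) simp
      ultimately show ?thesis by (simp cong: continuous_on_cong)
    qed
  qed
  then show ?thesis by blast
qed

lemma ext_log_lie_deriv: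
  assumes t: "test_fun \<beta> D"
  shows "has_lie_deriv A L y (ext_log \<beta>)" "lie_deriv A L y (ext_log \<beta>) = ext_log (D y)"
proof -
  have d: "((\<lambda>t. ext_log \<beta> (g + E (t *\<^sub>R y))) has_real_derivative ext_log (D y) g) (at 0)" for g
  proof (cases "g \<in> range E")
    case True
    then obtain x where g: "g = E x" by auto
    have "((\<lambda>t. \<beta> (mul x (t *\<^sub>R y))) has_real_derivative D y x) (at 0)" using t by (auto simp: test_fun_def)
    moreover have "ext_log \<beta> (g + E (t *\<^sub>R y)) = \<beta> (mul x (t *\<^sub>R y))" for t
      unfolding g E_mul[symmetric] by (rule ext_log_E)
    ultimately show ?thesis by (simp add: g)
  next
    case False
    \<comment> \<open>The range of \<open>exp\<close> is closed under products and inverses, so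
      curves that start outside it stay outside, and the extension vanishes along them.\<close>
    have "g + E (t *\<^sub>R y) \<notin> range E" for t
    proof
      assume "g + E (t *\<^sub>R y) \<in> range E"
      then obtain x where "g + E (t *\<^sub>R y) = E x" by auto
      then have "g = E x + - E (t *\<^sub>R y)" by (metis add_diff_cancel diff_conv_add_uminus)
      then have "g = E (mul x (- (t *\<^sub>R y)))" by (simp add: E_mul E_minus)
      then show False using False by blast
    qed
    then show ?thesis using False by (simp add: ext_log_def)
  qed
  then show "has_lie_deriv A L y (ext_log \<beta>)"
    unfolding has_lie_deriv_def using real_differentiable_def by blast
  show "lie_deriv A L y (ext_log \<beta>) = ext_log (D y)"
    unfolding lie_deriv_def by (rule ext) (rule DERIV_imp_deriv[OF d])
qed

end

section \<open>The isoperimetric inequality\<close>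

text \<open>One minus the product of 1 - f over finitely many plateaus f: a single factor 0 suffices
  for the value 1, and outside all the balls every factor is 1.\<close>

lemma compact_C1_cutoff:
  fixes K :: "'a::euclidean_space set"
  assumes K: "compact K" and O: "open Y" "K \<subseteq> Y"
  obtains \<beta> :: "'a \<Rightarrow> real" and K' where "Ck_on (Suc 0) \<beta> UNIV" "\<And>x. 0 \<le> \<beta> x" "\<And>x. \<beta> x \<le> 1" "\<And>x. x \<in> K \<Longrightarrow> \<beta> x = 1"
    "compact K'" "K' \<subseteq> Y" "\<And>x. x \<notin> K' \<Longrightarrow> \<beta> x = 0"
proof -
  define P where "P c R h \<longleftrightarrow> R > 0 \<and> cball c R \<subseteq> Y \<and> Ck_on (Suc 0) h UNIV \<and> (\<forall>x. 0 \<le> h x \<and> h x \<le> 1) \<and>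
      (\<forall>x. dist c x \<le> R / 2 \<longrightarrow> h x = 1) \<and> (\<forall>x. R \<le> dist c x \<longrightarrow> h x = 0)" for c R and h :: "'a \<Rightarrow> real"
  have "\<exists>R h. P c R h" if c: "c \<in> K" for c
  proof -
    have "c \<in> Y" using c O(2) by blast
    then obtain R where R: "R > 0" "cball c R \<subseteq> Y" using O(1) unfolding open_contains_cball by blast
    obtain f :: "'a \<Rightarrow> real" where "\<And>k. Ck_on k f UNIV" "\<And>x. 0 \<le> f x" "\<And>x. f x \<le> 1"
      "\<And>x. dist c x \<le> R / 2 \<Longrightarrow> f x = 1" "\<And>x. R \<le> dist c x \<Longrightarrow> f x = 0"
      using smooth_plateau[of "R/2" R c] R(1) by auto
    then have "P c R f" unfolding P_def using R by blast
    then show ?thesis by blast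
  qed
  then obtain R f where Rf: "\<And>c. c \<in> K \<Longrightarrow> P c (R c) (f c)" by metis
  note R = Rf[unfolded P_def]
  have "c \<in> ball c (R c / 2)" if "c \<in> K" for c using R[OF that] by simp
  then have "K \<subseteq> (\<Union>c\<in>K. ball c (R c / 2))" by blast
  then obtain F where F: "F \<subseteq> K" "finite F" "K \<subseteq> (\<Union>c\<in>F. ball c (R c / 2))"
    using compactE_image[OF K, of K "\<lambda>c. ball c (R c / 2)"] by (metis open_ball)
  define \<beta> where "\<beta> x = 1 + (-1) * (\<Prod>c\<in>F. 1 + (-1) * f c x)" for x
  have "Ck_on (Suc 0) (\<lambda>x. \<Prod>c\<in>F. 1 + (-1) * f c x) UNIV"
    using F(2,1)
  proof (induction F rule: finite_induct)
    case (insert c F)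
    have "Ck_on (Suc 0) (\<lambda>x. (1 + (-1) * f c x) * (\<Prod>c\<in>F. 1 + (-1) * f c x)) UNIV"
    proof (rule Ck_on_mult[OF open_UNIV])
      show "Ck_on (Suc 0) (\<lambda>x. 1 + (-1) * f c x) UNIV"
        by (rule Ck_on_add[OF open_UNIV Ck_on_const Ck_on_mult[OF open_UNIV Ck_on_const]]) (use R[of c] insert in blast)
      show "Ck_on (Suc 0) (\<lambda>x. \<Prod>c\<in>F. 1 + (-1) * f c x) UNIV" using insert by blast
    qed
    then show ?case using insert by simp
  qed (simp only: prod.empty Ck_on_const)
  then have C: "Ck_on (Suc 0) \<beta> UNIV"
    unfolding \<beta>_def by (intro Ck_on_add[OF open_UNIV Ck_on_const Ck_on_mult[OF open_UNIV Ck_on_const]])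
  have p01: "0 \<le> (\<Prod>c\<in>F. 1 + (-1) * f c x) \<and> (\<Prod>c\<in>F. 1 + (-1) * f c x) \<le> 1" for x
  proof -
    have "0 \<le> 1 + (-1) * f c x \<and> 1 + (-1) * f c x \<le> 1" if "c \<in> F" for c
      using R[of c] that F(1) by auto
    then show ?thesis by (intro conjI prod_nonneg prod_le_1) auto
  qed
  show ?thesis
  proof (rule that[OF C])
    show "0 \<le> \<beta> x" "\<beta> x \<le> 1" for x using p01[of x] by (auto simp: \<beta>_def)
    show "\<beta> x = 1" if x: "x \<in> K" for x
    proof -
      obtain c where c: "c \<in> F" "x \<in> ball c (R c / 2)" using F(3) x by blast
      then have "f c x = 1" using R[of c] F(1) by auto
      then have "(\<Prod>c\<in>F. 1 + (-1) * f c x) = 0" using c(1) F(2) by (intro prod_zero) auto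
      then show ?thesis by (simp add: \<beta>_def)
    qed
    show "compact (\<Union>c\<in>F. cball c (R c))" using F(2) by (intro compact_UN) auto
    show "(\<Union>c\<in>F. cball c (R c)) \<subseteq> Y" using R F(1) by blast
    show "\<beta> x = 0" if x: "x \<notin> (\<Union>c\<in>F. cball c (R c))" for x
    proof -
      have "f c x = 0" if c: "c \<in> F" for c
      proof -
        have "R c \<le> dist c x" using x c by (simp add: less_imp_le not_le)
        then show ?thesis using R[of c] c F(1) by blast
      qed
      then show ?thesis by (simp add: \<beta>_def)
    qed
  qed
qed

text \<open>The inner set comes from an open set around the complement of \<open>X\<close>, whose
  own complement is closed and is cut off by a large ball. These two errors and that of
  \<open>Y\<close> are each kept below \<epsilon>/3.\<close>

lemma lborel_compact_open_approximation:
  fixes X :: "'a::euclidean_space set"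
  assumes X: "X \<in> sets borel" "emeasure lborel X < \<infinity>" and \<epsilon>: "\<epsilon> > (0::real)"
  obtains K Y where "compact K" "open Y" "K \<subseteq> X" "X \<subseteq> Y" "emeasure lborel (Y - K) < ennreal \<epsilon>"
proof -
  have e3: "\<epsilon> / 3 > 0" using \<epsilon> by simp
  have "- X \<in> sets borel" using X(1) by simp
  then obtain U where U: "open U" "- X \<subseteq> U" "emeasure lborel (U - - X) < ennreal (\<epsilon> / 3)"
    using outer_regular_lborel[OF _ e3] by metis
  obtain Y where Y: "open Y" "X \<subseteq> Y" "emeasure lborel (Y - X) < ennreal (\<epsilon> / 3)"
    using outer_regular_lborel[OF X(1) e3] by metis
  define T where "T = - U"
  have T: "closed T" "T \<subseteq> X" "X - T = U - - X" using U by (auto simp: T_def)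
  have Tm: "T \<in> sets borel" using T(1) by simp
  have "(\<lambda>n. emeasure lborel (T - cball 0 (real n))) \<longlonglongrightarrow> emeasure lborel (\<Inter>n. T - cball 0 (real n))"
  proof (rule Lim_emeasure_decseq)
    show "decseq (\<lambda>n. T - cball 0 (real n))" by (auto simp: decseq_def)
    have "emeasure lborel (T - cball 0 (real n)) \<le> emeasure lborel X" for n
      using T X by (intro emeasure_mono) auto
    then show "emeasure lborel (T - cball 0 (real n)) \<noteq> \<infinity>" for n
      using X(2) by (metis infinity_ennreal_def leD)
  qed (use Tm in auto)
  moreover have "(\<Inter>n. T - cball 0 (real n)) = {}"
  proof -
    have "\<exists>n::nat. x \<in> cball 0 (real n)" for x :: 'a using real_arch_simple[of "norm x"] by auto
    then show ?thesis by blast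
  qed
  ultimately have "(\<lambda>n. emeasure lborel (T - cball 0 (real n))) \<longlonglongrightarrow> 0" by (simp only: emeasure_empty)
  then have "\<forall>\<^sub>F n in sequentially. emeasure lborel (T - cball 0 (real n)) < ennreal (\<epsilon> / 3)"
    by (rule order_tendstoD) (use e3 in simp)
  from eventually_happens'[OF sequentially_bot this]
  obtain n :: nat where n: "emeasure lborel (T - cball 0 (real n)) < ennreal (\<epsilon> / 3)" ..
  let ?K = "T \<inter> cball 0 (real n)"
  show ?thesis
  proof (rule that[of ?K Y])
    show "compact ?K" using T(1) by (rule closed_Int_compact) simp
    show "?K \<subseteq> X" using T by auto
    have "emeasure lborel (Y - ?K) \<le> emeasure lborel ((Y - X) \<union> ((U - - X) \<union> (T - cball 0 (real n))))"
      using Y X Tm U by (intro emeasure_mono) (auto simp: T_def)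
    also have "\<dots> \<le> emeasure lborel (Y - X) + emeasure lborel ((U - - X) \<union> (T - cball 0 (real n)))"
      using Y X Tm U by (intro emeasure_subadditive) auto
    also have "\<dots> \<le> emeasure lborel (Y - X) + (emeasure lborel (U - - X) + emeasure lborel (T - cball 0 (real n)))"
      using Y X Tm U by (intro add_left_mono emeasure_subadditive) auto
    also have "\<dots> < ennreal (\<epsilon> / 3) + (ennreal (\<epsilon> / 3) + ennreal (\<epsilon> / 3))"
      by (intro add_strict_mono Y(3) U(3) n)
    also have "\<dots> = ennreal \<epsilon>" using e3 by (simp add: ennreal_plus[symmetric] del: ennreal_plus)
    finally show "emeasure lborel (Y - ?K) < ennreal \<epsilon>" .
  qed (use Y in auto)
qed

context carnot_coordinates
begin

section \<open>Perimeter and test functions in exponential coordinates\<close>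

lemma mul_measurable [measurable]:
  assumes "f \<in> borel_measurable M" "g \<in> borel_measurable M"
  shows "(\<lambda>z. mul (f z) (g z)) \<in> borel_measurable M"
  by (rule borel_measurable_continuous_Pair[OF assms]) (intro continuous_on_mul continuous_intros)

text \<open>The test field has the extension of \<beta> as component \<open>i\<close> and zeros
  elsewhere, so its length bound is the bound on \<beta>. Haar measure is a completion;
  \<open>B\<close> is therefore replaced by \<open>main_part\<close>, a Borel set that differs from
  it by a null set.\<close>

lemma perimeter_ge:
  assumes B: "B \<in> sets (haar A L)" and t: "test_fun \<beta> D" and le: "\<And>x. \<bar>\<beta> x\<bar> \<le> 1" and i: "i \<in> {1..m}"
  shows "ereal (\<integral>x. indicator (E -` main_part (distr lborel borel E) B) x * D (e i) x \<partial>lborel) \<le> P_H A L m e B UNIV"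
proof -
  define M where "M = distr lborel borel E"
  have Em [measurable]: "E \<in> borel_measurable lborel"
    using borel_measurable_continuous_onI[OF continuous_E] by simp
  have haar: "haar A L = completion M" by (simp add: haar_def M_def)
  define B' where "B' = main_part M B"
  have B': "B' \<in> sets borel" using B main_part_sets[of B M] by (simp add: haar B'_def M_def)
  obtain K where K: "compact K" "\<And>x. x \<notin> K \<Longrightarrow> \<beta> x = 0" using t by (auto simp: test_fun_def)
  have Dc: "continuous_on UNIV (D y)" for y using t by (auto simp: test_fun_def)
  have cb: "continuous_compact_support UNIV (ext_log \<beta>)"
    by (rule ext_log_compact_support[OF _ K]) (use t in \<open>auto simp: test_fun_def\<close>)
  have cD: "continuous_compact_support UNIV (ext_log (D y))" for y
    by (rule ext_log_compact_support[OF Dc K(1) test_fun_D_support[OF t K]])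
  have c0: "continuous_compact_support UNIV (\<lambda>_::'g. 0::real)" by (simp add: continuous_compact_support_def)
  have l0: "has_lie_deriv A L y (\<lambda>_. 0)" "lie_deriv A L y (\<lambda>_. 0) = (\<lambda>_. 0)" for y
    by (auto simp: has_lie_deriv_def lie_deriv_def fun_eq_iff)
  define \<zeta> where "\<zeta> k = (if k = i then ext_log \<beta> else (\<lambda>_. 0))" for k
  have one: "(\<Sum>k=1..m. F k) = F i" if "\<And>k. k \<noteq> i \<Longrightarrow> F k = 0" for F :: "nat \<Rightarrow> real"
    using i that by (subst sum.mono_neutral_right[of "{1..m}" "{i}"]) auto
  have "\<zeta> \<in> test_fields A L m e UNIV"
    unfolding test_fields_def
  proof (intro CollectI conjI ballI)
    show "continuous_compact_support UNIV (\<zeta> k)" for k using cb c0 by (simp add: \<zeta>_def)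
    show "has_lie_deriv A L (e j) (\<zeta> k)" for k j using ext_log_lie_deriv(1)[OF t] l0 by (simp add: \<zeta>_def)
    show "continuous_compact_support UNIV (lie_deriv A L (e j) (\<zeta> k))" for k j
      using ext_log_lie_deriv(2)[OF t] cD l0 c0 by (simp add: \<zeta>_def)
    fix g
    have "(\<Sum>k=1..m. (\<zeta> k g)\<^sup>2) = (\<zeta> i g)\<^sup>2" by (rule one) (simp add: \<zeta>_def)
    moreover have "\<bar>\<zeta> i g\<bar> \<le> 1" using le by (simp add: \<zeta>_def ext_log_def)
    ultimately show "sqrt (\<Sum>k=1..m. (\<zeta> k g)\<^sup>2) \<le> 1" by simp
  qed
  then have "ereal (LINT g:UNIV|haar A L. indicator B g * (\<Sum>k=1..m. lie_deriv A L (e k) (\<zeta> k) g)) \<le> P_H A L m e B UNIV"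
    unfolding P_H_def Var_H_def by (rule SUP_upper)
  moreover have "(LINT g:UNIV|haar A L. indicator B g * (\<Sum>k=1..m. lie_deriv A L (e k) (\<zeta> k) g))
     = (\<integral>x. indicator (E -` B') x * D (e i) x \<partial>lborel)"
  proof -
    have s: "(\<Sum>k=1..m. lie_deriv A L (e k) (\<zeta> k) g) = ext_log (D (e i)) g" for g
    proof -
      have "(\<Sum>k=1..m. lie_deriv A L (e k) (\<zeta> k) g) = lie_deriv A L (e i) (\<zeta> i) g"
        by (rule one) (simp add: \<zeta>_def l0)
      then show ?thesis by (simp add: \<zeta>_def ext_log_lie_deriv(2)[OF t])
    qed
    have Fm: "ext_log (D (e i)) \<in> borel_measurable borel"
      using cD[of "e i"] by (intro borel_measurable_continuous_onI) (simp add: continuous_compact_support_def)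
    then have FM: "ext_log (D (e i)) \<in> borel_measurable M" by (simp add: M_def)
    have iM: "(\<lambda>g. indicator B' g * ext_log (D (e i)) g) \<in> borel_measurable M"
      using FM B' by (auto simp: M_def)
    have "(LINT g:UNIV|haar A L. indicator B g * (\<Sum>k=1..m. lie_deriv A L (e k) (\<zeta> k) g))
      = (\<integral>g. indicator B g * ext_log (D (e i)) g \<partial>completion M)"
      by (simp only: set_lebesgue_integral_def s haar) simp
    also have "\<dots> = (\<integral>g. indicator B' g * ext_log (D (e i)) g \<partial>completion M)"
    proof (rule integral_cong_AE)
      show "(\<lambda>g. indicator B g * ext_log (D (e i)) g) \<in> borel_measurable (completion M)"
        using B measurable_completion[OF FM] by (auto simp: haar)
      show "(\<lambda>g. indicator B' g * ext_log (D (e i)) g) \<in> borel_measurable (completion M)"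
        by (rule measurable_completion[OF iM])
      have "B \<in> sets (completion M)" using B by (simp add: haar)
      from null_part[OF this] obtain N where N: "N \<in> null_sets M" "null_part M B \<subseteq> N" by blast
      have "AE g in M. g \<notin> N" using N(1) by (rule AE_not_in)
      then have "AE g in completion M. g \<notin> N" by (rule AE_completion)
      then show "AE g in completion M. indicator B g * ext_log (D (e i)) g = indicator B' g * ext_log (D (e i)) g"
      proof eventually_elim
        case (elim g)
        then have "g \<in> B \<longleftrightarrow> g \<in> B'"
          using N(2) main_part_null_part_Un[OF \<open>B \<in> sets (completion M)\<close>] by (auto simp: B'_def)
        then show ?case by (simp add: indicator_def)
      qed
    qed
    also have "\<dots> = (\<integral>g. indicator B' g * ext_log (D (e i)) g \<partial>M)" by (rule integral_completion[OF iM])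
    also have "\<dots> = (\<integral>x. indicator B' (E x) * ext_log (D (e i)) (E x) \<partial>lborel)"
      unfolding M_def by (rule integral_distr[OF Em]) (use iM in \<open>simp add: M_def\<close>)
    also have "\<dots> = (\<integral>x. indicator (E -` B') x * D (e i) x \<partial>lborel)"
      by (simp add: indicator_def vimage_def)
    finally show ?thesis .
  qed
  ultimately show ?thesis by (simp add: B'_def M_def)
qed

lemma test_fun_approximation:
  assumes X: "X \<in> sets borel" "emeasure lborel X < \<infinity>" and \<epsilon>: "\<epsilon> > (0::real)"
  shows "\<exists>\<beta> D. test_fun \<beta> D \<and> (\<forall>x. 0 \<le> \<beta> x) \<and> (\<forall>x. \<beta> x \<le> 1) \<and> integrable lborel \<beta> \<and>
    (\<integral>x. \<bar>\<beta> x - indicator X x\<bar> \<partial>lborel) \<le> \<epsilon>"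
proof -
  obtain K Y where KY: "compact K" "open Y" "K \<subseteq> X" "X \<subseteq> Y" "emeasure lborel (Y - K) < ennreal \<epsilon>"
    using lborel_compact_open_approximation[OF X \<epsilon>] by metis
  obtain \<beta> :: "'v \<Rightarrow> real" and K' where b: "Ck_on (Suc 0) \<beta> UNIV" "\<And>x. 0 \<le> \<beta> x" "\<And>x. \<beta> x \<le> 1" "\<And>x. x \<in> K \<Longrightarrow> \<beta> x = 1"
    "compact K'" "K' \<subseteq> Y" "\<And>x. x \<notin> K' \<Longrightarrow> \<beta> x = 0"
    using compact_C1_cutoff[OF KY(1,2) subset_trans[OF KY(3,4)]] by metis
  obtain D where D: "test_fun \<beta> D" using test_fun_C1[OF b(1,5,7)] by blast
  have bm: "\<beta> \<in> borel_measurable borel" using Ck_on_imp_continuous_on[OF b(1)] by (rule borel_measurable_continuous_onI)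
  have Km: "K \<in> sets borel" "K' \<in> sets borel" "Y \<in> sets borel" using KY(1,2) b(5) by (auto intro: borel_compact)
  have ib: "integrable lborel \<beta>"
  proof (rule Bochner_Integration.integrable_bound[of _ "indicator K' :: 'v \<Rightarrow> real"])
    show "integrable lborel (indicator K' :: 'v \<Rightarrow> real)"
      using Km(2) emeasure_bounded_finite[OF compact_imp_bounded[OF b(5)]] by (simp add: integrable_indicator_iff)
    show "AE x in lborel. norm (\<beta> x) \<le> norm (indicator K' x :: real)"
      using b(2,3,7) by (intro AE_I2) (auto simp: indicator_def)
  qed (use bm in simp)
  have iYK: "integrable lborel (indicator (Y - K) :: 'v \<Rightarrow> real)"
    using Km KY(5) by (auto simp: integrable_indicator_iff intro: less_trans)
  have "(\<integral>x. \<bar>\<beta> x - indicator X x\<bar> \<partial>lborel) \<le> (\<integral>x. indicator (Y - K) x \<partial>lborel)"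
  proof (rule integral_mono_AE')
    show "AE x in lborel. \<bar>\<beta> x - indicator X x\<bar> \<le> (indicator (Y - K) x :: real)"
    proof (rule AE_I2)
      fix x
      show "\<bar>\<beta> x - indicator X x\<bar> \<le> (indicator (Y - K) x :: real)"
        using b(2,3)[of x] b(4)[of x] b(7)[of x] b(6) KY(3,4) by (auto simp: indicator_def)
    qed
  qed (use iYK in auto)
  also have "\<dots> = measure lborel (Y - K)" by simp
  also have "\<dots> \<le> \<epsilon>" using KY(5) \<epsilon> by (simp add: measure_def enn2real_leI)
  finally show ?thesis using D b(2,3) ib by blast
qed

section \<open>Mass lost under right translation, with a real number \<open>p\<close> bounding the
  horizontal perimeter\<close>

context
  fixes X :: "'v set" and p :: real
  assumes Xm [measurable]: "X \<in> sets borel" and Xf: "emeasure lborel X < \<infinity>" and p0: "0 \<le> p"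
    and bound: "\<And>\<beta> D i. test_fun \<beta> D \<Longrightarrow> (\<And>x. \<bar>\<beta> x\<bar> \<le> 1) \<Longrightarrow> i \<in> {1..m} \<Longrightarrow>
      (\<integral>x. indicator X x * D (e i) x \<partial>lborel) \<le> p"
begin

lemma integrable_indicator_X: "integrable lborel (indicator X :: 'v \<Rightarrow> real)"
  using Xf by (simp add: integrable_indicator_iff)

text \<open>Differentiate \<Phi>(s), the integral over \<open>X\<close> of \<beta> at x exp(s e_i).
  The derivative is again an integral bounded by \<open>p\<close>, now for a right translate of
  \<beta>: the direction stays \<open>e i\<close>, which \<open>Ad\<close> of its own subgroup
  fixes.\<close>

lemma flow_bound:
  assumes t: "test_fun \<beta> D" and le: "\<And>x. \<bar>\<beta> x\<bar> \<le> 1" and i: "i \<in> {1..m}"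
  shows "(\<integral>x. indicator X x * (\<beta> x - \<beta> (mul x (t *\<^sub>R e i))) \<partial>lborel) \<le> \<bar>t\<bar> * p"
proof -
  have bm [measurable]: "\<beta> \<in> borel_measurable borel" and Dm [measurable]: "D (e i) \<in> borel_measurable borel"
    using t by (auto simp: test_fun_def intro: borel_measurable_continuous_onI)
  obtain K where K: "compact K" "\<And>x. x \<notin> K \<Longrightarrow> \<beta> x = 0" using t by (auto simp: test_fun_def)
  have "bounded (D (e i) ` K)"
    using t K(1) by (intro compact_imp_bounded compact_continuous_image)
      (auto simp: test_fun_def intro: continuous_on_subset)
  then obtain M0 where M0: "\<And>x. x \<in> K \<Longrightarrow> \<bar>D (e i) x\<bar> \<le> M0" by (auto simp: bounded_iff)
  have M: "\<bar>D (e i) x\<bar> \<le> \<bar>M0\<bar>" for x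
    using M0[of x] test_fun_D_support[OF t K, of x "e i"] by (cases "x \<in> K") auto
  define F where "F s x = \<beta> (mul x (s *\<^sub>R e i))" for s x
  define F' where "F' s x = D (e i) (mul x (s *\<^sub>R e i))" for s x
  have Fm [measurable]: "F s \<in> borel_measurable borel" "F' s \<in> borel_measurable borel" for s
    unfolding F_def F'_def by measurable
  have FF': "((\<lambda>s. F s x) has_real_derivative F' s x) (at s)" for s x
    unfolding F_def F'_def by (rule test_fun_derivative[OF t])
  have int: "integrable lborel (\<lambda>x. indicator X x * h x)" if "h \<in> borel_measurable borel" "\<And>x. \<bar>h x\<bar> \<le> c" for h :: "'v \<Rightarrow> real" and c
  proof (rule Bochner_Integration.integrable_bound[of _ "\<lambda>x. c * indicator X x"])
    show "integrable lborel (\<lambda>x. c * indicator X x)" using integrable_indicator_X by simp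
    show "AE x in lborel. norm (indicator X x * h x) \<le> norm (c * indicator X x)"
      using that(2) by (intro AE_I2) (auto simp: indicator_def intro: order_trans[OF _ abs_ge_self])
  qed (use that in measurable)
  have intF: "integrable lborel (\<lambda>x. indicator X x * F s x)" for s
    by (rule int[of _ 1]) (use le in \<open>auto simp: F_def\<close>)
  define \<Phi> where "\<Phi> s = (\<integral>x. indicator X x * F s x \<partial>lborel)" for s
  have D\<Phi>: "(\<Phi> has_real_derivative (\<integral>x. indicator X x * F' s x \<partial>lborel)) (at s)" for s
    unfolding has_field_derivative_iff tendsto_at_iff_sequentially
  proof (intro allI impI)
    fix a :: "nat \<Rightarrow> real" assume a: "\<forall>n. a n \<in> UNIV - {s}" "a \<longlonglongrightarrow> s"
    let ?q = "\<lambda>n x. indicator X x * ((F (a n) x - F s x) / (a n - s))"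
    have "(\<lambda>n. \<integral>x. ?q n x \<partial>lborel) \<longlonglongrightarrow> (\<integral>x. indicator X x * F' s x \<partial>lborel)"
    proof (rule integral_dominated_convergence[where w = "\<lambda>x. \<bar>M0\<bar> * indicator X x"])
      show "integrable lborel (\<lambda>x. \<bar>M0\<bar> * indicator X x)" using integrable_indicator_X by simp
      show "AE x in lborel. (\<lambda>n. ?q n x) \<longlonglongrightarrow> indicator X x * F' s x"
      proof (rule AE_I2)
        fix x
        have "((\<lambda>u. (F u x - F s x) / (u - s)) \<longlongrightarrow> F' s x) (at s)"
          using FF' by (simp add: has_field_derivative_iff)
        then have "(\<lambda>n. (F (a n) x - F s x) / (a n - s)) \<longlonglongrightarrow> F' s x"
          using a unfolding tendsto_at_iff_sequentially by (auto simp: o_def)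
        then show "(\<lambda>n. ?q n x) \<longlonglongrightarrow> indicator X x * F' s x" by (intro tendsto_mult tendsto_const)
      qed
      \<comment> \<open>By the mean value theorem each difference quotient is a value of the
        derivative, and those are bounded by |M0|.\<close>
      show "AE x in lborel. norm (?q n x) \<le> \<bar>M0\<bar> * indicator X x" for n
      proof (rule AE_I2)
        fix x
        obtain z where z: "F (a n) x - F s x = (a n - s) * F' z x" by (rule MVT_symmetric[OF FF'])
        have "a n - s \<noteq> 0" using a(1) by auto
        then have "(F (a n) x - F s x) / (a n - s) = F' z x" by (simp add: z)
        then show "norm (?q n x) \<le> \<bar>M0\<bar> * indicator X x" using M by (simp add: F'_def indicator_def)
      qed
    qed measurable
    moreover have "(\<integral>x. ?q n x \<partial>lborel) = (\<Phi> (a n) - \<Phi> s) / (a n - s)" for n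
    proof -
      have "(\<integral>x. ?q n x \<partial>lborel) = (\<integral>x. (indicator X x * F (a n) x - indicator X x * F s x) / (a n - s) \<partial>lborel)"
        by (simp add: algebra_simps diff_divide_distrib)
      also have "\<dots> = (\<Phi> (a n) - \<Phi> s) / (a n - s)"
        unfolding \<Phi>_def by (simp add: Bochner_Integration.integral_diff[OF intF intF])
      finally show ?thesis .
    qed
    ultimately have "(\<lambda>n. (\<Phi> (a n) - \<Phi> s) / (a n - s)) \<longlonglongrightarrow> (\<integral>x. indicator X x * F' s x \<partial>lborel)"
      by (simp only:)
    then show "((\<lambda>u. (\<Phi> u - \<Phi> s) / (u - s)) \<circ> a) \<longlonglongrightarrow> (\<integral>x. indicator X x * F' s x \<partial>lborel)"
      unfolding o_def .
  qed
  have D\<Phi>p: "\<bar>\<integral>x. indicator X x * F' s x \<partial>lborel\<bar> \<le> p" for s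
  proof -
    have "Ad (E (- (s *\<^sub>R e i))) (e i) = e i"
      using Ad_one_parameter_self[OF exp_one_parameter, of "- s" "e i"] by simp
    then have e: "D (Ad (E (- (s *\<^sub>R e i))) (e i)) (mul x (s *\<^sub>R e i)) = F' s x" for x by (simp add: F'_def)
    note tr = test_fun_right_translate[OF t, of "s *\<^sub>R e i"]
    have "(\<integral>x. indicator X x * F' s x \<partial>lborel) \<le> p"
      using bound[OF tr _ i] le by (simp add: e)
    moreover have "- (\<integral>x. indicator X x * F' s x \<partial>lborel) \<le> p"
      using bound[OF test_fun_uminus[OF tr] _ i] le by (simp add: e)
    ultimately show ?thesis by linarith
  qed
  obtain z where z: "\<Phi> t - \<Phi> 0 = (t - 0) * (\<integral>x. indicator X x * F' z x \<partial>lborel)"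
    by (rule MVT_symmetric[OF D\<Phi>])
  have "\<bar>\<Phi> t - \<Phi> 0\<bar> \<le> \<bar>t\<bar> * p"
    unfolding z abs_mult using D\<Phi>p by (intro mult_mono) auto
  moreover have "(\<integral>x. indicator X x * (\<beta> x - \<beta> (mul x (t *\<^sub>R e i))) \<partial>lborel) = \<Phi> 0 - \<Phi> t"
    unfolding \<Phi>_def by (subst Bochner_Integration.integral_diff[OF intF intF, symmetric]) (simp add: F_def algebra_simps)
  ultimately show ?thesis by linarith
qed

definition shift_loss :: "'v \<Rightarrow> real" where
  "shift_loss w = measure lborel {x \<in> X. mul x w \<notin> X}"

lemma shift_loss_sets [measurable]: "{x \<in> X. mul x w \<notin> X} \<in> sets borel"
proof -
  have "{x \<in> space borel. x \<in> X \<and> mul x w \<notin> X} \<in> sets borel" by measurable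
  then show ?thesis by simp
qed

lemma shift_loss_finite: "emeasure lborel {x \<in> X. mul x w \<notin> X} = ennreal (shift_loss w)"
proof -
  have "emeasure lborel {x \<in> X. mul x w \<notin> X} \<le> emeasure lborel X" by (intro emeasure_mono) auto
  then have "emeasure lborel {x \<in> X. mul x w \<notin> X} \<noteq> \<infinity>" using Xf by (metis infinity_ennreal_def leD)
  then show ?thesis by (simp add: shift_loss_def emeasure_eq_ennreal_measure)
qed

text \<open>Apply \<open>flow_bound\<close> to a \<beta> close to the indicator of \<open>X\<close>
  in L^1. On the lost set the indicator drops from 1 to 0, so \<beta> drops by 1 up to the errors at
  x and at x w; by right invariance these have the same integral, hence the \<epsilon>/2.\<close>

lemma shift_loss_step:
  assumes i: "i \<in> {1..m}" shows "shift_loss (t *\<^sub>R e i) \<le> \<bar>t\<bar> * p"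
proof (rule field_le_epsilon)
  fix \<epsilon> :: real assume "\<epsilon> > 0"
  then have "\<epsilon> / 2 > 0" by simp
  from test_fun_approximation[OF Xm Xf this]
  obtain \<beta> D where b: "test_fun \<beta> D" "\<And>x. 0 \<le> \<beta> x" "\<And>x. \<beta> x \<le> 1" "integrable lborel \<beta>"
    "(\<integral>x. \<bar>\<beta> x - indicator X x\<bar> \<partial>lborel) \<le> \<epsilon> / 2"
    by blast
  have bm [measurable]: "\<beta> \<in> borel_measurable borel"
    using b(1) by (auto simp: test_fun_def intro: borel_measurable_continuous_onI)
  define w where "w = t *\<^sub>R e i"
  define d where "d x = \<bar>\<beta> x - indicator X x\<bar>" for x
  have dm [measurable]: "d \<in> borel_measurable borel" unfolding d_def by measurable
  have di: "integrable lborel d" unfolding d_def by (intro integrable_abs Bochner_Integration.integrable_diff b(4) integrable_indicator_X)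
  have Rm [measurable]: "(\<lambda>x. mul x w) \<in> borel_measurable borel" by measurable
  have "integrable (distr lborel borel (\<lambda>x. mul x w)) d" using di by (simp add: mul_right_preserves_lborel)
  then have dRi: "integrable lborel (\<lambda>x. d (mul x w))" by (subst (asm) integrable_distr_eq) auto
  have "(\<integral>x. d x \<partial>distr lborel borel (\<lambda>x. mul x w)) = (\<integral>x. d (mul x w) \<partial>lborel)"
    by (rule integral_distr) auto
  then have dR: "(\<integral>x. d (mul x w) \<partial>lborel) = (\<integral>x. d x \<partial>lborel)" by (simp add: mul_right_preserves_lborel)
  let ?g = "\<lambda>x. indicator X x * (\<beta> x - \<beta> (mul x w))"
  have gi: "integrable lborel ?g"
  proof (rule Bochner_Integration.integrable_bound[OF integrable_indicator_X])
    show "AE x in lborel. norm (?g x) \<le> norm (indicator X x :: real)"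
    proof (rule AE_I2)
      fix x show "norm (?g x) \<le> norm (indicator X x :: real)"
        using b(2,3)[of x] b(2,3)[of "mul x w"] by (auto simp: indicator_def abs_le_iff)
    qed
  qed measurable
  have "shift_loss w = (\<integral>x. indicator {x \<in> X. mul x w \<notin> X} x \<partial>lborel)"
    by (simp add: shift_loss_def)
  also have "\<dots> \<le> (\<integral>x. ?g x + (d x + d (mul x w)) \<partial>lborel)"
  proof (rule integral_mono)
    show "integrable lborel (indicator {x \<in> X. mul x w \<notin> X} :: 'v \<Rightarrow> real)"
      using shift_loss_finite[of w] by (simp add: integrable_indicator_iff)
    show "integrable lborel (\<lambda>x. ?g x + (d x + d (mul x w)))" by (intro Bochner_Integration.integrable_add gi di dRi)
    fix x
    show "indicator {x \<in> X. mul x w \<notin> X} x \<le> ?g x + (d x + d (mul x w))"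
      using b(2,3)[of x] b(2,3)[of "mul x w"] by (auto simp: d_def indicator_def)
  qed
  also have "\<dots> = (\<integral>x. ?g x \<partial>lborel) + ((\<integral>x. d x \<partial>lborel) + (\<integral>x. d x \<partial>lborel))"
    by (simp only: Bochner_Integration.integral_add[OF gi Bochner_Integration.integrable_add[OF di dRi]]
        Bochner_Integration.integral_add[OF di dRi] dR)
  also have "\<dots> \<le> \<bar>t\<bar> * p + (\<epsilon> / 2 + \<epsilon> / 2)"
  proof (intro add_mono)
    show "(\<integral>x. ?g x \<partial>lborel) \<le> \<bar>t\<bar> * p"
      unfolding w_def by (rule flow_bound[OF b(1) _ i]) (use b(2,3) in \<open>simp add: abs_le_iff order_trans[OF _ b(2)]\<close>)
  qed (use b(5) in \<open>simp_all add: d_def\<close>)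
  finally show "shift_loss (t *\<^sub>R e i) \<le> \<bar>t\<bar> * p + \<epsilon>" by (simp add: w_def)
qed

text \<open>A point lost under the product is already lost under \<open>w\<close>, or
  \<open>w\<close> carries it to a point lost under \<open>w'\<close>. Right invariance measures the
  second kind.\<close>

lemma shift_loss_mul: "shift_loss (mul w w') \<le> shift_loss w + shift_loss w'"
proof -
  have "emeasure lborel {x \<in> X. mul x (mul w w') \<notin> X}
     \<le> emeasure lborel ({x \<in> X. mul x w \<notin> X} \<union> {x. mul x w \<in> {y \<in> X. mul y w' \<notin> X}})"
  proof (rule emeasure_mono)
    show "{x \<in> X. mul x (mul w w') \<notin> X} \<subseteq> {x \<in> X. mul x w \<notin> X} \<union> {x. mul x w \<in> {y \<in> X. mul y w' \<notin> X}}"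
      by (auto simp: mul_assoc)
    have "{x \<in> space borel. mul x w \<in> X \<and> mul (mul x w) w' \<notin> X} \<in> sets borel" by measurable
    then show "{x \<in> X. mul x w \<notin> X} \<union> {x. mul x w \<in> {y \<in> X. mul y w' \<notin> X}} \<in> sets lborel" by simp
  qed
  also have "\<dots> \<le> emeasure lborel {x \<in> X. mul x w \<notin> X} + emeasure lborel {x. mul x w \<in> {y \<in> X. mul y w' \<notin> X}}"
  proof (rule emeasure_subadditive)
    have "{x \<in> space borel. mul x w \<in> X \<and> mul (mul x w) w' \<notin> X} \<in> sets borel" by measurable
    then show "{x. mul x w \<in> {y \<in> X. mul y w' \<notin> X}} \<in> sets lborel" by simp
  qed simp
  also have "emeasure lborel {x. mul x w \<in> {y \<in> X. mul y w' \<notin> X}} = emeasure lborel {y \<in> X. mul y w' \<notin> X}"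
    by (rule emeasure_mul_right) simp
  finally have "ennreal (shift_loss (mul w w')) \<le> ennreal (shift_loss w + shift_loss w')"
    by (simp add: shift_loss_finite shift_loss_def)
  then show ?thesis by (subst (asm) ennreal_le_iff) (auto simp: shift_loss_def)
qed

lemma shift_loss_Gen:
  assumes s: "s > 0" shows "w \<in> Gen k \<Longrightarrow> shift_loss (dil s w) \<le> real k * s * p"
proof (induction k arbitrary: w)
  case 0
  then show ?case by (simp add: linear_0[OF linear_dil] shift_loss_def)
next
  case (Suc k)
  then obtain i x t where w: "w = mul x (t *\<^sub>R e i)" "i \<in> {1..m}" "x \<in> Gen k" "\<bar>t\<bar> \<le> 1" by auto
  have "shift_loss (dil s w) \<le> shift_loss (dil s x) + shift_loss ((s * t) *\<^sub>R e i)"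
    unfolding w(1) dil_mul_e[OF w(2)] by (rule shift_loss_mul)
  also have "\<dots> \<le> real k * s * p + \<bar>s * t\<bar> * p" by (intro add_mono Suc.IH w(3) shift_loss_step w(2))
  also have "\<bar>s * t\<bar> * p \<le> s * p"
    using w(4) s p0 by (intro mult_right_mono) (auto simp: abs_mult mult_left_le)
  finally show ?case by (simp add: algebra_simps)
qed

text \<open>Integrate over w in the dilated \<open>Gen k\<close>. For each w the lost part is at
  most k s p. The part that stays is enlarged by letting w range over the whole space; Fubini and
  left invariance then give a^2.\<close>

lemma averaging:
  fixes k :: nat
  assumes s: "s > 0"
  defines "a \<equiv> measure lborel X" and "g \<equiv> measure lborel (Gen k)" and "Q \<equiv> homogeneous_dimension r V"
  shows "a * (s ^ Q * g) \<le> real k * s * p * (s ^ Q * g) + a * a"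
proof -
  define G where "G = dil s ` Gen k"
  have dG: "dil s -` G = Gen k"
  proof -
    have "x = y" if "dil s x = dil s y" for x y
    proof -
      have "dil (1 / s) (dil s x) = dil (1 / s) (dil s y)" using that by simp
      then show ?thesis using s by (simp add: dil_dil dil_1)
    qed
    then show ?thesis by (auto simp: G_def)
  qed
  have Gc: "compact G"
    unfolding G_def using linear_dil
    by (intro compact_continuous_image linear_continuous_on compact_Gen) (simp add: linear_conv_bounded_linear)
  have Gm [measurable]: "G \<in> sets borel" by (rule borel_compact[OF Gc])
  have gf: "emeasure lborel (Gen k) = ennreal g"
    using emeasure_bounded_finite[OF compact_imp_bounded[OF compact_Gen[of k]]]
    by (simp add: g_def emeasure_eq_ennreal_measure)
  have eG: "emeasure lborel G = ennreal (s ^ Q * g)"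
    using dil_emeasure[OF s Gm] s by (simp add: dG gf Q_def ennreal_mult[symmetric] g_def)
  have eX: "emeasure lborel X = ennreal a" using Xf by (simp add: a_def emeasure_eq_ennreal_measure)
  have N: "(\<integral>\<^sup>+x. indicator X x * indicator (- X) (mul x w) \<partial>lborel) = ennreal (shift_loss w)" for w
  proof -
    have "(\<integral>\<^sup>+x. indicator X x * indicator (- X) (mul x w) \<partial>lborel) = (\<integral>\<^sup>+x. indicator {x \<in> X. mul x w \<notin> X} x \<partial>lborel)"
      by (intro nn_integral_cong) (auto simp: indicator_def)
    then show ?thesis by (simp add: shift_loss_finite)
  qed
  have "emeasure lborel X * emeasure lborel G = (\<integral>\<^sup>+w. indicator G w * (\<integral>\<^sup>+x. indicator X x \<partial>lborel) \<partial>lborel)"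
    by (simp add: nn_integral_multc mult.commute)
  also have "\<dots> \<le> (\<integral>\<^sup>+w. indicator G w * (\<integral>\<^sup>+x. indicator X x * indicator (- X) (mul x w) \<partial>lborel)
      + (\<integral>\<^sup>+x. indicator X x * indicator X (mul x w) \<partial>lborel) \<partial>lborel)"
  proof (rule nn_integral_mono)
    fix w
    have "(\<integral>\<^sup>+x. indicator X x \<partial>lborel) = (\<integral>\<^sup>+x. indicator X x * indicator (- X) (mul x w) + indicator X x * indicator X (mul x w) \<partial>lborel)"
      by (intro nn_integral_cong) (auto simp: indicator_def)
    also have "\<dots> = (\<integral>\<^sup>+x. indicator X x * indicator (- X) (mul x w) \<partial>lborel) + (\<integral>\<^sup>+x. indicator X x * indicator X (mul x w) \<partial>lborel)"
      by (intro nn_integral_add) measurable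
    finally have "indicator G w * (\<integral>\<^sup>+x. indicator X x \<partial>lborel) = indicator G w * (\<integral>\<^sup>+x. indicator X x * indicator (- X) (mul x w) \<partial>lborel)
       + indicator G w * (\<integral>\<^sup>+x. indicator X x * indicator X (mul x w) \<partial>lborel)"
      by (simp only: distrib_left)
    also have "\<dots> \<le> indicator G w * (\<integral>\<^sup>+x. indicator X x * indicator (- X) (mul x w) \<partial>lborel)
       + (\<integral>\<^sup>+x. indicator X x * indicator X (mul x w) \<partial>lborel)"
      by (intro add_left_mono) (auto simp: indicator_def)
    finally show "indicator G w * (\<integral>\<^sup>+x. indicator X x \<partial>lborel) \<le> indicator G w * (\<integral>\<^sup>+x. indicator X x * indicator (- X) (mul x w) \<partial>lborel)
       + (\<integral>\<^sup>+x. indicator X x * indicator X (mul x w) \<partial>lborel)" .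
  qed
  also have "\<dots> = (\<integral>\<^sup>+w. indicator G w * (\<integral>\<^sup>+x. indicator X x * indicator (- X) (mul x w) \<partial>lborel) \<partial>lborel)
      + (\<integral>\<^sup>+w. (\<integral>\<^sup>+x. indicator X x * indicator X (mul x w) \<partial>lborel) \<partial>lborel)"
    by (intro nn_integral_add) measurable
  also have "(\<integral>\<^sup>+w. indicator G w * (\<integral>\<^sup>+x. indicator X x * indicator (- X) (mul x w) \<partial>lborel) \<partial>lborel)
      \<le> (\<integral>\<^sup>+w. ennreal (real k * s * p) * indicator G w \<partial>lborel)"
  proof (rule nn_integral_mono)
    fix w
    show "indicator G w * (\<integral>\<^sup>+x. indicator X x * indicator (- X) (mul x w) \<partial>lborel) \<le> ennreal (real k * s * p) * indicator G w"
      unfolding N using shift_loss_Gen[OF s] by (auto simp: indicator_def G_def intro!: ennreal_leI)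
  qed
  also have "(\<integral>\<^sup>+w. ennreal (real k * s * p) * indicator G w \<partial>lborel) = ennreal (real k * s * p) * emeasure lborel G"
    by (simp add: nn_integral_cmult)
  also have "(\<integral>\<^sup>+w. (\<integral>\<^sup>+x. indicator X x * indicator X (mul x w) \<partial>lborel) \<partial>lborel)
      = (\<integral>\<^sup>+x. (\<integral>\<^sup>+w. indicator X x * indicator X (mul x w) \<partial>lborel) \<partial>lborel)"
    by (rule lborel_pair.Fubini') measurable
  also have "\<dots> = (\<integral>\<^sup>+x. indicator X x * emeasure lborel X \<partial>lborel)"
  proof (rule nn_integral_cong)
    fix x
    have "(\<integral>\<^sup>+w. indicator X (mul x w) \<partial>lborel) = (\<integral>\<^sup>+w. indicator {w. mul x w \<in> X} w \<partial>lborel)"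
      by (intro nn_integral_cong) (auto simp: indicator_def)
    also have "\<dots> = emeasure lborel {w. mul x w \<in> X}"
    proof (rule nn_integral_indicator)
      have "{w \<in> space borel. mul x w \<in> X} \<in> sets borel" by measurable
      then show "{w. mul x w \<in> X} \<in> sets lborel" by simp
    qed
    also have "\<dots> = emeasure lborel X" by (rule emeasure_mul_left[OF Xm])
    finally show "(\<integral>\<^sup>+w. indicator X x * indicator X (mul x w) \<partial>lborel) = indicator X x * emeasure lborel X"
      by (subst nn_integral_cmult) auto
  qed
  also have "\<dots> = emeasure lborel X * emeasure lborel X" by (simp add: nn_integral_multc)
  finally have "ennreal a * ennreal (s ^ Q * g) \<le> ennreal (real k * s * p) * ennreal (s ^ Q * g) + ennreal a * ennreal a"
    unfolding eX eG by (simp add: add_mono)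
  then have "ennreal (a * (s ^ Q * g)) \<le> ennreal (real k * s * p * (s ^ Q * g) + a * a)"
    using s p0 by (simp add: ennreal_mult[symmetric] ennreal_plus[symmetric] a_def g_def del: ennreal_plus)
  then show ?thesis
    using s p0 by (subst (asm) ennreal_le_iff) (auto simp: a_def g_def)
qed

end

section \<open>Choice of the scale and of the constant\<close>

lemma homogeneous_dimension_pos: "homogeneous_dimension r V > 0"
proof (rule ccontr)
  assume "\<not> ?thesis"
  then have z: "dim (V j) = 0" if "j \<in> {1..r}" for j using that by (auto simp: homogeneous_dimension_def)
  have "pr j x = 0" for j and x :: 'v
  proof (cases "j \<in> {1..r}")
    case True
    then show ?thesis using z[OF True] pr_in[OF True, of x] by (auto simp: dim_eq_0)
  qed (rule pr_outside)
  then have "x = 0" for x :: 'v using pr_sum[of x] by simp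
  then show False using nonzero_Basis SOME_Basis by blast
qed

lemma isoperimetric_coordinates:
  "\<exists>C>0. \<forall>X p. X \<in> sets borel \<longrightarrow> emeasure lborel X < \<infinity> \<longrightarrow> 0 \<le> p \<longrightarrow>
     (\<forall>\<beta> D i. test_fun \<beta> D \<longrightarrow> (\<forall>x. \<bar>\<beta> x\<bar> \<le> 1) \<longrightarrow> i \<in> {1..m} \<longrightarrow> (\<integral>x. indicator X x * D (e i) x \<partial>lborel) \<le> p) \<longrightarrow>
     measure lborel X powr ((real (homogeneous_dimension r V) - 1) / real (homogeneous_dimension r V)) \<le> C * p"
proof -
  define Q where "Q = homogeneous_dimension r V"
  have Q: "Q > 0" unfolding Q_def by (rule homogeneous_dimension_pos)
  \<comment> \<open>Countably many sets \<open>Gen k\<close> cover the space, so they cannot all be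
    null. The index found here is fixed before \<open>X\<close> is.\<close>
  have "\<exists>k. emeasure lborel (Gen k) \<noteq> 0"
  proof (rule ccontr)
    assume "\<not> ?thesis"
    then have "(\<Union>k. Gen k) \<in> null_sets lborel"
      using borel_compact[OF compact_Gen] by (intro null_sets_UN) (auto simp: null_sets_def)
    then have "emeasure lborel (UNIV :: 'v set) = 0" using H_UNIV by (simp add: H_def null_sets_def)
    then show False by (simp add: emeasure_lborel_UNIV)
  qed
  then obtain k where k: "emeasure lborel (Gen k) \<noteq> 0" by blast
  define g where "g = measure lborel (Gen k)"
  have g: "g > 0"
  proof -
    have "emeasure lborel (Gen k) = ennreal g"
      using emeasure_bounded_finite[OF compact_imp_bounded[OF compact_Gen[of k]]]
      by (simp add: g_def emeasure_eq_ennreal_measure)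
    then show ?thesis using k by (simp add: g_def zero_less_measure_iff)
  qed
  \<comment> \<open>Substituting s = (2a/g)^(1/Q) into a \<le> 2 k s p gives the first summand; the
    1 makes \<open>C\<close> positive at once.\<close>
  define C where "C = 2 * real k * (2 / g) powr (1 / real Q) + 1"
  have C: "C > 0" unfolding C_def by (intro add_nonneg_pos) auto
  have "measure lborel X powr ((real Q - 1) / real Q) \<le> C * p"
    if X: "X \<in> sets borel" "emeasure lborel X < \<infinity>" and p: "0 \<le> p"
      and bound: "\<forall>\<beta> D i. test_fun \<beta> D \<longrightarrow> (\<forall>x. \<bar>\<beta> x\<bar> \<le> 1) \<longrightarrow> i \<in> {1..m} \<longrightarrow> (\<integral>x. indicator X x * D (e i) x \<partial>lborel) \<le> p" for X p
  proof (cases "measure lborel X = 0")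
    \<comment> \<open>\<open>powr\<close> with base 0 is 0 for every exponent, also for the exponent
      0 that occurs when Q = 1.\<close>
    case True
    then show ?thesis using C p by simp
  next
    case False
    define a where "a = measure lborel X"
    have a: "a > 0" using False by (simp add: a_def less_le)
    text \<open>The scale at which the averaging set has twice the volume of \<open>X\<close>.\<close>
    define s where "s = root Q (2 * a / g)"
    have s: "s > 0" using a g Q by (simp add: s_def)
    have sQ: "s ^ Q = 2 * a / g" unfolding s_def using a g Q by (intro real_root_pow_pos2) auto
    have "a * (s ^ Q * g) \<le> real k * s * p * (s ^ Q * g) + a * a"
      unfolding a_def g_def Q_def by (rule averaging[OF X p _ s]) (use bound in blast)
    then have "a * (2 * a) \<le> real k * s * p * (2 * a) + a * a" using sQ g by simp
    then have "a * a \<le> (2 * (real k * s * p)) * a" by (simp add: algebra_simps)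
    then have 1: "a \<le> 2 * (real k * s * p)" using a by (simp add: mult_le_cancel_right)
    have s': "s = (2 / g) powr (1 / real Q) * a powr (1 / real Q)"
      using a g Q by (simp add: s_def root_powr_inverse powr_mult[symmetric])
    have "a powr ((real Q - 1) / real Q) = a / a powr (1 / real Q)"
      using a Q by (simp add: powr_diff diff_divide_distrib)
    also have "\<dots> \<le> 2 * (real k * s * p) / a powr (1 / real Q)" using 1 by (intro divide_right_mono) auto
    also have "\<dots> = 2 * real k * (2 / g) powr (1 / real Q) * p" using a by (simp add: s')
    also have "\<dots> \<le> C * p" using p by (intro mult_right_mono) (auto simp: C_def)
    finally show ?thesis by (simp add: a_def)
  qed
  then show ?thesis unfolding Q_def[symmetric] using C by blast
qed

end

lemma P_H_nonneg: "0 \<le> P_H A L m e B UNIV"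
proof -
  have "(\<lambda>_ _. 0) \<in> test_fields A L m e UNIV"
    by (auto simp: test_fields_def continuous_compact_support_def has_lie_deriv_def lie_deriv_def[abs_def])
  then have "ereal (LINT g:UNIV|haar A L. indicator B g * (\<Sum>i=1..m. lie_deriv A L (e i) ((\<lambda>_ _. 0) i) g)) \<le> P_H A L m e B UNIV"
    unfolding P_H_def Var_H_def by (rule SUP_upper)
  then show ?thesis by (simp add: lie_deriv_def set_lebesgue_integral_def zero_ereal_def)
qed

text \<open>Haar measurable sets are Borel only up to null sets; their Borel part is what can be
  pulled back to exponential coordinates.\<close>

lemma (in nilpotent_lie_group_algebra) haar_main_part:
  assumes B: "B \<in> sets (haar A L)"
  shows "E -` main_part (distr lborel borel E) B \<in> sets borel"
    and "emeasure (haar A L) B = emeasure lborel (E -` main_part (distr lborel borel E) B)"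
proof -
  have Em: "E \<in> borel_measurable lborel" using continuous_E by (simp add: borel_measurable_continuous_onI)
  have B': "B \<in> sets (completion (distr lborel borel E))" using B by (simp add: haar_def)
  have m: "main_part (distr lborel borel E) B \<in> sets borel" using main_part_sets[OF B'] by simp
  show "E -` main_part (distr lborel borel E) B \<in> sets borel"
    using measurable_sets[OF Em m] by simp
  show "emeasure (haar A L) B = emeasure lborel (E -` main_part (distr lborel borel E) B)"
    unfolding haar_def emeasure_completion[OF B'] by (subst emeasure_distr[OF Em m]) simp
qed

theorem theorem1p5:
  fixes A :: "('g::{topological_group_add, t2_space, second_countable_topology},
               'm::euclidean_space) chart set"
    and L :: "'v::euclidean_space \<Rightarrow> ('g \<Rightarrow> real) \<Rightarrow> ('g \<Rightarrow> real)"
    and V :: "nat \<Rightarrow> 'v set" and e :: "nat \<Rightarrow> 'v" and r m Q :: nat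
  assumes "carnot_group A L r V"
    and "m = dim (V 1)" and "orthonormal_basis m e (V 1)"
    and "Q = homogeneous_dimension r V"
  shows "\<exists>C>0. \<forall>E. H_Caccioppoli A L m e E \<and> emeasure (haar A L) E < \<infinity> \<longrightarrow>
           ereal (measure (haar A L) E powr ((real Q - 1) / real Q))
             \<le> ereal C * P_H A L m e E UNIV"
proof (cases "inj (lie_exp A L)")
  case True
  interpret carnot_coordinates A L r V m e
    by unfold_locales (use assms True in \<open>auto simp: carnot_group_def orthonormal_basis_def\<close>)
  obtain C where C: "C > 0" and iso: "\<forall>X p. X \<in> sets borel \<longrightarrow> emeasure lborel X < \<infinity> \<longrightarrow> 0 \<le> p \<longrightarrow>
     (\<forall>\<beta> D i. test_fun \<beta> D \<longrightarrow> (\<forall>x. \<bar>\<beta> x\<bar> \<le> 1) \<longrightarrow> i \<in> {1..m} \<longrightarrow> (\<integral>x. indicator X x * D (e i) x \<partial>lborel) \<le> p) \<longrightarrow>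
     measure lborel X powr ((real Q - 1) / real Q) \<le> C * p"
    using isoperimetric_coordinates unfolding assms(4) by blast
  have "ereal (measure (haar A L) B powr ((real Q - 1) / real Q)) \<le> ereal C * P_H A L m e B UNIV"
    if B: "B \<in> sets (haar A L)" and fin: "emeasure (haar A L) B < \<infinity>" for B
  proof -
    define X where "X = lie_exp A L -` main_part (distr lborel borel (lie_exp A L)) B"
    have X: "X \<in> sets borel" "emeasure (haar A L) B = emeasure lborel X"
      unfolding X_def by (rule haar_main_part[OF B])+
    show ?thesis
    proof (cases "P_H A L m e B UNIV")
      case (real p)
      then have "0 \<le> p" using P_H_nonneg[of A L m e B] by simp
      moreover have "(\<integral>x. indicator X x * D (e i) x \<partial>lborel) \<le> p"
        if "test_fun \<beta> D" "\<forall>x. \<bar>\<beta> x\<bar> \<le> 1" "i \<in> {1..m}" for \<beta> D i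
        using perimeter_ge[OF B that(1) _ that(3)] that(2) by (simp add: real X_def)
      ultimately have "measure lborel X powr ((real Q - 1) / real Q) \<le> C * p"
        using iso X fin by simp
      then show ?thesis by (simp add: real measure_def X(2))
    next
      case PInf
      then show ?thesis using C by simp
    next
      case MInf
      then show ?thesis using P_H_nonneg[of A L m e B] by simp
    qed
  qed
  then show ?thesis using C unfolding H_Caccioppoli_def by blast
next
  \<comment> \<open>Here every set of finite measure has measure 0. Its power is 0 even for exponent
    0, by the convention of \<open>powr\<close>, so any positive constant will do.\<close>
  case False
  interpret stratified_lie_group A L r V
    by unfold_locales (use assms in \<open>auto simp: carnot_group_def\<close>)
  have "measure (haar A L) B = 0"
    if B: "B \<in> sets (haar A L)" and fin: "emeasure (haar A L) B < \<infinity>" for B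
    using finite_measure_null_if_not_inj[OF False haar_main_part(1)[OF B]] fin
    by (simp add: haar_main_part(2)[OF B] measure_def)
  then show ?thesis
    unfolding H_Caccioppoli_def using P_H_nonneg[of A L m e] by (intro exI[of _ 1]) (auto simp: zero_ereal_def[symmetric])
qed

end
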